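(* Let $\rho^+,\rho^-\in\mathbb{R}$ be constants with $\rho^+\neq\rho^-$, let $0<\gamma<1$, and let $z_0\in C^{1,\gamma}(\mathbb{T})$ be an initial curve satisfying the arc-chord condition $\|\mathcal{F}(z_0)\|_{L^\infty}<\infty$. Then there is a time $T>0$ such that there exists a unique solution $$z\in C^1((-T,T);C^{1,\gamma}(\mathbb{T}))$$ of $$z_t(\alpha,t)=(\rho^--\rho^+)\int_{\mathbb{T}}\mathcal{S}(z(\alpha,t)-z(\beta,t))\cdot\partial_\beta z^\perp(\beta,t)\,z_2(\beta,t)\,d\beta,\qquad z(\alpha,0)=z_0(\alpha),$$ satisfying the arc-chord condition, i.e. $\|\mathcal{F}(z(\cdot,t))\|_{L^\infty}<\infty$ for $t\in(-T,T)$.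
   Context: $\mathbb{T}=\mathbb{R}/2\pi\mathbb{Z}$, identified with $[-\pi,\pi]$. Curves $z=(z_1,z_2)$ are horizontally periodic, meaning $z(\alpha+2\pi k)=(2\pi k,0)+z(\alpha)$ for $k\in\mathbb{Z}$, and $z\in C^{1,\gamma}(\mathbb{T})$ is understood for such curves. The norm is $\|z\|_{C^{1,\gamma}}=\|z\|_{L^\infty}+\|z_\alpha\|_{L^\infty}+|z_\alpha|_\gamma$, where $\|z\|_{L^\infty}=\sup_{\alpha\in\mathbb{T}}|z(\alpha)|$ and $|f|_\gamma=\max_{\alpha\ne\beta}\frac{|f(\alpha)-f(\beta)|}{|\alpha-\beta|^\gamma}$. Also $\partial_\beta z^\perp=(-\partial_\beta z_2,\partial_\beta z_1)$. The $x_1$-periodic Stokeslet is the $2\times2$ matrix kernel $$\mathcal{S}(y)=\frac{1}{8\pi}\log\big(2(\cosh y_2-\cos y_1)\big)\,I-\frac{y_2}{8\pi(\cosh y_2-\cos y_1)}\begin{pmatrix}-\sinh y_2&\sin y_1\\ \sin y_1&\sinh y_2\end{pmatrix}.$$ The arc-chord function is $$\mathcal{F}(z)(\alpha,\beta)=\frac{\beta^2}{\cosh(z_2(\alpha)-z_2(\alpha-\beta))-\cos(z_1(\alpha)-z_1(\alpha-\beta))}\quad\text{for }\alpha,\beta\in(-\pi,\pi),\ \beta\neq0,\qquad \mathcal{F}(z)(\alpha,0)=\frac{2}{|\partial_\alpha z(\alpha)|^2},$$ (with value $+\infty$ when a denominator vanishes), and $\|\mathcal{F}(z)\|_{L^\infty}=\sup_{\alpha,\beta\in\mathbb{T}}|\mathcal{F}(z)(\alpha,\beta)|$.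 *)

theory Defs
  imports "HOL-Analysis.Analysis"
begin

text \<open>
  Functions on the torus are functions on the real line subject to a periodicity condition;
  the fundamental domain is the closed interval below. A time-dependent curve is written
  \<^term>\<open>z t \<alpha>\<close>, time first.
\<close>

abbreviation torus :: "real set" where
  "torus \<equiv> {-pi..pi}"

definition horizontally_periodic :: "(real \<Rightarrow> real^2) \<Rightarrow> bool" where
  "horizontally_periodic z \<longleftrightarrow>
     (\<forall>\<alpha>. \<forall>k::int. z (\<alpha> + 2 * pi * of_int k) = vector [2 * pi * of_int k, 0] + z \<alpha>)"

definition periodic :: "(real \<Rightarrow> real^2) \<Rightarrow> bool" where
  "periodic f \<longleftrightarrow> (\<forall>\<alpha>. \<forall>k::int. f (\<alpha> + 2 * pi * of_int k) = f \<alpha>)"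

abbreviation dcurve :: "(real \<Rightarrow> real^2) \<Rightarrow> real \<Rightarrow> real^2" where
  "dcurve z \<alpha> \<equiv> vector_derivative z (at \<alpha>)"

definition holder_quotients :: "real \<Rightarrow> (real \<Rightarrow> real^2) \<Rightarrow> real set" where
  "holder_quotients \<gamma> f =
     {norm (f \<alpha> - f \<beta>) / \<bar>\<alpha> - \<beta>\<bar> powr \<gamma> | \<alpha> \<beta>. \<alpha> \<in> torus \<and> \<beta> \<in> torus \<and> \<alpha> \<noteq> \<beta>}"

definition holder_seminorm :: "real \<Rightarrow> (real \<Rightarrow> real^2) \<Rightarrow> real" where
  "holder_seminorm \<gamma> f = Sup (holder_quotients \<gamma> f)"

definition sup_norm :: "(real \<Rightarrow> real^2) \<Rightarrow> real" where
  "sup_norm f = (SUP \<alpha>\<in>torus. norm (f \<alpha>))"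

text \<open>
  The suprema are taken in the reals, so the norm is meaningful only for \<^term>\<open>f\<close> satisfying
  \<open>C1_holder\<close> (for which all of them are finite); it is used only on such functions.
\<close>

definition C1_holder :: "real \<Rightarrow> (real \<Rightarrow> real^2) \<Rightarrow> bool" where
  "C1_holder \<gamma> f \<longleftrightarrow> f C1_differentiable_on UNIV \<and> bdd_above (holder_quotients \<gamma> (dcurve f))"

definition C1_holder_norm :: "real \<Rightarrow> (real \<Rightarrow> real^2) \<Rightarrow> real" where
  "C1_holder_norm \<gamma> f = sup_norm f + sup_norm (dcurve f) + holder_seminorm \<gamma> (dcurve f)"

definition C1_holder_curve :: "real \<Rightarrow> (real \<Rightarrow> real^2) \<Rightarrow> bool" where
  "C1_holder_curve \<gamma> z \<longleftrightarrow> horizontally_periodic z \<and> C1_holder \<gamma> z"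

text \<open>
  Horizontally periodic curves form an affine space over the periodic functions, so the time
  derivative \<^term>\<open>z'\<close> takes periodic values. It is the limit of difference quotients in the
  Hoelder norm, uniformly in the curve parameter, and is continuous in that norm.
\<close>

definition C1_in_time ::
  "real \<Rightarrow> real \<Rightarrow> (real \<Rightarrow> real \<Rightarrow> real^2) \<Rightarrow> (real \<Rightarrow> real \<Rightarrow> real^2) \<Rightarrow> bool" where
  "C1_in_time \<gamma> T z z' \<longleftrightarrow>
     (\<forall>t\<in>{-T<..<T}. C1_holder_curve \<gamma> (z t)) \<and>
     (\<forall>t\<in>{-T<..<T}. periodic (z' t) \<and> C1_holder \<gamma> (z' t)) \<and>
     (\<forall>t\<in>{-T<..<T}.
        ((\<lambda>h. C1_holder_norm \<gamma> (\<lambda>\<alpha>. (z (t + h) \<alpha> - z t \<alpha>) /\<^sub>R h - z' t \<alpha>)) \<longlongrightarrow> 0) (at 0)) \<and>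
     (\<forall>t\<in>{-T<..<T}. ((\<lambda>s. C1_holder_norm \<gamma> (\<lambda>\<alpha>. z' s \<alpha> - z' t \<alpha>)) \<longlongrightarrow> 0) (at t))"

definition perp :: "real^2 \<Rightarrow> real^2" where
  "perp v = vector [- v$2, v$1]"

definition stokeslet :: "real^2 \<Rightarrow> real^2^2" where
  "stokeslet y =
     (1 / (8 * pi) * ln (2 * (cosh (y$2) - cos (y$1)))) *\<^sub>R mat 1
     - (y$2 / (8 * pi * (cosh (y$2) - cos (y$1)))) *\<^sub>R
         vector [vector [- sinh (y$2), sin (y$1)],
                 vector [sin (y$1), sinh (y$2)]]"

text \<open>
  Both numerators are positive, so division in \<^typ>\<open>ennreal\<close> gives the value infinity
  exactly when a denominator vanishes.
\<close>

definition arc_chord :: "(real \<Rightarrow> real^2) \<Rightarrow> real \<Rightarrow> real \<Rightarrow> ennreal" where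
  "arc_chord z \<alpha> \<beta> =
     (if \<beta> = 0 then 2 / ennreal ((norm (dcurve z \<alpha>))\<^sup>2)
      else ennreal (\<beta>\<^sup>2) /
           ennreal (cosh (z \<alpha> $ 2 - z (\<alpha> - \<beta>) $ 2) - cos (z \<alpha> $ 1 - z (\<alpha> - \<beta>) $ 1)))"

definition arc_chord_norm :: "(real \<Rightarrow> real^2) \<Rightarrow> ennreal" where
  "arc_chord_norm z = (SUP \<alpha>\<in>torus. SUP \<beta>\<in>torus. arc_chord z \<alpha> \<beta>)"

text \<open>
  For curves in the Hoelder class with finite arc-chord norm the integrand has only a
  logarithmic singularity at \<open>\<beta> = \<alpha>\<close> (modulo the period) and is Lebesgue integrable.
\<close>

definition stokes_velocity :: "real \<Rightarrow> real \<Rightarrow> (real \<Rightarrow> real^2) \<Rightarrow> real \<Rightarrow> real^2" where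
  "stokes_velocity \<rho>p \<rho>m z \<alpha> =
     (\<rho>m - \<rho>p) *\<^sub>R
       (LINT \<beta>:torus|lborel. (z \<beta> $ 2) *\<^sub>R (stokeslet (z \<alpha> - z \<beta>) *v perp (dcurve z \<beta>)))"

definition is_solution ::
  "real \<Rightarrow> real \<Rightarrow> real \<Rightarrow> (real \<Rightarrow> real^2) \<Rightarrow> real \<Rightarrow> (real \<Rightarrow> real \<Rightarrow> real^2) \<Rightarrow> bool" where
  "is_solution \<rho>p \<rho>m \<gamma> z0 T z \<longleftrightarrow>
     (\<exists>z'. C1_in_time \<gamma> T z z' \<and>
           (\<forall>t\<in>{-T<..<T}. \<forall>\<alpha>. z' t \<alpha> = stokes_velocity \<rho>p \<rho>m (z t) \<alpha>)) \<and>
     z 0 = z0 \<and>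
     (\<forall>t\<in>{-T<..<T}. arc_chord_norm (z t) < \<infinity>)"

end

theory Submission imports Defs begin

text \<open>
  Write \<open>S\<close> for the Stokeslet, \<open>V\<close> for the velocity integral without the factor \<open>\<kappa> = \<rho>\<^sup>- - \<rho>\<^sup>+\<close>, and a
  prime for the derivative in the curve parameter. Differentiating \<open>V\<close> naively produces a kernel of
  order -1 against a density that is only Hoelder continuous. The proof rests on the observation
  that no singular integral is needed. The rows of \<open>S\<close> are divergence free, hence
  \<open>S(y) u\<^sup>\<bottom>\<close> is the derivative in direction \<open>u\<close> of a potential \<open>F\<close>. Along a curve this makes
  \<open>S(z(\<alpha>) - z(\<beta>)) z'(\<beta>)\<^sup>\<bottom>\<close> an exact \<open>\<beta>\<close>-derivative, and an integration by parts gives, up to an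
  additive constant,
  \<open>V(\<alpha>) = \<integral> F(z(\<alpha>) - z(\<beta>)) z\<^sub>2'(\<beta>) d\<beta>\<close>. Therefore
  \<open>V'(\<alpha>) = W(\<alpha>) z'(\<alpha>)\<^sup>\<bottom>\<close> with \<open>W(\<alpha>) = \<integral> z\<^sub>2'(\<beta>) S(z(\<alpha>) - z(\<beta>)) d\<beta>\<close>, where the kernel is again
  only logarithmically singular; this is \<open>vel_has_derivative\<close>.

  The potential is not elementary: its second component is \<open>sin y\<^sub>1\<close> times the logarithm plus a
  remainder whose gradient extends continuously across the singularities. The remainder is
  obtained by integrating that gradient (\<open>rem_potential_has_derivative\<close>). It is periodic only up to
  a constant, which is all that the integration by parts needs. The formula for \<open>V'\<close> is first
  proved with \<open>e > 0\<close> added to \<open>cosh y\<^sub>2 - cos y\<^sub>1\<close>, where all integrands are continuous, and then \<open>e\<close> tends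
  to 0.

  The arc-chord condition bounds \<open>|2 sin((y\<^sub>1 + i y\<^sub>2)/2)|\<close>, taken at \<open>y = z(\<alpha>) - z(\<beta>)\<close>, from below
  by a multiple of \<open>|2 sin((\<alpha> - \<beta>)/2)|\<close>. In terms of the former quantity, increments of \<open>S\<close> are
  controlled by relative increments of \<open>y\<close> (\<open>stokeslet_holder\<close>). Consequently \<open>V\<close> and \<open>V'\<close> are
  locally Lipschitz functions of the curve in the \<open>C\<^sup>1\<close> norm (\<open>vel_dvel_lipschitz\<close>), and \<open>W\<close> is
  Hoelder continuous of every order below 1 with constants that depend on \<open>C\<^sup>1\<close> bounds alone
  (\<open>tangent_op_holder\<close>).

  So the equation is an ordinary differential equation in \<open>C\<^sup>1\<close>, solved by Picard iteration
  (\<open>C1_solution_exists\<close>). The Hoelder norm is propagated because \<open>z'\<close> solves, for each parameter,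
  the linear equation \<open>\<partial>\<^sub>t z' = \<kappa> W z'\<^sup>\<bottom>\<close> whose coefficient is Hoelder continuous. Continuity of
  \<open>V'\<close> in time with values in the Hoelder class follows by interpolating the Lipschitz bound for
  \<open>W\<close> in the supremum norm with a Hoelder bound of higher order (\<open>tangent_op_diff_holder\<close>). For
  uniqueness, two solutions that agree at one time agree nearby by the Lipschitz estimate, and the
  set of times of agreement is open and closed in the interval.
\<close>

section \<open>The kernel in complex form\<close>

text \<open>
  This is \<open>|2 sin((y\<^sub>1 + i y\<^sub>2)/2)|\<close>: a substitute for the Euclidean norm that has the period of
  the kernel and vanishes exactly at its singularities.
\<close>

definition chord :: "real^2 \<Rightarrow> real" where
  "chord y = sqrt (2 * (cosh (y$2) - cos (y$1)))"

definition half_angle_sine :: "real^2 \<Rightarrow> complex" where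
  "half_angle_sine y = 2 * sin (Complex (y$1) (y$2) / 2)"

text \<open>
  The real part and minus the imaginary part are \<open>y\<^sub>2 sin y\<^sub>1 / (cosh y\<^sub>2 - cos y\<^sub>1)\<close> and
  \<open>y\<^sub>2 sinh y\<^sub>2 / (cosh y\<^sub>2 - cos y\<^sub>1)\<close>, the entries of the bounded part of the Stokeslet. The complex
  form turns their increments into the addition theorem for the sine.
\<close>

definition half_angle_cot :: "real^2 \<Rightarrow> complex" where
  "half_angle_cot y = of_real (y$2) * cot (Complex (y$1) (y$2) / 2)"

lemma cos_le_cosh: "cos (a::real) \<le> cosh b"
  using cosh_real_ge_1[of b] cos_le_one[of a] by linarith

lemma norm_half_angle_sine: "norm (half_angle_sine y) = chord y"
proof -
  have "norm (half_angle_sine y)^2 = 2 * (cosh (y$2) - cos (y$1))"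
    by (simp add: half_angle_sine_def norm_mult power_mult_distrib norm_sin_squared cosh_def exp_minus field_simps)
  thus ?thesis unfolding chord_def by (metis norm_ge_zero real_sqrt_unique)
qed

lemma chord_nonneg [simp]: "0 \<le> chord y"
  by (simp add: norm_half_angle_sine[symmetric])

lemma chord_sq: "(chord y)^2 = 2 * (cosh (y$2) - cos (y$1))"
  using cos_le_cosh[of "y$1" "y$2"] by (simp add: chord_def)

lemma cosh_mono_abs: "\<bar>a\<bar> \<le> B \<Longrightarrow> cosh (a::real) \<le> cosh B"
  by (metis abs_ge_zero abs_of_nonneg cosh_real_abs cosh_real_nonneg_le_iff order_trans)

lemma square_le_cosh_minus_cos: "b^2 \<le> 2 * (cosh b - cos (a::real))"
proof -
  have "\<bar>b/2\<bar> \<le> \<bar>sinh (b/2)\<bar>"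
    using real_le_abs_sinh[of "b/2"] by (simp add: sinh_def exp_minus)
  hence "(b/2)^2 \<le> (sinh (b/2))^2" by (simp only: abs_le_square_iff)
  hence "b^2 \<le> 4 * (sinh (b/2))^2" by (simp add: power_divide field_simps)
  moreover have "cosh b = 1 + 2 * (sinh (b/2))^2"
    using cosh_double[of "b/2"] by (simp add: cosh_square_eq)
  moreover have "cos a \<le> 1" by simp
  ultimately show ?thesis by (smt (verit, best))
qed

lemma abs_le_chord: "\<bar>y$2\<bar> \<le> chord y"
  unfolding chord_def by (metis square_le_cosh_minus_cos real_sqrt_abs real_sqrt_le_iff)

lemma norm_complex_vec: "norm (Complex (y$1) (y$2)) = norm (y::real^2)"
  by (simp add: norm_vec_def L2_set_def sum_2 complex_norm)

lemma norm_cos_le: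
  assumes "\<bar>Im w\<bar> \<le> B" shows "norm (cos w) \<le> cosh B"
proof -
  have "norm (cos w)^2 = (cos (Re w))^2 + (sinh (Im w))^2" by (simp add: norm_cos_squared sinh_def exp_minus power_divide)
  also have "\<dots> \<le> 1 + (sinh (Im w))^2" by (simp add: abs_square_le_1)
  also have "\<dots> = (cosh (Im w))^2" by (simp add: cosh_square_eq)
  also have "\<dots> \<le> (cosh B)^2" using cosh_mono_abs[OF assms] by (intro power_mono) auto
  finally show ?thesis by (rule power2_le_imp_le) simp
qed

lemma half_angle_sine_lipschitz:
  assumes "\<bar>y$2\<bar> \<le> B" "\<bar>x$2\<bar> \<le> B"
  shows "norm (half_angle_sine y - half_angle_sine x) \<le> cosh B * norm (y - x)"
proof -
  let ?S = "{w. \<bar>Im w\<bar> \<le> B}"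
  have S: "?S = {w. Im w \<le> B} \<inter> {w. Im w \<ge> -B}" by auto
  have cv: "convex ?S" unfolding S
    by (intro convex_Int convex_halfspace_Im_le convex_halfspace_Im_ge)
  have "norm (2 * sin (Complex (y$1) (y$2) / 2) - 2 * sin (Complex (x$1) (x$2) / 2))
      \<le> cosh B * norm (Complex (y$1) (y$2) - Complex (x$1) (x$2))"
  proof (rule field_differentiable_bound[where f' = "\<lambda>w. cos (w/2)", OF cv])
    show "((\<lambda>w. 2 * sin (w / 2)) has_field_derivative cos (w / 2)) (at w within ?S)" for w :: complex
      by (auto intro!: derivative_eq_intros)
    show "norm (cos (w/2)) \<le> cosh B" if "w \<in> ?S" for w
      using that by (intro norm_cos_le) auto
  qed (use assms in auto)
  moreover have "Complex (y$1) (y$2) - Complex (x$1) (x$2) = Complex ((y-x)$1) ((y-x)$2)"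
    by (simp add: complex_eq_iff)
  ultimately show ?thesis using norm_complex_vec[of "y - x"] unfolding half_angle_sine_def by simp
qed

lemma half_angle_sine_0 [simp]: "half_angle_sine 0 = 0"
  by (simp add: half_angle_sine_def Complex_eq_0 flip: zero_complex.code)

lemma chord_lipschitz:
  assumes "\<bar>y$2\<bar> \<le> B" "\<bar>x$2\<bar> \<le> B"
  shows "\<bar>chord y - chord x\<bar> \<le> cosh B * norm (y - x)"
  using half_angle_sine_lipschitz[OF assms] norm_triangle_ineq3[of "half_angle_sine y" "half_angle_sine x"]
  by (simp add: norm_half_angle_sine)

lemma chord_0 [simp]: "chord 0 = 0" by (simp add: chord_def)

lemma chord_le: "\<bar>y$2\<bar> \<le> B \<Longrightarrow> chord y \<le> cosh B * norm y"
  using chord_lipschitz[of y B 0] abs_ge_zero[of "y$2"] by simp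

lemma cot_formula:
  "cot (Complex a b / 2) = Complex (sin a / (cosh b - cos a)) (- sinh b / (cosh b - cos a))"
proof (cases "cosh b = cos a")
  case True
  have "chord (vector [a, b]) = 0" by (simp add: chord_def True)
  hence "sin (Complex a b / 2) = 0" using norm_half_angle_sine[of "vector [a,b]"] by (simp add: half_angle_sine_def)
  hence "cot (Complex a b / 2) = 0" by (simp only: cot_def) simp
  thus ?thesis using True by (simp add: complex_eq_iff)
next
  case False
  let ?w = "Complex a b / 2"
  have n: "norm (half_angle_sine (vector [a,b]))^2 = 2 * (cosh b - cos a)" by (simp add: norm_half_angle_sine chord_sq)
  hence nz: "sin ?w \<noteq> 0" using False by (auto simp: half_angle_sine_def)
  have s: "sin ?w * cnj (sin ?w) = of_real ((cosh b - cos a)/2)"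
  proof -
    have "(norm (sin ?w))^2 = (cosh b - cos a)/2"
      using n by (simp add: half_angle_sine_def norm_mult power_mult_distrib)
    thus ?thesis by (metis complex_norm_square)
  qed
  have a: "?w + cnj ?w = of_real a" "?w - cnj ?w = \<i> * of_real b"
    by (auto simp: complex_eq_iff)
  have "2 * (cos ?w * sin (cnj ?w)) = sin (?w + cnj ?w) - sin (?w - cnj ?w)"
    by (simp add: sin_add sin_diff)
  also have "\<dots> = of_real (sin a) - \<i> * of_real (sinh b)"
    unfolding a by (simp add: complex_eq_iff Re_sin Im_sin sinh_def exp_minus field_simps power2_eq_square)
  finally have c: "cos ?w * cnj (sin ?w) = (of_real (sin a) - \<i> * of_real (sinh b))/2"
    by (simp add: cnj_sin field_simps)
  have "cot ?w = (cos ?w * cnj (sin ?w)) / (sin ?w * cnj (sin ?w))"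
    using nz by (simp add: cot_def)
  also have "\<dots> = Complex (sin a / (cosh b - cos a)) (- sinh b / (cosh b - cos a))"
  proof -
    define d where "d = cosh b - cos a"
    have "d \<noteq> 0" using False by (simp add: d_def)
    thus ?thesis unfolding s c d_def[symmetric] by (simp add: complex_eq_iff Re_divide_of_real Im_divide_of_real)
  qed
  finally show ?thesis .
qed

lemma norm_cot_le:
  assumes "\<bar>y$2\<bar> \<le> B"
  shows "norm (cot (Complex (y$1) (y$2) / 2)) \<le> 2 * cosh B / chord y"
proof -
  have "norm (cos (Complex (y$1) (y$2) / 2)) \<le> cosh B"
    using assms by (intro norm_cos_le) auto
  moreover have "norm (sin (Complex (y$1) (y$2) / 2)) = chord y / 2"
    using norm_half_angle_sine[of y] by (simp add: half_angle_sine_def norm_mult)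
  ultimately have "norm (cos (Complex (y$1) (y$2) / 2)) / norm (sin (Complex (y$1) (y$2) / 2)) \<le> cosh B / (chord y / 2)"
    by (simp only:) (intro divide_right_mono, auto)
  thus ?thesis by (simp add: cot_def norm_divide mult.commute)
qed

lemma norm_half_angle_cot_le:
  assumes "\<bar>y$2\<bar> \<le> B"
  shows "norm (half_angle_cot y) \<le> 2 * cosh B"
proof -
  have "norm (half_angle_cot y) \<le> chord y * (2 * cosh B / chord y)"
    unfolding half_angle_cot_def norm_mult using norm_cot_le[OF assms] abs_le_chord[of y]
    by (intro mult_mono) auto
  also have "\<dots> \<le> 2 * cosh B" using chord_nonneg[of y] by (cases "chord y = 0") auto
  finally show ?thesis .
qed

lemma cot_diff:
  fixes w v :: complex
  assumes "sin w \<noteq> 0" "sin v \<noteq> 0"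
  shows "cot w - cot v = sin (v - w) / (sin w * sin v)"
  using assms by (simp add: cot_def sin_diff field_simps)

text \<open>
  By \<open>cot w - cot v = sin (v - w) / (sin w sin v)\<close> an increment of the cotangent costs two factors
  \<open>1/chord\<close>. The prefactor \<open>y\<^sub>2\<close> is at most \<open>chord y\<close> and absorbs one of them.
\<close>

lemma half_angle_cot_diff_le:
  assumes B: "\<bar>y$2\<bar> \<le> B" "\<bar>x$2\<bar> \<le> B" and pos: "0 < chord y" "0 < chord x"
  shows "norm (half_angle_cot y - half_angle_cot x) \<le> 4 * cosh (2*B) * norm (y - x) / chord y"
proof -
  let ?w = "Complex (y$1) (y$2) / 2" and ?v = "Complex (x$1) (x$2) / 2"
  have B0: "0 \<le> B" using B by linarith
  have nz: "sin ?w \<noteq> 0" "sin ?v \<noteq> 0" using pos norm_half_angle_sine[of y] norm_half_angle_sine[of x] by (auto simp: half_angle_sine_def)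
  have "norm (half_angle_sine (x - y) - half_angle_sine 0) \<le> cosh (2*B) * norm ((x - y) - 0)"
    using B B0 by (intro half_angle_sine_lipschitz) auto
  moreover have "half_angle_sine (x - y) = 2 * sin (?v - ?w)"
    by (simp add: half_angle_sine_def diff_divide_distrib[symmetric]) (metis complex_diff)
  ultimately have s: "norm (2 * sin (?v - ?w)) \<le> cosh (2*B) * norm (y - x)"
    by (simp add: norm_minus_commute half_angle_sine_0)
  have "cot ?w - cot ?v = sin (?v - ?w) / (sin ?w * sin ?v)"
    by (rule cot_diff[OF nz])
  also have "\<dots> = 2 * (2 * sin (?v - ?w)) / (half_angle_sine y * half_angle_sine x)" by (simp add: half_angle_sine_def)
  finally have "norm (cot ?w - cot ?v) = 2 * norm (2 * sin (?v - ?w)) / (chord y * chord x)"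
    by (simp add: norm_divide norm_mult norm_half_angle_sine)
  also have "\<dots> \<le> 2 * (cosh (2*B) * norm (y - x)) / (chord y * chord x)"
    using s pos by (intro divide_right_mono mult_left_mono) auto
  finally have 1: "norm (cot ?w - cot ?v) \<le> 2 * (cosh (2*B) * norm (y - x)) / (chord y * chord x)" .
  have 2: "norm (cot ?w) \<le> 2 * cosh (2*B) / chord y"
    using B B0 by (intro norm_cot_le) auto
  have 3: "\<bar>y$2 - x$2\<bar> \<le> norm (y - x)"
    using component_le_norm_cart[of "y - x" 2] by simp
  have "half_angle_cot y - half_angle_cot x = of_real (y$2 - x$2) * cot ?w + of_real (x$2) * (cot ?w - cot ?v)"
    by (simp add: half_angle_cot_def algebra_simps)
  also have "norm \<dots> \<le> \<bar>y$2 - x$2\<bar> * norm (cot ?w) + \<bar>x$2\<bar> * norm (cot ?w - cot ?v)"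
    by (rule order_trans[OF norm_triangle_ineq]) (simp add: norm_mult flip: of_real_diff)
  also have "\<dots> \<le> norm (y - x) * (2 * cosh (2*B) / chord y)
      + chord x * (2 * (cosh (2*B) * norm (y - x)) / (chord y * chord x))"
    using 1 2 3 abs_le_chord[of x] by (intro add_mono mult_mono) auto
  also have "\<dots> = 4 * cosh (2*B) * norm (y - x) / chord y" using pos by (simp add: field_simps)
  finally show ?thesis .
qed

lemma ln_one_plus_le_powr:
  fixes x \<theta> :: real assumes "0 \<le> x" "0 < \<theta>" "\<theta> \<le> 1"
  shows "ln (1 + x) \<le> x powr \<theta> / \<theta>"
proof (cases "x \<le> 1")
  case True
  have "ln (1 + x) \<le> x" using assms(1) by (rule ln_add_one_self_le_self)
  also have "x \<le> x powr \<theta>" using assms True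
    using powr_mono'[of \<theta> 1 x] by (cases "x = 0") auto
  also have "\<dots> \<le> x powr \<theta> / \<theta>" using assms by (simp add: field_simps) (metis mult.commute mult_left_le powr_ge_zero)
  finally show ?thesis .
next
  case False
  have "\<theta> * ln (1 + x) = ln ((1+x) powr \<theta>)" using assms by (simp add: ln_powr)
  also have "(1+x) powr \<theta> \<le> 1 + x powr \<theta>"
  proof -
    have "1 = 1/(1+x) + x/(1+x)" using assms by (simp add: field_simps)
    also have "\<dots> \<le> (1/(1+x)) powr \<theta> + (x/(1+x)) powr \<theta>"
      using assms powr_mono'[of \<theta> 1 "1/(1+x)"] powr_mono'[of \<theta> 1 "x/(1+x)"]
      by (intro add_mono) auto
    also have "\<dots> = (1 + x powr \<theta>) / (1+x) powr \<theta>"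
      using assms by (simp add: powr_divide add_divide_distrib)
    finally show ?thesis using assms by (simp add: field_simps)
  qed
  hence "ln ((1+x) powr \<theta>) \<le> ln (1 + x powr \<theta>)" using assms
    by (subst ln_le_cancel_iff) (auto intro: add_pos_nonneg)
  also have "\<dots> \<le> x powr \<theta>" by (rule ln_add_one_self_le_self) simp
  finally show ?thesis using assms by (simp add: field_simps)
qed

text \<open>
  The power \<open>\<theta>\<close> lets one estimate serve both as a Lipschitz bound (\<open>\<theta> = 1\<close>) and as a Hoelder bound
  whose singularity \<open>\<theta> < 1\<close> keeps integrable.
\<close>

lemma ln_diff_le_powr:
  fixes u v \<theta> :: real assumes "0 < u" "0 < v" "0 < \<theta>" "\<theta> \<le> 1"
  shows "\<bar>ln u - ln v\<bar> \<le> (\<bar>u - v\<bar> / min u v) powr \<theta> / \<theta>"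
proof -
  have *: "ln u - ln v \<le> ((u - v)/v) powr \<theta> / \<theta>" if "0 < v" "v \<le> u" for u v :: real
  proof -
    have "ln u - ln v = ln (1 + (u - v)/v)" using that by (simp add: diff_divide_distrib ln_div)
    also have "\<dots> \<le> ((u - v)/v) powr \<theta> / \<theta>" using that assms by (intro ln_one_plus_le_powr) auto
    finally show ?thesis .
  qed
  show ?thesis
  proof (cases "v \<le> u")
    case True thus ?thesis using *[of v u] assms by (simp add: ln_le_cancel_iff)
  next
    case False thus ?thesis using *[of u v] assms by (simp add: ln_le_cancel_iff abs_minus_commute)
  qed
qed

definition reflM :: "real^2^2" where "reflM = vector [vector [1, 0], vector [0, -1]]"
definition swapM :: "real^2^2" where "swapM = vector [vector [0, 1], vector [1, 0]]"

lemma stokeslet_decomp: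
  "stokeslet y = (1/(8*pi)) *\<^sub>R ((2 * ln (chord y)) *\<^sub>R mat 1 - Im (half_angle_cot y) *\<^sub>R reflM - Re (half_angle_cot y) *\<^sub>R swapM)"
proof -
  have "ln (2 * (cosh (y$2) - cos (y$1))) = 2 * ln (chord y)"
  proof (cases "cosh (y$2) = cos (y$1)")
    case True thus ?thesis by (simp add: chord_def)
  next
    case False
    hence "2 * (cosh (y$2) - cos (y$1)) > 0" using cos_le_cosh[of "y$1" "y$2"] by simp
    thus ?thesis by (simp add: chord_def ln_sqrt)
  qed
  thus ?thesis
    by (simp add: stokeslet_def half_angle_cot_def cot_formula vec_eq_iff forall_2 reflM_def swapM_def mat_def algebra_simps)
qed

text \<open>
  Bounds the three constant matrices over which the Stokeslet decomposes, so that kernel estimates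
  reduce to the scalar coefficients.
\<close>

definition basis_norm :: real where "basis_norm = norm (mat 1 :: real^2^2) + norm reflM + norm swapM"

lemma basis_norm_nonneg: "0 \<le> basis_norm" by (simp add: basis_norm_def)

lemma norm_combination_le:
  assumes "\<bar>l\<bar> \<le> k" "norm w \<le> k"
  shows "norm ((1/(8*pi)) *\<^sub>R (l *\<^sub>R mat 1 - Im w *\<^sub>R reflM - Re w *\<^sub>R swapM)) \<le> k * basis_norm"
proof -
  have "k \<ge> 0" using assms(1) by linarith
  have "norm (l *\<^sub>R mat 1 - Im w *\<^sub>R reflM - Re w *\<^sub>R swapM) \<le>
      norm (l *\<^sub>R mat 1::real^2^2) + norm (Im w *\<^sub>R reflM) + norm (Re w *\<^sub>R swapM)"
    using norm_triangle_ineq4[of "l *\<^sub>R mat 1 - Im w *\<^sub>R reflM" "Re w *\<^sub>R swapM"]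
      norm_triangle_ineq4[of "l *\<^sub>R (mat 1::real^2^2)" "Im w *\<^sub>R reflM"] by linarith
  also have "\<dots> \<le> k * norm (mat 1::real^2^2) + k * norm reflM + k * norm swapM"
    using assms abs_Im_le_cmod[of w] abs_Re_le_cmod[of w]
    by (simp only: norm_scaleR) (intro add_mono mult_right_mono; linarith?; simp)
  finally have 1: "norm (l *\<^sub>R mat 1 - Im w *\<^sub>R reflM - Re w *\<^sub>R swapM) \<le> k * basis_norm"
    by (simp add: basis_norm_def algebra_simps)
  have "1 / (8*pi) \<le> 1" using pi_gt3 by (simp add: field_simps)
  hence "(1 / (8*pi)) * norm (l *\<^sub>R mat 1 - Im w *\<^sub>R reflM - Re w *\<^sub>R swapM) \<le> 1 * (k * basis_norm)"
    using 1 basis_norm_nonneg \<open>k \<ge> 0\<close> by (intro mult_mono) auto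
  thus ?thesis by simp
qed

text \<open>
  Near a singularity the coefficients of the kernel behave like functions that are homogeneous of
  degree zero, up to a logarithm, so their increments are governed by the relative increment \<open>|y - x| / min (chord y) (chord x)\<close>. For the bounded
  coefficients any power \<open>\<theta> \<le> 1\<close> of it suffices by interpolation with the trivial bound, for the
  logarithm by \<open>ln_diff_le_powr\<close>.
\<close>

lemma stokeslet_holder:
  assumes "0 < \<theta>" "\<theta> \<le> 1"
  obtains C where "0 \<le> C"
    "\<And>y x. \<lbrakk>\<bar>y$2\<bar> \<le> B; \<bar>x$2\<bar> \<le> B; 0 < chord y; 0 < chord x\<rbrakk> \<Longrightarrow>
       norm (stokeslet y - stokeslet x) \<le> C * (norm (y - x) / min (chord y) (chord x)) powr \<theta>"
proof
  define H where "H = cosh (2*B)"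
  have H1: "H \<ge> 1" by (simp add: H_def cosh_real_ge_1)
  let ?C = "(2/\<theta>) * H powr \<theta> + 4 * H"
  show "0 \<le> ?C * basis_norm" using assms H1 basis_norm_nonneg by auto
  fix y x :: "real^2"
  assume B: "\<bar>y$2\<bar> \<le> B" "\<bar>x$2\<bar> \<le> B" and pos: "0 < chord y" "0 < chord x"
  have B0: "0 \<le> B" using B by linarith
  define r where "r = norm (y - x) / min (chord y) (chord x)"
  have r0: "0 \<le> r" using pos by (auto simp: r_def)
  have HB: "cosh B \<le> H" unfolding H_def using B0 by (intro cosh_mono_abs) auto
  have "\<bar>ln (chord y) - ln (chord x)\<bar> \<le> (\<bar>chord y - chord x\<bar> / min (chord y) (chord x)) powr \<theta> / \<theta>"
    using pos assms by (rule ln_diff_le_powr)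
  also have "\<dots> \<le> (H * r) powr \<theta> / \<theta>"
  proof -
    have "\<bar>chord y - chord x\<bar> \<le> H * norm (y - x)"
      using chord_lipschitz[OF B] HB by (meson mult_right_mono norm_ge_zero order_trans)
    thus ?thesis using assms pos unfolding r_def
      by (intro divide_right_mono powr_mono2) (auto simp: divide_right_mono)
  qed
  finally have l: "\<bar>2 * ln (chord y) - 2 * ln (chord x)\<bar> \<le> (2/\<theta>) * H powr \<theta> * r powr \<theta>"
    using r0 H1 by (simp add: powr_mult field_simps)
  have d: "norm (half_angle_cot y - half_angle_cot x) \<le> 4 * H * r powr \<theta>"
  proof (cases "r \<le> 1")
    case True
    have "norm (half_angle_cot y - half_angle_cot x) \<le> 4 * H * norm (y - x) / chord y"
      using half_angle_cot_diff_le[OF B pos] by (simp add: H_def)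
    also have "\<dots> \<le> 4 * H * r"
      using H1 pos unfolding r_def by (simp add: frac_le)
    also have "r \<le> r powr \<theta>" using powr_mono'[of \<theta> 1 r] assms True r0 by (cases "r = 0") auto
    finally show ?thesis using H1 by simp
  next
    case False
    have "norm (half_angle_cot y - half_angle_cot x) \<le> norm (half_angle_cot y) + norm (half_angle_cot x)" by (rule norm_triangle_ineq4)
    also have "\<dots> \<le> 2 * cosh B + 2 * cosh B" using norm_half_angle_cot_le B by (intro add_mono) auto
    also have "\<dots> \<le> 4 * H * 1" using HB by simp
    also have "\<dots> \<le> 4 * H * r powr \<theta>" using H1 False assms by (intro mult_left_mono ge_one_powr_ge_zero) auto
    finally show ?thesis .
  qed
  have "stokeslet y - stokeslet x = (1/(8*pi)) *\<^sub>R ((2 * ln (chord y) - 2 * ln (chord x)) *\<^sub>R mat 1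
      - Im (half_angle_cot y - half_angle_cot x) *\<^sub>R reflM - Re (half_angle_cot y - half_angle_cot x) *\<^sub>R swapM)"
    unfolding stokeslet_decomp by (simp add: algebra_simps)
  also have "norm \<dots> \<le> (?C * r powr \<theta>) * basis_norm"
  proof (rule norm_combination_le)
    show "\<bar>2 * ln (chord y) - 2 * ln (chord x)\<bar> \<le> ?C * r powr \<theta>"
      using l H1 unfolding distrib_right by (rule_tac order_trans[OF l]) simp
    show "norm (half_angle_cot y - half_angle_cot x) \<le> ?C * r powr \<theta>"
      using d assms unfolding distrib_right by (rule_tac order_trans[OF d]) simp
  qed
  finally show "norm (stokeslet y - stokeslet x) \<le> ?C * basis_norm * r powr \<theta>" by (simp add: mult_ac)
qed

text \<open>
  The logarithm is dominated by a power; the exponent -1/2 is one convenient integrable choice.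
  At a singularity both sides vanish, by the conventions for \<open>ln 0\<close>, division by zero and \<open>0 powr a\<close>.
\<close>

lemma stokeslet_bound:
  obtains C where "0 \<le> C"
    "\<And>y. \<lbrakk>\<bar>y$2\<bar> \<le> B\<rbrakk> \<Longrightarrow> norm (stokeslet y) \<le> C * chord y powr (-1/2)"
proof
  define Q where "Q = sqrt (2 * (cosh B + 1)) + 1"
  define C where "C = 4 * Q + 2 * cosh B * Q"
  have Q1: "Q \<ge> 1" by (simp add: Q_def)
  have C0: "C \<ge> 0" using Q1 by (simp add: C_def)
  show "0 \<le> C * basis_norm" using C0 basis_norm_nonneg by auto
  fix y :: "real^2" assume B: "\<bar>y$2\<bar> \<le> B"
  show "norm (stokeslet y) \<le> C * basis_norm * chord y powr (-1/2)"
  proof (cases "chord y = 0")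
    case True
    hence "cosh (y$2) = cos (y$1)" using cos_le_cosh[of "y$1" "y$2"] by (simp add: chord_def)
    hence "stokeslet y = 0" by (simp add: stokeslet_def)
    thus ?thesis using True by simp
  next
    case False
    define q where "q = chord y"
    have q: "q > 0" using False chord_nonneg[of y] by (simp add: q_def less_le)
    have "cosh (y$2) - cos (y$1) \<le> cosh B - (-1)"
      using cosh_mono_abs[OF B] by (intro diff_mono) auto
    hence "2 * (cosh (y$2) - cos (y$1)) \<le> 2 * (cosh B + 1)" by simp
    hence qQ: "q \<le> Q" unfolding q_def chord_def Q_def
      by (smt (verit) real_sqrt_le_iff)
    have e: "q powr (1/2) \<le> Q * q powr (-1/2)"
      using q qQ by (simp add: powr_minus powr_half_sqrt field_simps)
    have Qp: "1 \<le> Q * q powr (-1/2)"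
    proof -
      have "q powr (1/2) \<le> Q powr (1/2)" using q qQ by (intro powr_mono2) auto
      also have "\<dots> \<le> Q powr 1" using Q1 by (intro powr_mono) auto
      finally have "q powr (1/2) \<le> Q" using Q1 by simp
      thus ?thesis using q by (simp add: powr_minus field_simps)
    qed
    have "\<bar>ln q\<bar> \<le> 2 * Q * q powr (-1/2)"
    proof (cases "q \<ge> 1")
      case True
      have "ln q = ln (1 + (q-1))" by simp
      also have "\<dots> \<le> (q - 1) powr (1/2) / (1/2)" using True by (intro ln_one_plus_le_powr) auto
      also have "\<dots> \<le> q powr (1/2) / (1/2)" using True by (intro divide_right_mono powr_mono2) auto
      finally show ?thesis using e True by simp
    next
      case False
      have "- ln q = ln (1 + (1/q - 1))" using q by (simp add: ln_div)
      also have "\<dots> \<le> (1/q - 1) powr (1/2) / (1/2)" using False q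
        by (intro ln_one_plus_le_powr) (auto simp: field_simps)
      also have "\<dots> \<le> (1/q) powr (1/2) / (1/2)" using False q
        by (intro divide_right_mono powr_mono2) (auto simp: field_simps)
      also have "\<dots> = 2 * q powr (-1/2)" using q by (simp add: powr_divide powr_minus field_simps)
      also have "\<dots> \<le> 2 * Q * q powr (-1/2)" using Q1
        by (intro mult_right_mono) auto
      finally show ?thesis using False q by (simp add: abs_if)
    qed
    hence 1: "\<bar>2 * ln q\<bar> \<le> 4 * Q * q powr (-1/2)" by (simp add: abs_mult)
    have "norm (half_angle_cot y) \<le> 2 * cosh B * 1" using norm_half_angle_cot_le[OF B] by simp
    also have "\<dots> \<le> 2 * cosh B * (Q * q powr (-1/2))" using Qp by (intro mult_left_mono) auto
    finally have 2: "norm (half_angle_cot y) \<le> 2 * cosh B * Q * q powr (-1/2)" by simp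
    have "norm (stokeslet y) \<le> (C * q powr (-1/2)) * basis_norm"
      unfolding stokeslet_decomp using 1 2 Q1 unfolding q_def[symmetric] C_def
      by (intro norm_combination_le) (auto simp: algebra_simps intro!: add_increasing add_increasing2)
    thus ?thesis by (simp add: q_def mult_ac)
  qed
qed

section \<open>Weakly singular integrals over the circle\<close>

text \<open>
  The length of the chord between two points of the unit circle at angle \<open>x\<close>. Measuring parameter
  distances by it makes the arc-chord bound periodic in both parameters.
\<close>

definition circle_chord :: "real \<Rightarrow> real" where "circle_chord x = \<bar>2 * sin (x/2)\<bar>"

lemma circle_chord_nonneg [simp]: "0 \<le> circle_chord x" by (simp add: circle_chord_def)

lemma circle_chord_periodic: "circle_chord (x + 2 * pi * of_int k) = circle_chord x"
proof -
  have "(x + 2 * pi * of_int k)/2 = x/2 + of_int k * pi" by (simp add: field_simps)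
  moreover have s: "sin (of_int k * pi) = 0" by (auto simp: sin_zero_iff_int2)
  moreover have "\<bar>cos (of_int k * pi)\<bar> = 1"
    using sin_cos_squared_add[of "of_int k * pi"] unfolding s by (simp add: power2_eq_1_iff) auto
  ultimately show ?thesis unfolding circle_chord_def abs_mult by (simp only:) (simp add: sin_add abs_mult)
qed

lemma circle_chord_le: "circle_chord x \<le> \<bar>x\<bar>"
  using abs_sin_x_le_abs_x[of "x/2"] by (simp add: circle_chord_def abs_mult)

text \<open>
  Jordan's inequality, from concavity of the sine.
\<close>

lemma sin_ge_linear:
  assumes "0 \<le> x" "x \<le> pi/2" shows "2/pi * x \<le> sin x"
proof -
  have "convex_on {0..pi/2} (\<lambda>x. - sin x)"
  proof (rule convex_on_realI[where f' = "\<lambda>x. - cos x"])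
    show "- cos x \<le> - cos y" if "x \<in> {0..pi/2}" "y \<in> {0..pi/2}" "x \<le> y" for x y :: real
      using that by (auto intro!: cos_monotone_0_pi_le)
  qed (auto intro!: derivative_eq_intros)
  from convex_onD[OF this, of "2/pi * x" 0 "pi/2"] assms
  show ?thesis by (simp add: field_simps)
qed

lemma abs_le_circle_chord:
  assumes "\<bar>x\<bar> \<le> pi" shows "\<bar>x\<bar> \<le> pi/2 * circle_chord x"
proof -
  have "2/pi * (\<bar>x\<bar>/2) \<le> sin (\<bar>x\<bar>/2)" using assms by (intro sin_ge_linear) auto
  moreover have "sin (\<bar>x\<bar>/2) \<le> \<bar>sin (x/2)\<bar>" by (cases "x \<ge> 0") auto
  ultimately have "2/pi * (\<bar>x\<bar>/2) \<le> \<bar>sin (x/2)\<bar>" by linarith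
  thus ?thesis by (simp add: circle_chord_def abs_mult field_simps)
qed

lemma reduce_mod_2pi:
  obtains k :: int where "\<bar>x + 2 * pi * of_int k\<bar> \<le> pi"
proof
  let ?k = "- round (x / (2*pi))"
  have "\<bar>of_int (round (x/(2*pi))) - x/(2*pi)\<bar> \<le> 1/2" by (rule of_int_round_abs_le)
  hence "2*pi * \<bar>of_int (round (x/(2*pi))) - x/(2*pi)\<bar> \<le> 2*pi*(1/2)" by (intro mult_left_mono) auto
  also have "2*pi * \<bar>of_int (round (x/(2*pi))) - x/(2*pi)\<bar> = \<bar>2*pi * (of_int (round (x/(2*pi))) - x/(2*pi))\<bar>"
    by (simp add: abs_mult)
  finally show "\<bar>x + 2 * pi * of_int ?k\<bar> \<le> pi"
    by (simp add: algebra_simps abs_minus_commute)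
qed

lemma AE_circle_chord_pos: "AE \<beta> in lborel. 0 < circle_chord (\<alpha> - \<beta>)"
proof -
  let ?N = "range (\<lambda>i::int. \<alpha> - 2 * pi * of_int i)"
  have "countable ?N" by simp
  hence "?N \<in> null_sets lborel" by (rule countable_imp_null_set_lborel)
  thus ?thesis
  proof (rule AE_I')
    show "{\<beta> \<in> space lborel. \<not> 0 < circle_chord (\<alpha> - \<beta>)} \<subseteq> ?N"
    proof
      fix \<beta> assume "\<beta> \<in> {\<beta> \<in> space lborel. \<not> 0 < circle_chord (\<alpha> - \<beta>)}"
      hence "sin ((\<alpha> - \<beta>)/2) = 0" by (auto simp: circle_chord_def)
      then obtain i :: int where "(\<alpha> - \<beta>)/2 = of_int i * pi" by (auto simp: sin_zero_iff_int2)
      hence "\<beta> = \<alpha> - 2 * pi * of_int i" by (simp add: field_simps)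
      thus "\<beta> \<in> ?N" by blast
    qed
  qed
qed

lemma set_integral_dominated:
  fixes f :: "real \<Rightarrow> 'a::{banach, second_countable_topology}"
  assumes f: "f \<in> borel_measurable borel" and g: "set_integrable lborel S g" and S: "S \<in> sets borel"
    and le: "AE \<beta> in lborel. \<beta> \<in> S \<longrightarrow> norm (f \<beta>) \<le> g \<beta>"
  shows "set_integrable lborel S f" "norm (LINT \<beta>:S|lborel. f \<beta>) \<le> (LINT \<beta>:S|lborel. g \<beta>)"
proof -
  show 1: "set_integrable lborel S f"
    unfolding set_integrable_def
  proof (rule Bochner_Integration.integrable_bound[OF g[unfolded set_integrable_def]])
    show "(\<lambda>x. indicat_real S x *\<^sub>R f x) \<in> borel_measurable lborel" using f S by measurable
    show "AE x in lborel. norm (indicat_real S x *\<^sub>R f x) \<le> norm (indicat_real S x *\<^sub>R g x)"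
      using le by eventually_elim (auto simp: indicator_def)
  qed
  have "norm (LINT \<beta>:S|lborel. f \<beta>) \<le> (LINT \<beta>|lborel. norm (indicat_real S \<beta> *\<^sub>R f \<beta>))"
    unfolding set_lebesgue_integral_def by (rule integral_norm_bound)
  also have "\<dots> \<le> (LINT \<beta>:S|lborel. g \<beta>)"
    unfolding set_lebesgue_integral_def
  proof (intro integral_mono_AE integrable_norm 1[unfolded set_integrable_def] g[unfolded set_integrable_def])
    show "AE x in lborel. norm (indicat_real S x *\<^sub>R f x) \<le> indicat_real S x *\<^sub>R g x"
      using le by eventually_elim (auto simp: indicator_def)
  qed
  finally show "norm (LINT \<beta>:S|lborel. f \<beta>) \<le> (LINT \<beta>:S|lborel. g \<beta>)" .
qed

lemma set_integrable_abs_powr: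
  fixes a R :: real assumes "a > -1" "R \<ge> 0"
  shows "set_integrable lborel {-R..R} (\<lambda>x. \<bar>x\<bar> powr a)"
proof -
  have 1: "(\<lambda>x. x powr a) integrable_on {0..R}"
    using has_integral_powr_from_0[OF assms] by blast
  have 2: "(\<lambda>x. \<bar>x\<bar> powr a) integrable_on {0..R}"
    using 1 by (rule integrable_eq) auto
  have "(\<lambda>x. (-x) powr a) integrable_on {-R..-0}"
    using 1 by (subst Henstock_Kurzweil_Integration.integrable_reflect_real) simp
  hence 3: "(\<lambda>x. \<bar>x\<bar> powr a) integrable_on {-R..0}"
    by (simp, rule_tac integrable_eq) auto
  have "(\<lambda>x. \<bar>x\<bar> powr a) integrable_on {-R..R}"
    using 3 2 assms by (intro Henstock_Kurzweil_Integration.integrable_combine[of "-R" 0 R]) auto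
  hence "(\<lambda>x. \<bar>x\<bar> powr a) absolutely_integrable_on {-R..R}"
    by (intro nonnegative_absolutely_integrable_1) auto
  hence "integrable lebesgue (\<lambda>x. indicat_real {-R..R} x *\<^sub>R \<bar>x\<bar> powr a)"
    by (simp add: set_integrable_def)
  thus ?thesis unfolding set_integrable_def
    by (subst (asm) integrable_completion) auto
qed

text \<open>
  For \<open>\<alpha>\<close> and \<open>\<beta>\<close> in the fundamental domain the difference lies in \<open>[-2\<pi>, 2\<pi>]\<close>, where the chord length
  vanishes at \<open>0\<close> and at both ends. A majorant is a sum of three translates of \<open>|u| powr (-\<theta>)\<close>, cut off
  to \<open>[-4\<pi>, 4\<pi>]\<close>, whose integral does not depend on the translation.
\<close>

lemma circle_chord_powr_integral:
  assumes "0 \<le> \<theta>" "\<theta> < 1"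
  obtains C where "0 \<le> C" "\<And>\<alpha>. set_integrable lborel torus (\<lambda>\<beta>. circle_chord (\<alpha> - \<beta>) powr (-\<theta>))"
    "\<And>\<alpha>. (LINT \<beta>:torus|lborel. circle_chord (\<alpha> - \<beta>) powr (-\<theta>)) \<le> C"
proof -
  define J where "J u = indicat_real {-(4*pi)..4*pi} u * \<bar>u\<bar> powr (-\<theta>)" for u
  have intJ: "integrable lborel J"
    using set_integrable_abs_powr[of "-\<theta>" "4*pi"] assms unfolding set_integrable_def J_def by simp
  have intJ': "integrable lborel (\<lambda>\<beta>. J (a - \<beta>))" for a
    using lborel_integrable_real_affine[OF intJ, of "-1" a] by simp
  have eqJ: "(LINT \<beta>|lborel. J (a - \<beta>)) = (LINT \<beta>|lborel. J \<beta>)" for a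
    using lborel_integral_real_affine[of "-1" J a] by simp
  have J0: "0 \<le> J u" for u by (simp add: J_def)
  define c where "c = (pi/2) powr \<theta>"
  have c0: "0 \<le> c" by (simp add: c_def)
  define g where "g \<alpha> \<beta> = c * (J (\<alpha> - \<beta>) + J (\<alpha> - 2*pi - \<beta>) + J (\<alpha> + 2*pi - \<beta>))" for \<alpha> \<beta>
  have gint: "integrable lborel (g \<alpha>)" for \<alpha>
    unfolding g_def by (intro integrable_mult_right integrable_add) (use intJ' in auto)
  have gset: "set_integrable lborel torus (g \<alpha>)" for \<alpha>
    unfolding set_integrable_def by (intro integrable_mult_indicator gint) auto
  have gI: "(LINT \<beta>:torus|lborel. g \<alpha> \<beta>) \<le> 3 * c * (LINT \<beta>|lborel. J \<beta>)" for \<alpha>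
  proof -
    have "(LINT \<beta>:torus|lborel. g \<alpha> \<beta>) \<le> (LINT \<beta>|lborel. g \<alpha> \<beta>)"
      unfolding set_lebesgue_integral_def using gset[of \<alpha>] J0 c0
      by (intro integral_mono gint) (auto simp: set_integrable_def indicator_def g_def)
    also have "\<dots> = c * ((LINT \<beta>|lborel. J (\<alpha> - \<beta>)) + (LINT \<beta>|lborel. J (\<alpha> - 2*pi - \<beta>)) + (LINT \<beta>|lborel. J (\<alpha> + 2*pi - \<beta>)))"
      unfolding g_def using intJ' by simp
    also have "\<dots> = 3 * c * (LINT \<beta>|lborel. J \<beta>)" unfolding eqJ by simp
    finally show ?thesis .
  qed
  have le: "circle_chord (\<alpha> - \<beta>) powr (-\<theta>) \<le> g \<alpha> \<beta>" if "\<alpha> \<in> torus" "\<beta> \<in> torus" for \<alpha> \<beta>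
  proof -
    have *: "circle_chord (\<alpha> - \<beta>) powr (-\<theta>) \<le> c * J u" if u: "circle_chord u = circle_chord (\<alpha> - \<beta>)" "\<bar>u\<bar> \<le> pi" for u
    proof (cases "u = 0")
      case True
      hence "circle_chord (\<alpha> - \<beta>) = 0" using u by (simp add: circle_chord_def)
      thus ?thesis using J0 c0 by simp
    next
      case False
      have "circle_chord u \<ge> \<bar>u\<bar> / (pi/2)" using abs_le_circle_chord[OF u(2)] by (simp add: field_simps)
      hence "circle_chord u powr (-\<theta>) \<le> (\<bar>u\<bar> / (pi/2)) powr (-\<theta>)"
        using False assms by (intro powr_mono2') auto
      also have "\<dots> = c * \<bar>u\<bar> powr (-\<theta>)"
        by (simp add: powr_divide c_def powr_minus field_simps powr_mult)
      also have "\<bar>u\<bar> powr (-\<theta>) = J u" using u(2) pi_gt_zero by (auto simp: J_def indicator_def abs_le_iff)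
      finally show ?thesis by (simp add: u)
    qed
    consider "\<bar>\<alpha> - \<beta>\<bar> \<le> pi" | "\<alpha> - \<beta> > pi" | "\<alpha> - \<beta> < - pi" by linarith
    thus ?thesis
    proof cases
      case 1 thus ?thesis using *[of "\<alpha> - \<beta>"] J0 c0 unfolding g_def distrib_left by (simp add: add_increasing2)
    next
      case 2
      have "circle_chord (\<alpha> - 2*pi - \<beta>) = circle_chord (\<alpha> - \<beta>)" using circle_chord_periodic[of "\<alpha> - \<beta>" "-1"] by (simp add: algebra_simps)
      thus ?thesis using *[of "\<alpha> - 2*pi - \<beta>"] 2 that J0 c0 unfolding g_def distrib_left
        by (simp add: abs_le_iff add_increasing2 add_increasing)
    next
      case 3
      have "circle_chord (\<alpha> + 2*pi - \<beta>) = circle_chord (\<alpha> - \<beta>)" using circle_chord_periodic[of "\<alpha> - \<beta>" "1"] by (simp add: algebra_simps)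
      thus ?thesis using *[of "\<alpha> + 2*pi - \<beta>"] 3 that J0 c0 unfolding g_def distrib_left
        by (simp add: abs_le_iff add_increasing2 add_increasing)
    qed
  qed
  have meas: "(\<lambda>\<beta>. circle_chord (\<alpha> - \<beta>) powr (-\<theta>)) \<in> borel_measurable borel" for \<alpha>
    unfolding circle_chord_def by measurable
  have main: "set_integrable lborel torus (\<lambda>\<beta>. circle_chord (\<alpha> - \<beta>) powr (-\<theta>)) \<and>
     (LINT \<beta>:torus|lborel. circle_chord (\<alpha> - \<beta>) powr (-\<theta>)) \<le> 3 * c * (LINT \<beta>|lborel. J \<beta>)"
    if a: "\<alpha> \<in> torus" for \<alpha>
  proof -
    have "AE \<beta> in lborel. \<beta> \<in> torus \<longrightarrow> norm (circle_chord (\<alpha> - \<beta>) powr (-\<theta>)) \<le> g \<alpha> \<beta>"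
      using le[OF a] by (intro AE_I2) auto
    note d = set_integral_dominated[OF meas gset _ this]
    show ?thesis using d gI[of \<alpha>] by (auto simp: abs_le_iff)
  qed
  show thesis
  proof
    show "0 \<le> 3 * c * (LINT \<beta>|lborel. J \<beta>)" using c0 J0 by (simp add: integral_nonneg_AE)
    fix \<alpha>
    obtain k :: int where k: "\<bar>\<alpha> + 2 * pi * of_int k\<bar> \<le> pi" using reduce_mod_2pi by blast
    have "circle_chord (\<alpha> + 2 * pi * of_int k - \<beta>) = circle_chord (\<alpha> - \<beta>)" for \<beta>
      using circle_chord_periodic[of "\<alpha> - \<beta>" k] by (simp add: algebra_simps)
    moreover have "\<alpha> + 2 * pi * of_int k \<in> torus" using k by (auto simp: abs_le_iff)
    ultimately show "set_integrable lborel torus (\<lambda>\<beta>. circle_chord (\<alpha> - \<beta>) powr (-\<theta>))"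
      "(LINT \<beta>:torus|lborel. circle_chord (\<alpha> - \<beta>) powr (-\<theta>)) \<le> 3 * c * (LINT \<beta>|lborel. J \<beta>)"
      using main[of "\<alpha> + 2 * pi * of_int k"] by auto
  qed
qed

section \<open>Horizontally periodic curves\<close>

lemma vec2_eq_iff: "(v::real^2) = w \<longleftrightarrow> v$1 = w$1 \<and> v$2 = w$2"
  by (simp add: vec_eq_iff forall_2)

lemma C1_onD:
  assumes "z C1_differentiable_on UNIV"
  shows "(z has_vector_derivative dcurve z \<alpha>) (at \<alpha>)" "continuous_on UNIV (dcurve z)"
    "continuous_on UNIV z" "dcurve z \<in> borel_measurable borel" "z \<in> borel_measurable borel"
proof -
  show 1: "(z has_vector_derivative dcurve z \<alpha>) (at \<alpha>)" for \<alpha>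
    using assms by (auto simp: C1_differentiable_on_eq vector_derivative_works[symmetric])
  show 2: "continuous_on UNIV (dcurve z)" using assms by (auto simp: C1_differentiable_on_eq)
  show 3: "continuous_on UNIV z"
    using 1 by (auto intro!: continuous_at_imp_continuous_on has_vector_derivative_continuous)
  show "dcurve z \<in> borel_measurable borel" "z \<in> borel_measurable borel"
    using 2 3 by (auto intro: borel_measurable_continuous_onI)
qed

lemma C1_onI:
  assumes "\<And>\<alpha>. (z has_vector_derivative p \<alpha>) (at \<alpha>)" "continuous_on UNIV p"
  shows "z C1_differentiable_on UNIV" "dcurve z = p"
  using assms by (auto simp: C1_differentiable_on_def vector_derivative_at)

lemma periodic_derivative:
  fixes f :: "real \<Rightarrow> real^2"
  assumes "periodic f" "\<And>\<alpha>. (f has_vector_derivative p \<alpha>) (at \<alpha>)"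
  shows "periodic p"
  unfolding periodic_def
proof (intro allI)
  fix \<alpha> and k :: int
  have "((\<lambda>a. f (a + 2 * pi * of_int k)) has_vector_derivative p (\<alpha> + 2 * pi * of_int k)) (at \<alpha>)"
  proof -
    have "((\<lambda>a. a + 2 * pi * of_int k) has_vector_derivative 1) (at \<alpha>)"
      by (auto intro!: derivative_eq_intros)
    from vector_diff_chain_at[OF this assms(2)] show ?thesis by (simp add: o_def)
  qed
  moreover have "(\<lambda>a. f (a + 2 * pi * of_int k)) = f" using assms(1) by (auto simp: periodic_def)
  ultimately show "p (\<alpha> + 2 * pi * of_int k) = p \<alpha>"
    using assms(2)[of \<alpha>] vector_derivative_unique_at by metis
qed

lemma hp_diff_periodic:
  "horizontally_periodic z \<Longrightarrow> horizontally_periodic w \<Longrightarrow> periodic (\<lambda>\<alpha>. z \<alpha> - w \<alpha>)"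
  by (simp add: horizontally_periodic_def periodic_def)

lemma hp_add_periodic:
  "horizontally_periodic z \<Longrightarrow> periodic f \<Longrightarrow> horizontally_periodic (\<lambda>\<alpha>. z \<alpha> + f \<alpha>)"
  by (simp add: horizontally_periodic_def periodic_def)

lemma hp_id: "horizontally_periodic (\<lambda>\<alpha>. vector [\<alpha>, 0])"
  by (simp add: horizontally_periodic_def vec2_eq_iff)

lemma hp_dcurve_periodic:
  assumes "horizontally_periodic z" "z C1_differentiable_on UNIV"
  shows "periodic (dcurve z)"
proof -
  have e: "((\<lambda>\<alpha>. vector [\<alpha>, 0] :: real^2) has_vector_derivative axis 1 1) (at \<alpha>)" for \<alpha>
  proof -
    have "(\<lambda>\<alpha>. vector [\<alpha>, 0] :: real^2) = (\<lambda>\<alpha>. \<alpha> *\<^sub>R axis 1 1)"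
      by (auto simp: vec2_eq_iff axis_def)
    thus ?thesis by (auto intro!: derivative_eq_intros)
  qed
  have "periodic (\<lambda>\<alpha>. dcurve z \<alpha> - axis 1 1)"
    by (rule periodic_derivative[OF hp_diff_periodic[OF assms(1) hp_id]])
      (intro has_vector_derivative_diff C1_onD(1)[OF assms(2)] e)
  thus ?thesis by (simp add: periodic_def)
qed

lemma periodic_bound_torus:
  assumes "periodic f" "\<And>\<alpha>. \<alpha> \<in> torus \<Longrightarrow> P (f \<alpha>)" shows "P (f \<alpha>)"
proof -
  obtain k :: int where k: "\<bar>\<alpha> + 2 * pi * of_int k\<bar> \<le> pi" using reduce_mod_2pi by blast
  hence "P (f (\<alpha> + 2 * pi * of_int k))" by (intro assms(2)) (auto simp: abs_le_iff)
  thus ?thesis using assms(1) by (simp add: periodic_def)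
qed

lemma lipschitz_of_derivative:
  fixes f :: "real \<Rightarrow> real^2"
  assumes "\<And>\<alpha>. (f has_vector_derivative p \<alpha>) (at \<alpha>)" "\<And>\<alpha>. norm (p \<alpha>) \<le> K"
  shows "norm (f \<alpha> - f \<beta>) \<le> K * \<bar>\<alpha> - \<beta>\<bar>"
proof -
  have "norm (f \<alpha> - f \<beta>) \<le> K * norm (\<alpha> - \<beta>)"
    using assms by (intro differentiable_bound[where S = UNIV and f' = "\<lambda>x h. h *\<^sub>R p x"])
      (auto simp: has_vector_derivative_def intro!: onorm_le, metis abs_ge_zero mult.commute mult_left_mono)
  thus ?thesis by simp
qed

text \<open>
  Differences of two horizontally periodic curves are periodic, so their increments are controlled
  by the distance on the circle and not only by that on the line.
\<close>

lemma periodic_lipschitz_circle_chord: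
  fixes f :: "real \<Rightarrow> real^2"
  assumes "periodic f" "\<And>\<alpha>. (f has_vector_derivative p \<alpha>) (at \<alpha>)" "\<And>\<alpha>. norm (p \<alpha>) \<le> K"
  shows "norm (f \<alpha> - f \<beta>) \<le> K * (pi/2) * circle_chord (\<alpha> - \<beta>)"
proof -
  have K0: "K \<ge> 0" using assms(3)[of 0] norm_ge_zero order_trans by blast
  obtain k :: int where k: "\<bar>\<alpha> - \<beta> + 2 * pi * of_int k\<bar> \<le> pi" using reduce_mod_2pi by blast
  have "norm (f \<alpha> - f \<beta>) = norm (f (\<alpha> + 2 * pi * of_int k) - f \<beta>)"
    using assms(1) by (simp add: periodic_def)
  also have "\<dots> \<le> K * \<bar>\<alpha> + 2 * pi * of_int k - \<beta>\<bar>" by (rule lipschitz_of_derivative[OF assms(2,3)])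
  also have "\<dots> = K * \<bar>\<alpha> - \<beta> + 2 * pi * of_int k\<bar>" by (simp add: algebra_simps)
  also have "\<dots> \<le> K * (pi/2 * circle_chord (\<alpha> - \<beta> + 2 * pi * of_int k))"
    using K0 by (intro mult_left_mono abs_le_circle_chord k)
  finally show ?thesis by (simp add: circle_chord_periodic)
qed

section \<open>The velocity of a regular curve\<close>

lemma norm_matrix_vector_le: "norm ((A::real^2^2) *v x) \<le> norm A * norm x"
proof -
  have "norm (A *v x) = L2_set (\<lambda>i. norm ((A *v x) $ i)) UNIV" by (simp add: norm_vec_def)
  also have "\<dots> \<le> L2_set (\<lambda>i. norm (A $ i) * norm x) UNIV"
    by (intro L2_set_mono) (auto simp: matrix_vector_mul_component Cauchy_Schwarz_ineq2)
  also have "\<dots> = norm A * norm x" by (simp add: norm_vec_def L2_set_left_distrib)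
  finally show ?thesis .
qed

lemma bounded_bilinear_matrix_vector: "bounded_bilinear ((*v) :: real^2^2 \<Rightarrow> real^2 \<Rightarrow> real^2)"
  by unfold_locales
    (auto simp: matrix_vector_mult_add_rdistrib matrix_vector_right_distrib scaleR_matrix_vector_assoc
      matrix_vector_mult_scaleR intro!: exI[of _ 1] norm_matrix_vector_le)

lemma perp_component [simp]: "perp v $ 1 = - v $ 2" "perp v $ 2 = v $ 1"
  by (simp_all add: perp_def)

lemma norm_perp [simp]: "norm (perp v) = norm v"
  by (simp add: norm_vec_def L2_set_def sum_2)

lemma linear_perp: "linear perp"
  by (intro linearI) (simp_all add: vec2_eq_iff)

lemma bounded_linear_perp: "bounded_linear perp"
  using linear_perp linear_conv_bounded_linear by blast

lemma perp_diff: "perp (v - w) = perp v - perp w" by (simp add: vec2_eq_iff)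

definition vel :: "(real \<Rightarrow> real^2) \<Rightarrow> real \<Rightarrow> real^2" where
  "vel z \<alpha> = (LINT \<beta>:torus|lborel. (z \<beta> $ 2) *\<^sub>R (stokeslet (z \<alpha> - z \<beta>) *v perp (dcurve z \<beta>)))"

text \<open>
  The operator \<open>W\<close> with \<open>V' = W z'\<^sup>\<bottom>\<close>; see \<open>vel_has_derivative\<close>.
\<close>

definition tangent_op :: "(real \<Rightarrow> real^2) \<Rightarrow> real \<Rightarrow> real^2^2" where
  "tangent_op z \<alpha> = (LINT \<beta>:torus|lborel. (dcurve z \<beta> $ 2) *\<^sub>R stokeslet (z \<alpha> - z \<beta>))"

text \<open>
  A quantitative form of membership in the domain of the equation, at \<open>C\<^sup>1\<close> level: all constants
  below depend on the curve only through \<open>c\<close> and \<open>A\<close>.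
\<close>

definition regular :: "real \<Rightarrow> real \<Rightarrow> (real \<Rightarrow> real^2) \<Rightarrow> bool" where
  "regular c A z \<longleftrightarrow> 0 < c \<and> horizontally_periodic z \<and> z C1_differentiable_on UNIV \<and>
     (\<forall>\<alpha>. \<bar>z \<alpha> $ 2\<bar> \<le> A) \<and> (\<forall>\<alpha>. norm (dcurve z \<alpha>) \<le> A) \<and>
     (\<forall>\<alpha> \<beta>. c * circle_chord (\<alpha> - \<beta>) \<le> chord (z \<alpha> - z \<beta>))"

lemma regularD:
  assumes "regular c A z"
  shows "0 < c" "horizontally_periodic z" "z C1_differentiable_on UNIV" "\<bar>z \<alpha> $ 2\<bar> \<le> A"
    "norm (dcurve z \<alpha>) \<le> A" "c * circle_chord (\<alpha> - \<beta>) \<le> chord (z \<alpha> - z \<beta>)" "0 \<le> A" "\<bar>(z \<alpha> - z \<beta>) $ 2\<bar> \<le> 2 * A"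
    "\<bar>dcurve z \<alpha> $ 2\<bar> \<le> A"
proof -
  show "\<bar>z \<alpha> $ 2\<bar> \<le> A" using assms by (auto simp: regular_def)
  show d: "norm (dcurve z \<alpha>) \<le> A" using assms by (auto simp: regular_def)
  show "0 \<le> A" using d norm_ge_zero order_trans by blast
  have "\<bar>z \<alpha> $ 2\<bar> \<le> A" "\<bar>z \<beta> $ 2\<bar> \<le> A" using assms by (auto simp: regular_def)
  thus "\<bar>(z \<alpha> - z \<beta>) $ 2\<bar> \<le> 2 * A" unfolding vector_minus_component by linarith
  show "\<bar>dcurve z \<alpha> $ 2\<bar> \<le> A" using d component_le_norm_cart order_trans by blast
qed (use assms in \<open>auto simp: regular_def\<close>)

lemma stokeslet_measurable [measurable]: "stokeslet \<in> borel_measurable borel"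
proof -
  have c: "(\<lambda>y::real^2. y $ i) \<in> borel_measurable borel" for i
    by (intro borel_measurable_continuous_onI continuous_intros)
  have ch: "(\<lambda>y::real^2. cosh (y $ i)) \<in> borel_measurable borel" "(\<lambda>y::real^2. sinh (y $ i)) \<in> borel_measurable borel" for i
    by (intro borel_measurable_continuous_onI continuous_intros)+
  show ?thesis unfolding stokeslet_decomp chord_def half_angle_cot_def cot_formula
    using c ch by simp
qed

lemma vel_integrand_measurable:
  assumes "z C1_differentiable_on UNIV"
  shows "(\<lambda>\<beta>. (z \<beta> $ 2) *\<^sub>R (stokeslet (z \<alpha> - z \<beta>) *v perp (dcurve z \<beta>))) \<in> borel_measurable borel"
    "(\<lambda>\<beta>. (dcurve z \<beta> $ 2) *\<^sub>R stokeslet (z \<alpha> - z \<beta>)) \<in> borel_measurable borel"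
proof -
  note [measurable] = C1_onD(4,5)[OF assms]
  have c: "(\<lambda>y::real^2. y $ i) \<in> borel_measurable borel" for i
    by (intro borel_measurable_continuous_onI continuous_intros)
  have p: "(\<lambda>\<beta>. perp (dcurve z \<beta>)) \<in> borel_measurable borel"
    using C1_onD(2)[OF assms] by (intro borel_measurable_continuous_onI bounded_linear.continuous_on[OF bounded_linear_perp])
  have s: "(\<lambda>\<beta>. stokeslet (z \<alpha> - z \<beta>)) \<in> borel_measurable borel" by measurable
  have c1: "(\<lambda>\<beta>. z \<beta> $ 2) \<in> borel_measurable borel" "(\<lambda>\<beta>. dcurve z \<beta> $ 2) \<in> borel_measurable borel"
    by (rule measurable_compose[OF _ c], measurable)+
  have "(\<lambda>\<beta>. stokeslet (z \<alpha> - z \<beta>) *v perp (dcurve z \<beta>)) \<in> borel_measurable borel"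
    by (rule borel_measurable_continuous_Pair[OF s p])
      (intro bounded_bilinear.continuous_on[OF bounded_bilinear_matrix_vector] continuous_intros)
  thus "(\<lambda>\<beta>. (z \<beta> $ 2) *\<^sub>R (stokeslet (z \<alpha> - z \<beta>) *v perp (dcurve z \<beta>))) \<in> borel_measurable borel"
    using c1 by simp
  show "(\<lambda>\<beta>. (dcurve z \<beta> $ 2) *\<^sub>R stokeslet (z \<alpha> - z \<beta>)) \<in> borel_measurable borel"
    using c1 s by simp
qed

text \<open>
  The bound holds for all parameters, including those where both sides are zero because the two
  points coincide modulo the period.
\<close>

lemma regular_stokeslet_bound:
  obtains C where "0 \<le> C" "\<And>z \<alpha> \<beta>. regular c A z \<Longrightarrow> norm (stokeslet (z \<alpha> - z \<beta>)) \<le> C * circle_chord (\<alpha> - \<beta>) powr (-(1/2))"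
proof -
  obtain C where C: "0 \<le> C" "\<And>y. \<bar>y$2\<bar> \<le> 2*A \<Longrightarrow> norm (stokeslet y) \<le> C * chord y powr (-1/2)"
    using stokeslet_bound by blast
  show thesis
  proof
    show "0 \<le> C * c powr (-(1/2))" using C by simp
    fix z \<alpha> \<beta> assume z: "regular c A z"
    show "norm (stokeslet (z \<alpha> - z \<beta>)) \<le> C * c powr (-(1/2)) * circle_chord (\<alpha> - \<beta>) powr (-(1/2))"
    proof (cases "circle_chord (\<alpha> - \<beta>) = 0")
      case False
      hence t: "0 < circle_chord (\<alpha> - \<beta>)" using circle_chord_nonneg[of "\<alpha> - \<beta>"] by linarith
      have "norm (stokeslet (z \<alpha> - z \<beta>)) \<le> C * chord (z \<alpha> - z \<beta>) powr (-(1/2))"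
        using C(2)[OF regularD(8)[OF z]] by simp
      also have "\<dots> \<le> C * (c * circle_chord (\<alpha> - \<beta>)) powr (-(1/2))"
        using t regularD(1)[OF z] C(1) by (intro mult_left_mono powr_mono2' regularD(6)[OF z]) auto
      finally show ?thesis using t regularD(1)[OF z] by (simp add: powr_mult)
    next
      case True
      hence "sin ((\<alpha> - \<beta>)/2) = 0" by (simp add: circle_chord_def)
      then obtain i :: int where "(\<alpha> - \<beta>)/2 = of_int i * pi" by (auto simp: sin_zero_iff_int2)
      hence "\<alpha> = \<beta> + 2 * pi * of_int i" by (simp add: field_simps)
      hence "z \<alpha> - z \<beta> = vector [2 * pi * of_int i, 0]"
        using regularD(2)[OF z] by (simp add: horizontally_periodic_def)
      hence "chord (z \<alpha> - z \<beta>) = 0" using cos_int_2pin[of i] by (simp add: chord_def)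
      thus ?thesis using C(2)[OF regularD(8)[OF z]] True by (metis norm_le_zero_iff mult_zero_right powr_0 norm_zero)
    qed
  qed
qed

lemma circle_chord_half_integral:
  obtains I where "0 \<le> I" "\<And>\<alpha>. set_integrable lborel torus (\<lambda>\<beta>. circle_chord (\<alpha> - \<beta>) powr (-(1/2)))"
    "\<And>\<alpha>. (LINT \<beta>:torus|lborel. circle_chord (\<alpha> - \<beta>) powr (-(1/2))) \<le> I"
  using circle_chord_powr_integral[of "1/2"] by auto

lemma vel_integrable:
  assumes "regular c A z"
  shows "set_integrable lborel torus (\<lambda>\<beta>. (z \<beta> $ 2) *\<^sub>R (stokeslet (z \<alpha> - z \<beta>) *v perp (dcurve z \<beta>)))" (is ?A)
    and "set_integrable lborel torus (\<lambda>\<beta>. (dcurve z \<beta> $ 2) *\<^sub>R stokeslet (z \<alpha> - z \<beta>))" (is ?B)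
proof -
  note zD = regularD[OF assms]
  obtain C where C: "0 \<le> C" "\<And>z \<alpha> \<beta>. regular c A z \<Longrightarrow> norm (stokeslet (z \<alpha> - z \<beta>)) \<le> C * circle_chord (\<alpha> - \<beta>) powr (-(1/2))"
    using regular_stokeslet_bound by blast
  obtain I where I: "\<And>\<alpha>. set_integrable lborel torus (\<lambda>\<beta>. circle_chord (\<alpha> - \<beta>) powr (-(1/2)))"
    using circle_chord_half_integral by blast
  have b: "norm ((z \<beta> $ 2) *\<^sub>R (stokeslet (z \<alpha> - z \<beta>) *v perp (dcurve z \<beta>))) \<le> A * (C * circle_chord (\<alpha> - \<beta>) powr (-(1/2)) * A)" for \<beta>
    unfolding norm_scaleR
    by (intro mult_mono order_trans[OF norm_matrix_vector_le mult_mono[OF C(2)[OF assms]]])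
      (simp_all add: zD(4,5,7) C(1))
  have b': "norm ((dcurve z \<beta> $ 2) *\<^sub>R stokeslet (z \<alpha> - z \<beta>)) \<le> A * (C * circle_chord (\<alpha> - \<beta>) powr (-(1/2)))" for \<beta>
    unfolding norm_scaleR by (intro mult_mono C(2)[OF assms]) (simp_all add: zD(9,7))
  show ?A
    by (rule set_integral_dominated(1)[OF vel_integrand_measurable(1)[OF zD(3)], where g = "\<lambda>\<beta>. A * (C * circle_chord (\<alpha> - \<beta>) powr (-(1/2)) * A)"])
      (use I b in auto)
  show ?B
    by (rule set_integral_dominated(1)[OF vel_integrand_measurable(2)[OF zD(3)], where g = "\<lambda>\<beta>. A * (C * circle_chord (\<alpha> - \<beta>) powr (-(1/2)))"])
      (use I b' in auto)
qed

lemma tangent_op_bounded: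
  obtains C where "0 \<le> C" "\<And>z \<alpha>. regular c A z \<Longrightarrow> norm (tangent_op z \<alpha>) \<le> C"
proof -
  obtain C where C: "0 \<le> C" "\<And>z \<alpha> \<beta>. regular c A z \<Longrightarrow> norm (stokeslet (z \<alpha> - z \<beta>)) \<le> C * circle_chord (\<alpha> - \<beta>) powr (-(1/2))"
    using regular_stokeslet_bound by blast
  obtain I where I: "0 \<le> I" "\<And>\<alpha>. set_integrable lborel torus (\<lambda>\<beta>. circle_chord (\<alpha> - \<beta>) powr (-(1/2)))"
     "\<And>\<alpha>. (LINT \<beta>:torus|lborel. circle_chord (\<alpha> - \<beta>) powr (-(1/2))) \<le> I"
    using circle_chord_half_integral by blast
  show thesis
  proof
    show "0 \<le> \<bar>A\<bar> * (C * I)" using C I by simp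
    fix z \<alpha> assume z: "regular c A z"
    have "norm ((dcurve z \<beta> $ 2) *\<^sub>R stokeslet (z \<alpha> - z \<beta>)) \<le> A * C * circle_chord (\<alpha> - \<beta>) powr (-(1/2))" for \<beta>
      unfolding norm_scaleR mult.assoc by (intro mult_mono C(2)[OF z]) (simp_all add: regularD(9,7)[OF z])
    hence "norm (tangent_op z \<alpha>) \<le> (LINT \<beta>:torus|lborel. A * C * circle_chord (\<alpha> - \<beta>) powr (-(1/2)))"
      unfolding tangent_op_def
      by (intro set_integral_dominated(2)[OF vel_integrand_measurable(2)[OF regularD(3)[OF z]]]) (use I in auto)
    also have "\<dots> \<le> A * C * I" using I C regularD(7)[OF z] by (simp add: mult_left_mono)
    also have "\<dots> \<le> \<bar>A\<bar> * (C * I)" unfolding mult.assoc by (intro mult_right_mono mult_nonneg_nonneg I(1) C(1)) auto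
    finally show "norm (tangent_op z \<alpha>) \<le> \<bar>A\<bar> * (C * I)" .
  qed
qed

text \<open>
  Only the kernel depends on \<open>\<alpha>\<close>, so the density \<open>z\<^sub>2'\<close> need only be bounded. Applied to
  \<open>y = z(\<alpha>) - z(\<beta>)\<close> and \<open>x = z(\<alpha>') - z(\<beta>)\<close>, the kernel estimate produces \<open>|\<alpha> - \<alpha>'|\<close> to the power \<open>\<theta>\<close> against
  the sum of the singularities at \<open>\<alpha>\<close> and at \<open>\<alpha>'\<close>.
\<close>

lemma tangent_op_holder:
  assumes "0 < \<theta>" "\<theta> < 1"
  obtains C where "0 \<le> C" "\<And>z \<alpha> \<alpha>'. regular c A z \<Longrightarrow> norm (tangent_op z \<alpha> - tangent_op z \<alpha>') \<le> C * \<bar>\<alpha> - \<alpha>'\<bar> powr \<theta>"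
proof -
  obtain K where K: "0 \<le> K"
    "\<And>y x. \<lbrakk>\<bar>y$2\<bar> \<le> 2*A; \<bar>x$2\<bar> \<le> 2*A; 0 < chord y; 0 < chord x\<rbrakk> \<Longrightarrow>
       norm (stokeslet y - stokeslet x) \<le> K * (norm (y - x) / min (chord y) (chord x)) powr \<theta>"
    using stokeslet_holder assms less_imp_le by metis
  obtain I where I: "0 \<le> I" "\<And>\<alpha>. set_integrable lborel torus (\<lambda>\<beta>. circle_chord (\<alpha> - \<beta>) powr (-\<theta>))"
    "\<And>\<alpha>. (LINT \<beta>:torus|lborel. circle_chord (\<alpha> - \<beta>) powr (-\<theta>)) \<le> I"
    using circle_chord_powr_integral[of \<theta>] assms by auto
  show thesis
  proof
    show "0 \<le> \<bar>A\<bar> * (K * (\<bar>A\<bar> / \<bar>c\<bar>) powr \<theta>) * (2 * I)" using K I by simp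
    fix z \<alpha> \<alpha>' assume z: "regular c A z"
    note zD = regularD[OF z]
    define d where "d = A * (K * (A / c) powr \<theta>) * \<bar>\<alpha> - \<alpha>'\<bar> powr \<theta>"
    have d0: "d \<ge> 0" using zD K by (simp add: d_def)
    have le: "norm ((dcurve z \<beta> $ 2) *\<^sub>R stokeslet (z \<alpha> - z \<beta>) - (dcurve z \<beta> $ 2) *\<^sub>R stokeslet (z \<alpha>' - z \<beta>))
       \<le> d * (circle_chord (\<alpha> - \<beta>) powr (-\<theta>) + circle_chord (\<alpha>' - \<beta>) powr (-\<theta>))" (is "?l \<le> _")
      if t: "0 < circle_chord (\<alpha> - \<beta>)" "0 < circle_chord (\<alpha>' - \<beta>)" for \<beta>
    proof -
      let ?m = "min (circle_chord (\<alpha> - \<beta>)) (circle_chord (\<alpha>' - \<beta>))"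
      have ch: "0 < chord (z \<alpha> - z \<beta>)" "0 < chord (z \<alpha>' - z \<beta>)"
        using mult_pos_pos[OF zD(1) t(1)] mult_pos_pos[OF zD(1) t(2)] zD(6)[of \<alpha> \<beta>] zD(6)[of \<alpha>' \<beta>] by linarith+
      have m: "c * ?m \<le> min (chord (z \<alpha> - z \<beta>)) (chord (z \<alpha>' - z \<beta>))"
        using zD(1) zD(6)[of \<alpha> \<beta>] zD(6)[of \<alpha>' \<beta>] by (simp add: min_mult_distrib_left min.coboundedI1 min.coboundedI2)
      have "norm (stokeslet (z \<alpha> - z \<beta>) - stokeslet (z \<alpha>' - z \<beta>))
          \<le> K * (norm ((z \<alpha> - z \<beta>) - (z \<alpha>' - z \<beta>)) / min (chord (z \<alpha> - z \<beta>)) (chord (z \<alpha>' - z \<beta>))) powr \<theta>"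
        by (rule K(2)[OF zD(8) zD(8) ch])
      also have "\<dots> \<le> K * (A * \<bar>\<alpha> - \<alpha>'\<bar> / (c * ?m)) powr \<theta>"
      proof (intro mult_left_mono powr_mono2 frac_le)
        show "norm ((z \<alpha> - z \<beta>) - (z \<alpha>' - z \<beta>)) \<le> A * \<bar>\<alpha> - \<alpha>'\<bar>"
          using lipschitz_of_derivative[of z "dcurve z" A \<alpha> \<alpha>'] C1_onD(1)[OF zD(3)] zD(5) by simp
        show "0 < c * ?m" using zD(1) t by simp
        show "0 \<le> norm ((z \<alpha> - z \<beta>) - (z \<alpha>' - z \<beta>)) / min (chord (z \<alpha> - z \<beta>)) (chord (z \<alpha>' - z \<beta>))"
          by simp
      qed (use assms m zD(7) K(1) in simp_all)
      also have "\<dots> = K * ((A/c) powr \<theta> * \<bar>\<alpha> - \<alpha>'\<bar> powr \<theta>) * ?m powr (-\<theta>)"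
      proof -
        have "A * \<bar>\<alpha> - \<alpha>'\<bar> / (c * ?m) = (A/c * \<bar>\<alpha> - \<alpha>'\<bar>) / ?m" by simp
        moreover have "0 < ?m" using t by simp
        ultimately show ?thesis using zD(1,7) by (simp only: powr_divide powr_mult powr_minus_divide) simp
      qed
      also have "\<dots> \<le> K * ((A/c) powr \<theta> * \<bar>\<alpha> - \<alpha>'\<bar> powr \<theta>) * (circle_chord (\<alpha> - \<beta>) powr (-\<theta>) + circle_chord (\<alpha>' - \<beta>) powr (-\<theta>))"
        using K by (intro mult_left_mono) (auto simp: min_def)
      finally have s: "norm (stokeslet (z \<alpha> - z \<beta>) - stokeslet (z \<alpha>' - z \<beta>)) \<le>
         K * ((A/c) powr \<theta> * \<bar>\<alpha> - \<alpha>'\<bar> powr \<theta>) * (circle_chord (\<alpha> - \<beta>) powr (-\<theta>) + circle_chord (\<alpha>' - \<beta>) powr (-\<theta>))" .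
      have "?l = \<bar>dcurve z \<beta> $ 2\<bar> * norm (stokeslet (z \<alpha> - z \<beta>) - stokeslet (z \<alpha>' - z \<beta>))"
        unfolding scaleR_diff_right[symmetric] norm_scaleR ..
      also have "\<dots> \<le> A * (K * ((A/c) powr \<theta> * \<bar>\<alpha> - \<alpha>'\<bar> powr \<theta>) * (circle_chord (\<alpha> - \<beta>) powr (-\<theta>) + circle_chord (\<alpha>' - \<beta>) powr (-\<theta>)))"
        by (intro mult_mono s zD(7,9)) auto
      finally show ?thesis by (simp add: d_def mult_ac)
    qed
    have ae: "AE \<beta> in lborel. \<beta> \<in> torus \<longrightarrow> norm ((dcurve z \<beta> $ 2) *\<^sub>R stokeslet (z \<alpha> - z \<beta>) - (dcurve z \<beta> $ 2) *\<^sub>R stokeslet (z \<alpha>' - z \<beta>))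
       \<le> d * (circle_chord (\<alpha> - \<beta>) powr (-\<theta>) + circle_chord (\<alpha>' - \<beta>) powr (-\<theta>))"
      using AE_circle_chord_pos[of \<alpha>] AE_circle_chord_pos[of \<alpha>'] by eventually_elim (use le in auto)
    have "tangent_op z \<alpha> - tangent_op z \<alpha>' = (LINT \<beta>:torus|lborel. (dcurve z \<beta> $ 2) *\<^sub>R stokeslet (z \<alpha> - z \<beta>) - (dcurve z \<beta> $ 2) *\<^sub>R stokeslet (z \<alpha>' - z \<beta>))"
      unfolding tangent_op_def by (rule set_integral_diff(2)[symmetric]) (intro vel_integrable(2)[OF z])+
    also have "norm \<dots> \<le> (LINT \<beta>:torus|lborel. d * (circle_chord (\<alpha> - \<beta>) powr (-\<theta>) + circle_chord (\<alpha>' - \<beta>) powr (-\<theta>)))"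
    proof (rule set_integral_dominated(2)[OF _ _ _ ae])
      show "set_integrable lborel torus (\<lambda>\<beta>. d * (circle_chord (\<alpha> - \<beta>) powr - \<theta> + circle_chord (\<alpha>' - \<beta>) powr - \<theta>))"
        by (intro set_integrable_mult_right set_integral_add(1) I(2))
    qed (intro borel_measurable_diff vel_integrand_measurable(2) zD(3), simp)
    also have "\<dots> = d * ((LINT \<beta>:torus|lborel. circle_chord (\<alpha> - \<beta>) powr (-\<theta>)) + (LINT \<beta>:torus|lborel. circle_chord (\<alpha>' - \<beta>) powr (-\<theta>)))"
      using I by (simp add: set_integral_add)
    also have "\<dots> \<le> d * (2 * I)" using I(3)[of \<alpha>] I(3)[of \<alpha>'] d0 by (intro mult_left_mono) auto
    finally show "norm (tangent_op z \<alpha> - tangent_op z \<alpha>') \<le> \<bar>A\<bar> * (K * (\<bar>A\<bar> / \<bar>c\<bar>) powr \<theta>) * (2 * I) * \<bar>\<alpha> - \<alpha>'\<bar> powr \<theta>"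
      using abs_of_nonneg[OF zD(7)] abs_of_pos[OF zD(1)] by (simp add: d_def mult_ac)
  qed
qed

text \<open>
  Here \<open>\<theta> = 1\<close>: the increment of \<open>z(\<alpha>) - z(\<beta>)\<close> between two curves is itself of the order of the
  chord length, which cancels the singularity. The kernel therefore depends on the curve in a
  Lipschitz way uniformly in \<open>\<alpha>\<close> and \<open>\<beta>\<close>.
\<close>

lemma stokeslet_curve_lipschitz:
  obtains K where "0 \<le> K"
    "\<And>z w \<delta> \<alpha> \<beta>. \<lbrakk>regular c A z; regular c A w; \<And>\<alpha>. norm (dcurve z \<alpha> - dcurve w \<alpha>) \<le> \<delta>; 0 < circle_chord (\<alpha> - \<beta>)\<rbrakk> \<Longrightarrow>
       norm (stokeslet (z \<alpha> - z \<beta>) - stokeslet (w \<alpha> - w \<beta>)) \<le> K * \<delta>"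
proof -
  obtain K where K: "0 \<le> K"
    "\<And>y x. \<lbrakk>\<bar>y$2\<bar> \<le> 2*A; \<bar>x$2\<bar> \<le> 2*A; 0 < chord y; 0 < chord x\<rbrakk> \<Longrightarrow>
       norm (stokeslet y - stokeslet x) \<le> K * (norm (y - x) / min (chord y) (chord x)) powr 1"
    using stokeslet_holder[of 1] by auto
  show thesis
  proof
    show "0 \<le> K * (pi/2 / \<bar>c\<bar>)" using K by simp
    fix z w \<delta> \<alpha> \<beta>
    assume z: "regular c A z" and w: "regular c A w" and \<delta>: "\<And>\<alpha>. norm (dcurve z \<alpha> - dcurve w \<alpha>) \<le> \<delta>"
      and t: "0 < circle_chord (\<alpha> - \<beta>)"
    note zD = regularD[OF z] and wD = regularD[OF w]
    have \<delta>0: "\<delta> \<ge> 0" using \<delta> norm_ge_zero order_trans by blast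
    have ct: "0 < c * circle_chord (\<alpha> - \<beta>)" using zD t by simp
    have ch: "0 < chord (z \<alpha> - z \<beta>)" "0 < chord (w \<alpha> - w \<beta>)"
      using ct zD(6)[of \<alpha> \<beta>] wD(6)[of \<alpha> \<beta>] by linarith+
    have "norm ((z \<alpha> - w \<alpha>) - (z \<beta> - w \<beta>)) \<le> \<delta> * (pi/2) * circle_chord (\<alpha> - \<beta>)"
      by (rule periodic_lipschitz_circle_chord[OF hp_diff_periodic[OF zD(2) wD(2)] has_vector_derivative_diff[OF C1_onD(1)[OF zD(3)] C1_onD(1)[OF wD(3)]] \<delta>])
    hence n: "norm ((z \<alpha> - z \<beta>) - (w \<alpha> - w \<beta>)) \<le> \<delta> * (pi/2) * circle_chord (\<alpha> - \<beta>)" by (simp add: algebra_simps)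
    have "norm (stokeslet (z \<alpha> - z \<beta>) - stokeslet (w \<alpha> - w \<beta>)) \<le>
       K * (norm ((z \<alpha> - z \<beta>) - (w \<alpha> - w \<beta>)) / min (chord (z \<alpha> - z \<beta>)) (chord (w \<alpha> - w \<beta>)))"
      using K(2)[OF zD(8) wD(8) ch] ch by simp
    also have "\<dots> \<le> K * (\<delta> * (pi/2) * circle_chord (\<alpha> - \<beta>) / (c * circle_chord (\<alpha> - \<beta>)))"
      using n ct zD(6)[of \<alpha> \<beta>] wD(6)[of \<alpha> \<beta>] K \<delta>0 by (intro mult_left_mono frac_le) auto
    also have "\<dots> = K * (pi/2 / \<bar>c\<bar>) * \<delta>" using t zD(1) by simp
    finally show "norm (stokeslet (z \<alpha> - z \<beta>) - stokeslet (w \<alpha> - w \<beta>)) \<le> K * (pi/2 / \<bar>c\<bar>) * \<delta>" .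
  qed
qed

lemma norm_triangle3: "norm (a + b + c) \<le> norm a + norm b + norm (c::'a::real_normed_vector)"
  by (intro order_trans[OF norm_triangle_ineq] add_right_mono norm_triangle_ineq)

lemma scaleR_bilinear_diff:
  assumes "bounded_bilinear h"
  shows "a *\<^sub>R h S u - a' *\<^sub>R h S' u' = a *\<^sub>R h (S - S') u + (a - a') *\<^sub>R h S' u + a' *\<^sub>R h S' (u - u')"
  unfolding bounded_bilinear.diff_left[OF assms] bounded_bilinear.diff_right[OF assms]
    scaleR_diff_right scaleR_diff_left by simp

lemma vel_lipschitz:
  obtains C where "0 \<le> C"
    "\<And>z w \<delta> \<alpha>. \<lbrakk>regular c A z; regular c A w; \<And>\<alpha>. norm (z \<alpha> - w \<alpha>) \<le> \<delta>; \<And>\<alpha>. norm (dcurve z \<alpha> - dcurve w \<alpha>) \<le> \<delta>\<rbrakk> \<Longrightarrow>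
       norm (vel z \<alpha> - vel w \<alpha>) \<le> C * \<delta> \<and> norm (tangent_op z \<alpha> - tangent_op w \<alpha>) \<le> C * \<delta>"
proof -
  obtain K where K: "0 \<le> K"
    "\<And>z w \<delta> \<alpha> \<beta>. \<lbrakk>regular c A z; regular c A w; \<And>\<alpha>. norm (dcurve z \<alpha> - dcurve w \<alpha>) \<le> \<delta>; 0 < circle_chord (\<alpha> - \<beta>)\<rbrakk> \<Longrightarrow>
       norm (stokeslet (z \<alpha> - z \<beta>) - stokeslet (w \<alpha> - w \<beta>)) \<le> K * \<delta>"
    using stokeslet_curve_lipschitz by blast
  obtain B where B: "0 \<le> B" "\<And>z \<alpha> \<beta>. regular c A z \<Longrightarrow> norm (stokeslet (z \<alpha> - z \<beta>)) \<le> B * circle_chord (\<alpha> - \<beta>) powr (-(1/2))"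
    using regular_stokeslet_bound by blast
  obtain I where I: "0 \<le> I" "\<And>\<alpha>. set_integrable lborel torus (\<lambda>\<beta>. circle_chord (\<alpha> - \<beta>) powr (-(1/2)))"
     "\<And>\<alpha>. (LINT \<beta>:torus|lborel. circle_chord (\<alpha> - \<beta>) powr (-(1/2))) \<le> I"
    using circle_chord_half_integral by blast
  define C1 where "C1 = A * A * K * (2*pi) + 2 * A * B * I"
  define C2 where "C2 = A * K * (2*pi) + B * I"
  show thesis
  proof
    show "0 \<le> max 0 (max C1 C2)" by simp
    fix z w \<delta> and \<alpha> :: real
    assume z: "regular c A z" and w: "regular c A w"
      and \<delta>: "\<And>\<alpha>. norm (z \<alpha> - w \<alpha>) \<le> \<delta>" "\<And>\<alpha>. norm (dcurve z \<alpha> - dcurve w \<alpha>) \<le> \<delta>"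
    note zD = regularD[OF z] and wD = regularD[OF w]
    have \<delta>0: "\<delta> \<ge> 0" using \<delta>(1) norm_ge_zero order_trans by blast
    have A0: "A \<ge> 0" by (rule zD)
    have z2: "\<bar>z \<beta> $ 2 - w \<beta> $ 2\<bar> \<le> \<delta>" for \<beta>
      using component_le_norm_cart[of "z \<beta> - w \<beta>" 2] \<delta>(1)[of \<beta>] by simp
    have dz2: "\<bar>dcurve z \<beta> $ 2 - dcurve w \<beta> $ 2\<bar> \<le> \<delta>" for \<beta>
      using component_le_norm_cart[of "dcurve z \<beta> - dcurve w \<beta>" 2] \<delta>(2)[of \<beta>] by simp
    let ?S = "\<lambda>z \<beta>. stokeslet (z \<alpha> - z \<beta>)"
    let ?t = "\<lambda>\<beta>. circle_chord (\<alpha> - \<beta>) powr (-(1/2))"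
    let ?f = "\<lambda>z \<beta>. (z \<beta> $ 2) *\<^sub>R (?S z \<beta> *v perp (dcurve z \<beta>))"
    let ?g = "\<lambda>z \<beta>. (dcurve z \<beta> $ 2) *\<^sub>R ?S z \<beta>"
    have fle: "norm (?f z \<beta> - ?f w \<beta>) \<le> A * A * K * \<delta> + 2 * A * B * \<delta> * ?t \<beta>" if t: "0 < circle_chord (\<alpha> - \<beta>)" for \<beta>
    proof -
      have e: "?f z \<beta> - ?f w \<beta> = (z \<beta> $ 2) *\<^sub>R ((?S z \<beta> - ?S w \<beta>) *v perp (dcurve z \<beta>)) +
         (z \<beta> $ 2 - w \<beta> $ 2) *\<^sub>R (?S w \<beta> *v perp (dcurve z \<beta>)) +
         (w \<beta> $ 2) *\<^sub>R (?S w \<beta> *v perp (dcurve z \<beta> - dcurve w \<beta>))"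
        unfolding perp_diff by (rule scaleR_bilinear_diff[OF bounded_bilinear_matrix_vector])
      have "norm (?f z \<beta> - ?f w \<beta>) \<le> \<bar>z \<beta> $ 2\<bar> * norm ((?S z \<beta> - ?S w \<beta>) *v perp (dcurve z \<beta>)) +
         \<bar>z \<beta> $ 2 - w \<beta> $ 2\<bar> * norm (?S w \<beta> *v perp (dcurve z \<beta>)) +
         \<bar>w \<beta> $ 2\<bar> * norm (?S w \<beta> *v perp (dcurve z \<beta> - dcurve w \<beta>))"
        unfolding e by (rule order_trans[OF norm_triangle3]) (simp only: norm_scaleR order_refl)
      also have "\<dots> \<le> A * ((K * \<delta>) * A) + \<delta> * ((B * ?t \<beta>) * A) + A * ((B * ?t \<beta>) * \<delta>)"
      proof (intro add_mono mult_mono)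
        note K' = K(2)[OF z w \<delta>(2) t] and B' = B(2)[OF w, of \<alpha> \<beta>]
        show "norm ((?S z \<beta> - ?S w \<beta>) *v perp (dcurve z \<beta>)) \<le> (K * \<delta>) * A"
          by (rule order_trans[OF norm_matrix_vector_le mult_mono], rule K') (simp_all add: zD(5) K(1) \<delta>0)
        show "norm (?S w \<beta> *v perp (dcurve z \<beta>)) \<le> (B * ?t \<beta>) * A"
          by (rule order_trans[OF norm_matrix_vector_le mult_mono], rule B') (simp_all add: zD(5) B(1))
        show "norm (?S w \<beta> *v perp (dcurve z \<beta> - dcurve w \<beta>)) \<le> (B * ?t \<beta>) * \<delta>"
          by (rule order_trans[OF norm_matrix_vector_le mult_mono], rule B') (simp_all add: \<delta>(2) B(1))
        show "\<bar>z \<beta> $ 2\<bar> \<le> A" "\<bar>w \<beta> $ 2\<bar> \<le> A" by (rule zD(4), rule wD(4))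
        show "\<bar>z \<beta> $ 2 - w \<beta> $ 2\<bar> \<le> \<delta>" by (rule z2)
      qed (use A0 \<delta>0 in simp_all)
      finally show ?thesis by (simp add: algebra_simps)
    qed
    have gle: "norm (?g z \<beta> - ?g w \<beta>) \<le> A * K * \<delta> + B * \<delta> * ?t \<beta>" if t: "0 < circle_chord (\<alpha> - \<beta>)" for \<beta>
    proof -
      have e: "?g z \<beta> - ?g w \<beta> = (dcurve z \<beta> $ 2) *\<^sub>R (?S z \<beta> - ?S w \<beta>) + (dcurve z \<beta> $ 2 - dcurve w \<beta> $ 2) *\<^sub>R ?S w \<beta>"
        unfolding scaleR_diff_right scaleR_diff_left by simp
      have "norm (?g z \<beta> - ?g w \<beta>) \<le> \<bar>dcurve z \<beta> $ 2\<bar> * norm (?S z \<beta> - ?S w \<beta>) + \<bar>dcurve z \<beta> $ 2 - dcurve w \<beta> $ 2\<bar> * norm (?S w \<beta>)"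
        unfolding e by (rule order_trans[OF norm_triangle_ineq]) (simp only: norm_scaleR order_refl)
      also have "\<dots> \<le> A * (K * \<delta>) + \<delta> * (B * ?t \<beta>)"
        by (intro add_mono mult_mono K(2)[OF z w \<delta>(2) t] B(2)[OF w]) (simp_all add: zD(9,7) \<delta>0 dz2)
      finally show ?thesis by (simp add: algebra_simps)
    qed
    have int: "set_integrable lborel torus (\<lambda>\<beta>. a + b * ?t \<beta>)"
      "(LINT \<beta>:torus|lborel. a + b * ?t \<beta>) \<le> a * (2*pi) + b * I" if "b \<ge> 0" for a b
    proof -
      have c: "set_integrable lborel torus (\<lambda>\<beta>::real. a)" by (simp add: set_integrable_def)
      show "set_integrable lborel torus (\<lambda>\<beta>. a + b * ?t \<beta>)" using c I by (intro set_integral_add) auto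
      have "(LINT \<beta>:torus|lborel. a + b * ?t \<beta>) = (LINT \<beta>:torus|lborel. a) + b * (LINT \<beta>:torus|lborel. ?t \<beta>)"
        using c I by (subst set_integral_add(2)) auto
      also have "\<dots> \<le> a * (2*pi) + b * I"
        using I(3)[of \<alpha>] that by (intro add_mono mult_left_mono) (auto simp: set_lebesgue_integral_def)
      finally show "(LINT \<beta>:torus|lborel. a + b * ?t \<beta>) \<le> a * (2*pi) + b * I" .
    qed
    have ae1: "AE \<beta> in lborel. \<beta> \<in> torus \<longrightarrow> norm (?f z \<beta> - ?f w \<beta>) \<le> A * A * K * \<delta> + 2 * A * B * \<delta> * ?t \<beta>"
      using AE_circle_chord_pos[of \<alpha>] by eventually_elim (use fle in auto)
    have ae2: "AE \<beta> in lborel. \<beta> \<in> torus \<longrightarrow> norm (?g z \<beta> - ?g w \<beta>) \<le> A * K * \<delta> + B * \<delta> * ?t \<beta>"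
      using AE_circle_chord_pos[of \<alpha>] by eventually_elim (use gle in auto)
    have evel: "vel z \<alpha> - vel w \<alpha> = (LINT \<beta>:torus|lborel. ?f z \<beta> - ?f w \<beta>)"
      unfolding vel_def by (rule set_integral_diff(2)[symmetric]) (intro vel_integrable(1)[OF z] vel_integrable(1)[OF w])+
    have "norm (vel z \<alpha> - vel w \<alpha>) \<le> (LINT \<beta>:torus|lborel. A * A * K * \<delta> + 2 * A * B * \<delta> * ?t \<beta>)"
      unfolding evel proof (rule set_integral_dominated(2)[OF _ _ _ ae1])
      show "set_integrable lborel torus (\<lambda>\<beta>. A * A * K * \<delta> + 2 * A * B * \<delta> * ?t \<beta>)" using A0 B(1) \<delta>0 by (intro int(1)) simp
    qed (intro borel_measurable_diff vel_integrand_measurable(1) zD(3) wD(3), simp)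
    also have "\<dots> \<le> A * A * K * \<delta> * (2*pi) + 2 * A * B * \<delta> * I" using A0 B(1) \<delta>0 by (intro int(2)) auto
    also have "\<dots> = C1 * \<delta>" by (simp add: C1_def algebra_simps)
    finally have 1: "norm (vel z \<alpha> - vel w \<alpha>) \<le> C1 * \<delta>" .
    have egradM: "tangent_op z \<alpha> - tangent_op w \<alpha> = (LINT \<beta>:torus|lborel. ?g z \<beta> - ?g w \<beta>)"
      unfolding tangent_op_def by (rule set_integral_diff(2)[symmetric]) (intro vel_integrable(2)[OF z] vel_integrable(2)[OF w])+
    have "norm (tangent_op z \<alpha> - tangent_op w \<alpha>) \<le> (LINT \<beta>:torus|lborel. A * K * \<delta> + B * \<delta> * ?t \<beta>)"
      unfolding egradM proof (rule set_integral_dominated(2)[OF _ _ _ ae2])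
      show "set_integrable lborel torus (\<lambda>\<beta>. A * K * \<delta> + B * \<delta> * ?t \<beta>)" using A0 B(1) \<delta>0 by (intro int(1)) simp
    qed (intro borel_measurable_diff vel_integrand_measurable(2) zD(3) wD(3), simp)
    also have "\<dots> \<le> A * K * \<delta> * (2*pi) + B * \<delta> * I" using A0 B(1) \<delta>0 by (intro int(2)) auto
    also have "\<dots> = C2 * \<delta>" by (simp add: C2_def algebra_simps)
    finally have 2: "norm (tangent_op z \<alpha> - tangent_op w \<alpha>) \<le> C2 * \<delta>" .
    have "C1 * \<delta> \<le> max 0 (max C1 C2) * \<delta>" "C2 * \<delta> \<le> max 0 (max C1 C2) * \<delta>"
      using \<delta>0 by (auto intro!: mult_right_mono)
    thus "norm (vel z \<alpha> - vel w \<alpha>) \<le> max 0 (max C1 C2) * \<delta> \<and> norm (tangent_op z \<alpha> - tangent_op w \<alpha>) \<le> max 0 (max C1 C2) * \<delta>"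
      using 1 2 by linarith
  qed
qed

section \<open>A potential for the rows of the Stokeslet\<close>

text \<open>
  The oriented integral from 0, for times or abscissae of either sign.
\<close>

definition primitive :: "(real \<Rightarrow> 'a::banach) \<Rightarrow> real \<Rightarrow> 'a" where
  "primitive f t = (if 0 \<le> t then integral {0..t} f else - integral {t..0} f)"

lemma primitive_0 [simp]: "primitive f 0 = 0"
  by (simp add: primitive_def)

lemma primitive_has_vector_derivative:
  assumes c: "continuous_on UNIV f"
  shows "(primitive f has_vector_derivative f t) (at t)"
proof -
  define M where "M = \<bar>t\<bar> + 1"
  have c': "continuous_on S f" for S using c by (rule continuous_on_subset) auto
  hence i: "f integrable_on {u..v}" for u v by (intro integrable_continuous_real)
  have eq: "primitive f u = integral {-M..u} f - integral {-M..0} f" if "u \<in> {-M<..<M}" for u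
  proof (cases "0 \<le> u")
    case True
    have "integral {-M..0} f + integral {0..u} f = integral {-M..u} f"
      by (rule Henstock_Kurzweil_Integration.integral_combine[OF _ _ i]) (use True in \<open>auto simp: M_def\<close>)
    hence "integral {-M..u} f - integral {-M..0} f = integral {0..u} f" by (metis add_diff_cancel_left')
    thus ?thesis using True by (simp add: primitive_def)
  next
    case False
    have "integral {-M..u} f + integral {u..0} f = integral {-M..0} f"
      by (rule Henstock_Kurzweil_Integration.integral_combine[OF _ _ i]) (use that False in auto)
    hence "integral {-M..u} f - integral {-M..0} f = - integral {u..0} f" by (metis add_diff_cancel_left' minus_diff_eq)
    thus ?thesis using False by (simp add: primitive_def)
  qed
  have "((\<lambda>u. integral {-M..u} f) has_vector_derivative f t) (at t within {-M..M})"
    by (rule integral_has_vector_derivative[OF c']) (auto simp: M_def)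
  hence "((\<lambda>u. integral {-M..u} f - integral {-M..0} f) has_vector_derivative f t) (at t within {-M<..<M})"
    by (intro derivative_eq_intros) (auto intro: has_vector_derivative_within_subset)
  hence "(primitive f has_vector_derivative f t) (at t within {-M<..<M})"
    by (rule has_vector_derivative_transform[rotated 2]) (use eq in \<open>auto simp: M_def\<close>)
  moreover have "at t within {-M<..<M} = at t" by (rule at_within_open) (auto simp: M_def)
  ultimately show ?thesis by (simp only:)
qed

definition gap :: "real \<Rightarrow> real \<Rightarrow> real" where "gap a b = cosh b - cos a"
text \<open>
  With \<open>L = ln (2 (cosh b - cos a))\<close>, the second row of \<open>8\<pi> S(y) u\<^sup>\<bottom>\<close> is the 1-form
  \<open>(L - b \<partial>\<^sub>b L) da + b \<partial>\<^sub>a L db\<close>. Subtracting the differential of \<open>sin a L\<close> leaves \<open>rem1 da + rem2 db\<close>.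
  In this form every quotient has a numerator of higher order than \<open>gap\<close>, so that the remainder is
  continuous on the whole plane with the values that division by zero assigns.
\<close>

definition rem1 :: "real \<Rightarrow> real \<Rightarrow> real" where
  "rem1 a b = (1 - cos a) * ln (2 * gap a b) - cosh b - cos a - (b - sinh b) * sinh b / gap a b"
definition rem2 :: "real \<Rightarrow> real \<Rightarrow> real" where
  "rem2 a b = (b - sinh b) * sin a / gap a b"

lemma gap_nonneg [simp]: "0 \<le> gap a b" using cos_le_cosh[of a b] by (simp add: gap_def)

lemma gap_pos: "b \<noteq> 0 \<Longrightarrow> 0 < gap a b"
  using less_le_trans[OF _ square_le_cosh_minus_cos[of b a], of 0] by (simp add: gap_def)

lemma one_minus_cos_le_gap: "1 - cos a \<le> gap a b"
  using cosh_real_ge_1[of b] by (simp add: gap_def)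

lemma cosh_minus_one_le_gap: "cosh b - 1 \<le> gap a b"
  by (simp add: gap_def)

lemma sin_sq_le_gap: "(sin a)^2 \<le> 2 * gap a b"
proof -
  have "(sin a)^2 = (1 - cos a) * (1 + cos a)"
    using sin_cos_squared_add[of a] by (simp add: power2_eq_square algebra_simps)
  also have "\<dots> \<le> gap a b * 2"
  proof (intro mult_mono one_minus_cos_le_gap)
    show "1 + cos a \<le> 2" using cos_le_one[of a] by linarith
    show "0 \<le> 1 + cos a" using cos_ge_minus_one[of a] by linarith
  qed simp
  finally show ?thesis by simp
qed

lemma sinh_sq: "(sinh b)^2 = (cosh b - 1) * (cosh (b::real) + 1)"
  using cosh_square_eq[of b] by (simp add: power2_eq_square algebra_simps)

lemma sinh_sq_le_gap: "(sinh b)^2 \<le> (cosh b + 1) * gap a b"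
  unfolding sinh_sq using cosh_minus_one_le_gap[of b a] cosh_real_ge_1[of b]
  by (subst mult.commute, intro mult_left_mono) auto

lemma abs_le_abs_sinh: "\<bar>b\<bar> \<le> \<bar>sinh (b::real)\<bar>"
  using real_le_abs_sinh[of b] by (simp add: sinh_def exp_minus)

lemma sinh_minus_id_le: "\<bar>b - sinh b\<bar> \<le> \<bar>sinh b\<bar> * (cosh b - 1)" for b :: real
proof -
  have *: "sinh b - b \<le> sinh b * (cosh b - 1)" if "b \<ge> 0" for b :: real
  proof -
    define f where "f b = sinh b * cosh b - 2 * sinh b + b" for b :: real
    have "f 0 \<le> f b"
    proof (rule DERIV_nonneg_imp_nondecreasing[OF that])
      fix x :: real
      have "(f has_real_derivative (cosh x * cosh x + sinh x * sinh x - 2 * cosh x + 1)) (at x)"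
        unfolding f_def by (auto intro!: derivative_eq_intros)
      moreover have "cosh x * cosh x + sinh x * sinh x - 2 * cosh x + 1 = 2 * (cosh x * (cosh x - 1))"
        using cosh_square_eq[of x] by (simp add: power2_eq_square algebra_simps)
      moreover have "0 \<le> 2 * (cosh x * (cosh x - 1))" using cosh_real_ge_1[of x] by simp
      ultimately show "\<exists>y. (f has_real_derivative y) (at x) \<and> 0 \<le> y" by metis
    qed
    thus ?thesis by (simp add: f_def algebra_simps)
  qed
  have ge: "b \<le> sinh b" if "b \<ge> 0" for b :: real
    using abs_le_abs_sinh[of b] that sinh_real_nonneg_iff[of b] by linarith
  show ?thesis
  proof (cases "b \<ge> 0")
    case True thus ?thesis using *[of b] ge[of b] by simp
  next
    case False
    hence "sinh (-b) \<ge> 0" "sinh (-b) \<ge> -b" using ge[of "-b"] sinh_real_nonneg_iff[of "-b"] by auto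
    thus ?thesis using *[of "-b"] False by (simp add: abs_if)
  qed
qed

text \<open>
  Handles quotients that are continuous off the zero set of the denominator and vanish there
  together with a continuous majorant.
\<close>

lemma continuous_on_squeeze_at_zeros:
  fixes f g :: "'a::metric_space \<Rightarrow> real"
  assumes "closed Z" "continuous_on (- Z) f" "continuous_on UNIV g"
    and "\<And>p. \<bar>f p\<bar> \<le> g p" "\<And>p. p \<in> Z \<Longrightarrow> g p = 0"
  shows "continuous_on UNIV f"
proof (intro continuous_at_imp_continuous_on ballI)
  fix p
  show "isCont f p"
  proof (cases "p \<in> Z")
    case False
    thus ?thesis using assms(1,2) by (simp add: continuous_on_eq_continuous_at open_Compl)
  next
    case True
    have "f p = 0" using assms(4)[of p] assms(5)[OF True] by simp
    moreover have "(g \<longlongrightarrow> 0) (at p)"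
      using assms(3) assms(5)[OF True] by (metis continuous_on_eq_continuous_at isCont_def open_UNIV UNIV_I)
    hence "(f \<longlongrightarrow> 0) (at p)"
      by (rule Lim_null_comparison[rotated]) (use assms(4) in auto)
    ultimately show ?thesis by (simp add: isCont_def)
  qed
qed

lemma closed_gap_zero: "closed {p. gap (fst p) (snd p) = 0}"
  unfolding gap_def by (intro closed_Collect_eq continuous_intros)

lemma x_ln_x_le: "x * \<bar>ln x\<bar> \<le> 2 * sqrt x + x\<^sup>2" if "0 \<le> x" for x :: real
proof (cases "x = 0")
  case False
  hence x: "x > 0" using that by simp
  show ?thesis
  proof (cases "x \<ge> 1")
    case True
    have "x * \<bar>ln x\<bar> \<le> x * x" using True ln_le_minus_one[of x] by (intro mult_left_mono) auto
    also have "\<dots> \<le> 2 * sqrt x + x\<^sup>2" using x by (simp add: power2_eq_square)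
    finally show ?thesis .
  next
    case False
    have s: "0 < sqrt x" "sqrt x < 1" using x False by auto
    have "- ln x = 2 * ln (1 / sqrt x)" using x by (simp add: ln_div ln_sqrt)
    also have "\<dots> \<le> 2 * (1 / sqrt x)" using ln_le_minus_one[of "1 / sqrt x"] s by simp
    finally have "\<bar>ln x\<bar> \<le> 2 * (1 / sqrt x)" using False x by (simp add: abs_if)
    hence "x * \<bar>ln x\<bar> \<le> x * (2 * (1 / sqrt x))" using x by (intro mult_left_mono) auto
    also have "\<dots> = 2 * (x / sqrt x)" by simp
    also have "\<dots> = 2 * sqrt x" using x by (simp only: real_div_sqrt less_imp_le)
    finally show ?thesis by (simp add: add_increasing2)
  qed
qed simp

lemma continuous_rem1: "continuous_on UNIV (\<lambda>p. rem1 (fst p) (snd p))"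
proof -
  let ?Z = "{p. gap (fst p) (snd p) = 0}"
  have nz: "continuous_on (- ?Z) (\<lambda>p. gap (fst p) (snd p))" unfolding gap_def by (intro continuous_intros)
  have 1: "continuous_on UNIV (\<lambda>p. (1 - cos (fst p)) * ln (2 * gap (fst p) (snd p)))"
  proof (rule continuous_on_squeeze_at_zeros[OF closed_gap_zero,
        where g = "\<lambda>p. (1/2) * (2 * sqrt (2 * gap (fst p) (snd p)) + (2 * gap (fst p) (snd p))\<^sup>2)"])
    show "continuous_on (- ?Z) (\<lambda>p. (1 - cos (fst p)) * ln (2 * gap (fst p) (snd p)))"
      by (intro continuous_intros nz) (auto simp: less_le)
    show "continuous_on UNIV (\<lambda>p. (1/2) * (2 * sqrt (2 * gap (fst p) (snd p)) + (2 * gap (fst p) (snd p))\<^sup>2))"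
      unfolding gap_def by (intro continuous_intros)
    fix p :: "real \<times> real"
    let ?x = "2 * gap (fst p) (snd p)"
    have "\<bar>(1 - cos (fst p)) * ln ?x\<bar> \<le> gap (fst p) (snd p) * \<bar>ln ?x\<bar>"
      unfolding abs_mult using one_minus_cos_le_gap[of "fst p" "snd p"] by (intro mult_right_mono) auto
    also have "\<dots> = (1/2) * (?x * \<bar>ln ?x\<bar>)" by simp
    also have "\<dots> \<le> (1/2) * (2 * sqrt ?x + ?x\<^sup>2)" by (intro mult_left_mono x_ln_x_le) auto
    finally show "\<bar>(1 - cos (fst p)) * ln ?x\<bar> \<le> (1/2) * (2 * sqrt ?x + ?x\<^sup>2)" .
  qed auto
  have 2: "continuous_on UNIV (\<lambda>p. (snd p - sinh (snd p)) * sinh (snd p) / gap (fst p) (snd p))"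
  proof (rule continuous_on_squeeze_at_zeros[OF closed_gap_zero,
        where g = "\<lambda>p. (cosh (snd p) + 1) * (cosh (snd p) - 1)"])
    show "continuous_on (- ?Z) (\<lambda>p. (snd p - sinh (snd p)) * sinh (snd p) / gap (fst p) (snd p))"
      by (intro continuous_intros nz) auto
    show "continuous_on UNIV (\<lambda>p::real\<times>real. (cosh (snd p) + 1) * (cosh (snd p) - 1))"
      by (intro continuous_intros)
    show "(cosh (snd p) + 1) * (cosh (snd p) - 1) = 0" if "p \<in> ?Z" for p :: "real \<times> real"
      using that gap_pos[of "snd p" "fst p"] by (cases "snd p = 0") auto
    fix p :: "real \<times> real"
    obtain a b where p: "p = (a, b)" by (cases p)
    have "\<bar>(b - sinh b) * sinh b / gap a b\<bar> = \<bar>b - sinh b\<bar> * \<bar>sinh b\<bar> / gap a b"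
      by (simp add: abs_mult)
    also have "\<dots> \<le> (\<bar>sinh b\<bar> * (cosh b - 1)) * \<bar>sinh b\<bar> / gap a b"
      by (intro divide_right_mono mult_right_mono sinh_minus_id_le) auto
    also have "\<dots> = ((sinh b)^2 / gap a b) * (cosh b - 1)" by (simp add: power2_eq_square)
    also have "\<dots> \<le> (cosh b + 1) * (cosh b - 1)"
    proof (rule mult_right_mono)
      show "(sinh b)^2 / gap a b \<le> cosh b + 1"
        using sinh_sq_le_gap[of b a] cosh_real_ge_1[of b] gap_nonneg[of a b]
        by (cases "gap a b = 0") (auto simp: divide_le_eq less_le)
    qed (use cosh_real_ge_1[of b] in simp)
    finally show "\<bar>(snd p - sinh (snd p)) * sinh (snd p) / gap (fst p) (snd p)\<bar> \<le> (cosh (snd p) + 1) * (cosh (snd p) - 1)"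
      by (simp add: p)
  qed
  show ?thesis unfolding rem1_def by (intro continuous_intros 1 2)
qed

lemma continuous_rem2: "continuous_on UNIV (\<lambda>p. rem2 (fst p) (snd p))"
proof -
  let ?Z = "{p. gap (fst p) (snd p) = 0}"
  have nz: "continuous_on (- ?Z) (\<lambda>p. gap (fst p) (snd p))" unfolding gap_def by (intro continuous_intros)
  show ?thesis unfolding rem2_def
  proof (rule continuous_on_squeeze_at_zeros[OF closed_gap_zero, where g = "\<lambda>p. \<bar>sinh (snd p)\<bar>"])
    show "continuous_on (- ?Z) (\<lambda>p. (snd p - sinh (snd p)) * sin (fst p) / gap (fst p) (snd p))"
      by (intro continuous_intros nz) auto
    show "continuous_on UNIV (\<lambda>p::real\<times>real. \<bar>sinh (snd p)\<bar>)" by (intro continuous_intros)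
    show "\<bar>sinh (snd p)\<bar> = 0" if "p \<in> ?Z" for p :: "real \<times> real"
      using that gap_pos[of "snd p" "fst p"] by (cases "snd p = 0") auto
    fix p :: "real \<times> real"
    obtain a b where p: "p = (a, b)" by (cases p)
    have "\<bar>(b - sinh b) * sin a / gap a b\<bar> = \<bar>b - sinh b\<bar> * \<bar>sin a\<bar> / gap a b"
      by (simp add: abs_mult)
    also have "\<dots> \<le> (\<bar>sinh b\<bar> * (cosh b - 1)) * 1 / gap a b"
      by (intro divide_right_mono mult_mono sinh_minus_id_le) (simp_all add: cosh_real_ge_1)
    also have "\<dots> = \<bar>sinh b\<bar> * ((cosh b - 1) / gap a b)" by simp
    also have "\<dots> \<le> \<bar>sinh b\<bar> * 1"
      using cosh_minus_one_le_gap[of b a] gap_nonneg[of a b]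
      by (intro mult_left_mono) (cases "gap a b = 0", auto simp: divide_le_eq less_le)
    finally show "\<bar>(snd p - sinh (snd p)) * sin (fst p) / gap (fst p) (snd p)\<bar> \<le> \<bar>sinh (snd p)\<bar>"
      by (simp add: p)
  qed
qed

lemma continuous_on_pairD:
  fixes F :: "real \<Rightarrow> real \<Rightarrow> 'c::topological_space"
  assumes "continuous_on UNIV (\<lambda>p. F (fst p) (snd p))"
    and "continuous_on S f" "continuous_on S g"
  shows "continuous_on S (\<lambda>x. F (f x) (g x))"
  using continuous_on_compose2[OF assms(1), of S "\<lambda>x. (f x, g x)"] assms(2,3)
  by (auto intro: continuous_intros)

text \<open>
  The common value of the two mixed partial derivatives away from \<open>b = 0\<close>; their equality says
  that the remainder is closed, which amounts to harmonicity of the logarithm.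
\<close>

definition rem12 :: "real \<Rightarrow> real \<Rightarrow> real" where
  "rem12 a b = (b - sinh b) * (cosh b * cos a - 1) / (gap a b)\<^sup>2"

lemma rem2_deriv1:
  assumes "b \<noteq> 0" shows "((\<lambda>a. rem2 a b) has_real_derivative rem12 a b) (at a within S)"
proof -
  have g: "gap a b \<noteq> 0" using gap_pos[OF assms, of a] by simp
  have "((\<lambda>a. rem2 a b) has_real_derivative ((b - sinh b) * cos a * gap a b - (b - sinh b) * sin a * sin a) / (gap a b * gap a b)) (at a within S)"
    unfolding rem2_def
  proof (rule DERIV_divide)
    show "gap a b \<noteq> 0" by (rule g)
    show "((\<lambda>a. (b - sinh b) * sin a) has_real_derivative (b - sinh b) * cos a) (at a within S)"
      "((\<lambda>a. gap a b) has_real_derivative sin a) (at a within S)"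
      unfolding gap_def by (auto intro!: derivative_eq_intros)
  qed
  moreover have "(b - sinh b) * cos a * gap a b - (b - sinh b) * sin a * sin a = (b - sinh b) * (cosh b * cos a - 1)"
  proof -
    have "cos a * gap a b - sin a * sin a = cosh b * cos a - 1"
      using sin_cos_squared_add[of a] by (simp add: gap_def power2_eq_square algebra_simps)
    thus ?thesis by (metis mult.assoc right_diff_distrib)
  qed
  ultimately show ?thesis by (simp add: rem12_def power2_eq_square)
qed

lemma rem1_deriv2:
  assumes "b \<noteq> 0" shows "((\<lambda>b. rem1 a b) has_real_derivative rem12 a b) (at b within S)"
proof -
  have g: "0 < gap a b" using gap_pos[OF assms, of a] by simp
  let ?k = "b - sinh b" and ?d = "gap a b"
  have "((\<lambda>b. rem1 a b) has_real_derivative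
      (1 - cos a) * (sinh b / ?d) - sinh b - (((1 - cosh b) * sinh b + ?k * cosh b) * ?d - ?k * sinh b * sinh b) / (?d * ?d)) (at b within S)"
    unfolding rem1_def
  proof -
    have d: "((\<lambda>b. gap a b) has_real_derivative sinh b) (at b within S)"
      unfolding gap_def by (auto intro!: derivative_eq_intros)
    have 1: "((\<lambda>b. (1 - cos a) * ln (2 * gap a b)) has_real_derivative (1 - cos a) * (sinh b / ?d)) (at b within S)"
      using g by (auto intro!: derivative_eq_intros d simp: field_simps)
    have 2: "((\<lambda>b. (b - sinh b) * sinh b) has_real_derivative (1 - cosh b) * sinh b + ?k * cosh b) (at b within S)"
      by (auto intro!: derivative_eq_intros)
    have 3: "(cosh has_real_derivative sinh b) (at b within S)" "((\<lambda>b. cos a) has_real_derivative 0) (at b within S)"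
      by (auto intro!: derivative_eq_intros)
    have 4: "((\<lambda>b. (b - sinh b) * sinh b / gap a b) has_real_derivative
        (((1 - cosh b) * sinh b + ?k * cosh b) * ?d - ?k * sinh b * sinh b) / (?d * ?d)) (at b within S)"
      by (rule DERIV_divide[OF 2 d]) (use g in simp)
    show "((\<lambda>b. (1 - cos a) * ln (2 * gap a b) - cosh b - cos a - (b - sinh b) * sinh b / gap a b) has_real_derivative
      (1 - cos a) * (sinh b / ?d) - sinh b - (((1 - cosh b) * sinh b + ?k * cosh b) * ?d - ?k * sinh b * sinh b) / (?d * ?d)) (at b within S)"
      using DERIV_diff[OF DERIV_diff[OF DERIV_diff[OF 1 3(1)] 3(2)] 4] by simp
  qed
  moreover have "(1 - cos a) * (sinh b / ?d) - sinh b - (((1 - cosh b) * sinh b + ?k * cosh b) * ?d - ?k * sinh b * sinh b) / (?d * ?d) = rem12 a b"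
  proof -
    have "(1 - cos a) * (sinh b / ?d) - sinh b - (((1 - cosh b) * sinh b + ?k * cosh b) * ?d - ?k * sinh b * sinh b) / (?d * ?d)
      = (sinh b * ?d * ((1 - cos a) - ?d + (cosh b - 1)) - ?k * (cosh b * ?d - sinh b * sinh b)) / (?d * ?d)"
      using g by (simp add: field_simps)
    also have "(1 - cos a) - ?d + (cosh b - 1) = 0" by (simp add: gap_def)
    also have "cosh b * ?d - sinh b * sinh b = 1 - cosh b * cos a"
      using cosh_square_eq[of b] by (simp add: gap_def power2_eq_square algebra_simps)
    finally show ?thesis by (simp add: rem12_def power2_eq_square algebra_simps)
  qed
  ultimately show ?thesis by simp
qed

text \<open>
  For \<open>b \<noteq> 0\<close> this is differentiation under the integral sign and closedness. The segment may cross
  singularities only when \<open>b = 0\<close>; there the fundamental theorem with one exceptional point applies,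
  since both the integral and the claimed derivative are continuous in \<open>b\<close>.
\<close>

lemma integral_rem1_deriv:
  assumes "x \<le> y"
  shows "((\<lambda>b. integral {x..y} (\<lambda>s. rem1 s b)) has_real_derivative rem2 y b - rem2 x b) (at b)"
proof -
  let ?G = "\<lambda>b. integral {x..y} (\<lambda>s. rem1 s b)" and ?h = "\<lambda>b. rem2 y b - rem2 x b"
  have crem1: "continuous_on S (\<lambda>q. rem1 (f q) (g q))" if "continuous_on S f" "continuous_on S g" for S :: "'a::topological_space set" and f g
    by (rule continuous_on_pairD[OF continuous_rem1 that])
  have crem12: "continuous_on (U \<times> cbox x y) (\<lambda>(b, s). rem12 s b)" if "0 \<notin> U" for U
    unfolding rem12_def gap_def split_beta
    using that gap_pos by (intro continuous_intros) (auto simp: gap_def, metis less_irrefl)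
  have off: "(?G has_real_derivative ?h b) (at b)" if b: "b \<noteq> 0" for b
  proof -
    define U where "U = (if b > 0 then {0<..} else {..<0::real})"
    have U: "open U" "convex U" "b \<in> U" "0 \<notin> U" using b by (auto simp: U_def)
    have "((\<lambda>b. integral (cbox x y) (\<lambda>s. rem1 s b)) has_real_derivative integral (cbox x y) (\<lambda>s. rem12 s b)) (at b within U)"
    proof (rule leibniz_rule_field_derivative[OF _ _ _ U(3,2)])
      show "((\<lambda>b. rem1 t b) has_real_derivative rem12 t b) (at b within U)" if "b \<in> U" for b t
        using that U(4) by (intro rem1_deriv2) auto
      show "(\<lambda>s. rem1 s b) integrable_on cbox x y" for b
        by (intro integrable_continuous crem1 continuous_intros)
    qed (rule crem12[OF U(4)])
    moreover have "((\<lambda>s. rem12 s b) has_integral rem2 y b - rem2 x b) {x..y}"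
      by (rule fundamental_theorem_of_calculus[OF assms])
        (use rem2_deriv1[OF b] in \<open>auto simp: has_real_derivative_iff_has_vector_derivative\<close>)
    hence "integral (cbox x y) (\<lambda>s. rem12 s b) = ?h b" by (simp add: integral_unique)
    moreover have "at b within U = at b" by (rule at_within_open[OF U(3,1)])
    ultimately show ?thesis by (simp only: box_real(2))
  qed
  have ch: "continuous_on S ?h" for S
    by (intro continuous_intros continuous_on_pairD[OF continuous_rem2])
  have cG: "continuous_on S ?G" for S
  proof -
    have "continuous_on (S \<times> cbox x y) (\<lambda>(b, s). rem1 s b)"
      unfolding split_beta by (intro crem1 continuous_intros)
    from integral_continuous_on_param[OF this] show ?thesis by simp
  qed
  show ?thesis
  proof (cases "b = 0")
    case True
    have I: "(?h has_integral (?G u - ?G (-1))) {-1..u}" if "-1 \<le> u" for u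
      by (rule fundamental_theorem_of_calculus_interior_strong[of "{0}"])
        (use off that cG in \<open>auto simp: has_real_derivative_iff_has_vector_derivative\<close>)
    have "((\<lambda>u. integral {-1..u} ?h) has_vector_derivative ?h 0) (at 0 within {-1..1})"
      by (rule integral_has_vector_derivative[OF ch]) auto
    hence "((\<lambda>u. integral {-1..u} ?h + ?G (-1)) has_vector_derivative ?h 0) (at 0 within {-1<..<1})"
      by (intro derivative_eq_intros) (auto intro: has_vector_derivative_within_subset)
    hence "(?G has_vector_derivative ?h 0) (at 0 within {-1<..<1})"
      by (rule has_vector_derivative_transform[rotated 2]) (auto simp: integral_unique[OF I])
    moreover have "at 0 within {-1<..<1} = at (0::real)" by (rule at_within_open) auto
    ultimately show ?thesis using True by (simp only: has_real_derivative_iff_has_vector_derivative)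
  qed (rule off)
qed

definition rem_potential :: "real \<Rightarrow> real \<Rightarrow> real" where
  "rem_potential a b = primitive (\<lambda>s. rem1 s b) a"

text \<open>
  The boundary term at \<open>a = 0\<close> vanishes because \<open>rem2\<close> contains the factor \<open>sin a\<close>.
\<close>

lemma rem_potential_deriv2: "((\<lambda>b. rem_potential a b) has_real_derivative rem2 a b) (at b)"
proof -
  have z: "rem2 0 b = 0" by (simp add: rem2_def)
  show ?thesis
  proof (cases "0 \<le> a")
    case True
    thus ?thesis using integral_rem1_deriv[of 0 a b] z by (simp add: rem_potential_def primitive_def)
  next
    case False
    thus ?thesis using DERIV_minus[OF integral_rem1_deriv[of a 0 b]] z by (simp add: rem_potential_def primitive_def)
  qed
qed

lemma rem_potential_deriv1: "((\<lambda>a. rem_potential a b) has_real_derivative rem1 a b) (at a)"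
proof -
  have "continuous_on UNIV (\<lambda>s. rem1 s b)" by (intro continuous_on_pairD[OF continuous_rem1] continuous_intros)
  hence "(primitive (\<lambda>s. rem1 s b) has_vector_derivative rem1 a b) (at a)" by (rule primitive_has_vector_derivative)
  thus ?thesis unfolding rem_potential_def by (simp only: has_real_derivative_iff_has_vector_derivative)
qed

lemma rem_potential_has_derivative:
  "((\<lambda>y::real^2. rem_potential (y$1) (y$2)) has_derivative (\<lambda>u. rem1 (y$1) (y$2) * u$1 + rem2 (y$1) (y$2) * u$2)) (at y)"
proof -
  have "((\<lambda>(a, b). rem_potential a b) has_derivative (\<lambda>(ta, tb). rem1 (y$1) (y$2) * ta + blinfun_mult_right (rem2 (y$1) (y$2)) tb))
     (at (y$1, y$2) within UNIV \<times> UNIV)"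
  proof (rule has_derivative_partialsI[where fy = "\<lambda>a b. blinfun_mult_right (rem2 a b)"])
    show "((\<lambda>a. rem_potential a (y$2)) has_derivative (\<lambda>ta. rem1 (y$1) (y$2) * ta)) (at (y$1) within UNIV)"
      using rem_potential_deriv1 by (simp add: has_field_derivative_def)
    show "((\<lambda>b. rem_potential a b) has_derivative blinfun_mult_right (rem2 a b)) (at b within UNIV)" for a b
      using rem_potential_deriv2[of a b] by (simp add: has_field_derivative_def)
    have "continuous_on UNIV (\<lambda>p. blinfun_mult_right (rem2 (fst p) (snd p)))"
      by (intro bounded_linear.continuous_on[OF bounded_linear_blinfun_mult_right] continuous_rem2)
    thus "continuous (at (y$1, y$2) within UNIV \<times> UNIV) (\<lambda>(a, b). blinfun_mult_right (rem2 a b))"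
      unfolding case_prod_unfold by (simp add: continuous_on_eq_continuous_at)
  qed auto
  hence 1: "((\<lambda>p. rem_potential (fst p) (snd p)) has_derivative (\<lambda>t. rem1 (y$1) (y$2) * fst t + rem2 (y$1) (y$2) * snd t)) (at (y$1, y$2))"
    by (simp add: case_prod_unfold)
  have 2: "((\<lambda>y::real^2. (y$1, y$2)) has_derivative (\<lambda>u. (u$1, u$2))) (at y)"
    by (intro derivative_intros bounded_linear_imp_has_derivative bounded_linear_vec_nth)
  from diff_chain_at[OF 2 1] show ?thesis by (simp add: o_def)
qed

text \<open>
  The gradient is periodic, so the increment over a period is constant. Its value is not computed:
  a constant is harmless in the integration by parts.
\<close>

lemma rem_potential_periodic:
  "rem_potential (a + 2*pi) b - rem_potential a b = rem_potential (2*pi) 0 - rem_potential 0 0"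
proof -
  define g where "g y = rem_potential (y$1 + 2*pi) (y$2) - rem_potential (y$1) (y$2)" for y :: "real^2"
  have R: "rem1 (s + 2*pi) t = rem1 s t" "rem2 (s + 2*pi) t = rem2 s t" for s t
    by (simp_all add: rem1_def rem2_def gap_def)
  have "(g has_derivative (\<lambda>u. 0)) (at y)" for y
  proof -
    have "((\<lambda>y::real^2. y + vector [2*pi, 0]) has_derivative (\<lambda>u. u)) (at y)"
      by (auto intro!: derivative_eq_intros)
    from diff_chain_at[OF this rem_potential_has_derivative[of "y + vector [2*pi,0]"]]
    have "((\<lambda>y::real^2. rem_potential (y$1 + 2*pi) (y$2)) has_derivative (\<lambda>u. rem1 (y$1) (y$2) * u$1 + rem2 (y$1) (y$2) * u$2)) (at y)"
      by (simp add: o_def R)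
    from has_derivative_diff[OF this rem_potential_has_derivative[of y]] show ?thesis
      unfolding g_def by simp
  qed
  hence "\<exists>c. \<forall>y\<in>UNIV. g y = c" by (intro has_derivative_zero_constant) auto
  hence "g (vector [a, b]) = g (vector [0, 0])" by auto
  thus ?thesis by (simp add: g_def)
qed

definition log_gap :: "real \<Rightarrow> real \<Rightarrow> real \<Rightarrow> real" where
  "log_gap e a b = ln (2 * (gap a b + e))"

text \<open>
  The potential with \<open>gap\<close> replaced by \<open>gap + e\<close> in its singular part. For \<open>e = 0\<close> its derivative in
  direction \<open>u\<close> would be \<open>S(y) u\<^sup>\<bottom>\<close>.
\<close>

definition stream :: "real \<Rightarrow> real^2 \<Rightarrow> real^2" where
  "stream e y = (1/(8*pi)) *\<^sub>R vector [- (y$2 * log_gap e (y$1) (y$2)), sin (y$1) * log_gap e (y$1) (y$2) + rem_potential (y$1) (y$2)]"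

text \<open>
  The derivative of \<open>stream\<close> at \<open>y\<close> in direction \<open>u\<close>.
\<close>

definition dstream :: "real \<Rightarrow> real^2 \<Rightarrow> real^2 \<Rightarrow> real^2" where
  "dstream e y u = (1/(8*pi)) *\<^sub>R vector
     [- (y$2 * sin (y$1) / (gap (y$1) (y$2) + e)) * u$1
        - (log_gap e (y$1) (y$2) + y$2 * sinh (y$2) / (gap (y$1) (y$2) + e)) * u$2,
      (cos (y$1) * log_gap e (y$1) (y$2) + (sin (y$1))\<^sup>2 / (gap (y$1) (y$2) + e) + rem1 (y$1) (y$2)) * u$1
        + (sin (y$1) * sinh (y$2) / (gap (y$1) (y$2) + e) + rem2 (y$1) (y$2)) * u$2]"

lemma vector2_axis: "(vector [s, t] :: real^2) = s *\<^sub>R axis 1 1 + t *\<^sub>R axis 2 1"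
  by (simp add: vec2_eq_iff axis_def)

lemma has_derivative_vec2:
  assumes "(f has_derivative f') F" "(g has_derivative g') F"
  shows "((\<lambda>y. vector [f y, g y] :: real^2) has_derivative (\<lambda>u. vector [f' u, g' u])) F"
  unfolding vector2_axis using assms by (intro derivative_intros)

lemma continuous_on_vec2 [continuous_intros]:
  assumes "continuous_on S f" "continuous_on S g"
  shows "continuous_on S (\<lambda>y. vector [f y, g y] :: real^2)"
  unfolding vector2_axis using assms by (intro continuous_intros)

lemma stream_has_derivative:
  assumes e: "0 < e"
  shows "(stream e has_derivative dstream e y) (at y)"
proof -
  have n: "((\<lambda>y::real^2. y $ i) has_derivative (\<lambda>u. u $ i)) (at y)" for i
    by (intro bounded_linear_imp_has_derivative bounded_linear_vec_nth)
  let ?d = "gap (y$1) (y$2) + e"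
  have d: "?d > 0" using e gap_nonneg[of "y$1" "y$2"] by linarith
  have c: "(cosh has_real_derivative sinh x) (at x)" for x :: real by (auto intro!: derivative_eq_intros)
  have ch: "((\<lambda>y::real^2. cosh (y$2)) has_derivative (\<lambda>u. u$2 * sinh (y$2))) (at y)"
    "((\<lambda>y::real^2. cos (y$1)) has_derivative (\<lambda>u. u$1 * - sin (y$1))) (at y)"
    "((\<lambda>y::real^2. sin (y$1)) has_derivative (\<lambda>u. u$1 * cos (y$1))) (at y)"
    using DERIV_compose_FDERIV[OF _ n, of cosh] DERIV_compose_FDERIV[OF _ n, of cos] DERIV_compose_FDERIV[OF _ n, of sin]
    by (metis c DERIV_cos DERIV_sin)+
  have g: "((\<lambda>y::real^2. 2 * (gap (y$1) (y$2) + e)) has_derivative (\<lambda>u. 2 * (u$2 * sinh (y$2) + u$1 * sin (y$1)))) (at y)"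
    unfolding gap_def by (rule derivative_eq_intros ch refl)+ auto
  have "((\<lambda>y::real^2. ln (2 * (gap (y$1) (y$2) + e))) has_derivative
      (\<lambda>u. 2 * (u$2 * sinh (y$2) + u$1 * sin (y$1)) * (1 / (2 * ?d)))) (at y)"
    by (rule DERIV_compose_FDERIV[OF _ g]) (use d DERIV_ln_divide[of "2 * ?d"] in simp)
  note Lraw = this
  have L: "((\<lambda>y::real^2. log_gap e (y$1) (y$2)) has_derivative (\<lambda>u. (u$2 * sinh (y$2) + u$1 * sin (y$1)) / ?d)) (at y)"
  proof -
    have h: "2 * A * (1 / (2 * q)) = A / q" for A q :: real by simp
    show ?thesis using Lraw unfolding log_gap_def by (simp only: h)
  qed
  have 1: "((\<lambda>y::real^2. - (y$2 * log_gap e (y$1) (y$2))) has_derivative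
      (\<lambda>u. - (y$2 * ((u$2 * sinh (y$2) + u$1 * sin (y$1)) / ?d) + u$2 * log_gap e (y$1) (y$2)))) (at y)"
    by (intro has_derivative_minus has_derivative_mult n L)
  have 2: "((\<lambda>y::real^2. sin (y$1) * log_gap e (y$1) (y$2) + rem_potential (y$1) (y$2)) has_derivative
      (\<lambda>u. (sin (y$1) * ((u$2 * sinh (y$2) + u$1 * sin (y$1)) / ?d) + u$1 * cos (y$1) * log_gap e (y$1) (y$2))
         + (rem1 (y$1) (y$2) * u$1 + rem2 (y$1) (y$2) * u$2))) (at y)"
    by (intro has_derivative_add has_derivative_mult ch L rem_potential_has_derivative)
  have "((\<lambda>y::real^2. (1/(8*pi)) *\<^sub>R vector [- (y$2 * log_gap e (y$1) (y$2)), sin (y$1) * log_gap e (y$1) (y$2) + rem_potential (y$1) (y$2)] :: real^2)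
    has_derivative dstream e y) (at y)"
  proof (rule has_derivative_eq_rhs[OF has_derivative_scaleR_right[OF has_derivative_vec2[OF 1 2]]])
    show "(\<lambda>u. (1/(8*pi)) *\<^sub>R (vector [- (y$2 * ((u$2 * sinh (y$2) + u$1 * sin (y$1)) / ?d) + u$2 * log_gap e (y$1) (y$2)),
       (sin (y$1) * ((u$2 * sinh (y$2) + u$1 * sin (y$1)) / ?d) + u$1 * cos (y$1) * log_gap e (y$1) (y$2))
         + (rem1 (y$1) (y$2) * u$1 + rem2 (y$1) (y$2) * u$2)] :: real^2)) = dstream e y"
    proof
      fix u :: "real^2"
      define q where "q = 1 / ?d"
      have q: "x / ?d = x * q" for x by (simp add: q_def)
      show "(1/(8*pi)) *\<^sub>R (vector [- (y$2 * ((u$2 * sinh (y$2) + u$1 * sin (y$1)) / ?d) + u$2 * log_gap e (y$1) (y$2)),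
       (sin (y$1) * ((u$2 * sinh (y$2) + u$1 * sin (y$1)) / ?d) + u$1 * cos (y$1) * log_gap e (y$1) (y$2))
         + (rem1 (y$1) (y$2) * u$1 + rem2 (y$1) (y$2) * u$2)] :: real^2) = dstream e y u"
        unfolding dstream_def q by (simp add: vec2_eq_iff algebra_simps power2_eq_square)
    qed
  qed
  thus ?thesis unfolding stream_def[abs_def] .
qed

lemma continuous_dstream:
  fixes S :: "'a::t2_space set"
  assumes e: "0 < e" and f: "continuous_on S f" and g: "continuous_on S g"
  shows "continuous_on S (\<lambda>x. dstream e (f x) (g x))"
proof -
  have c: "continuous_on S (\<lambda>x. f x $ i)" "continuous_on S (\<lambda>x. g x $ i)" for i
    using f g by (auto intro: continuous_intros)
  have d: "gap (f x $ 1) (f x $ 2) + e \<noteq> 0" for x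
    using e gap_nonneg[of "f x $ 1" "f x $ 2"] by linarith
  hence d': "2 * (gap (f x $ 1) (f x $ 2) + e) \<noteq> 0" for x by (simp only: mult_eq_0_iff) simp
  have gc: "continuous_on S (\<lambda>x. gap (f x $ 1) (f x $ 2))" 
    unfolding gap_def by (intro continuous_on_diff continuous_on_cosh continuous_on_cos c)
  have t: "continuous_on S (\<lambda>x. cos (f x $ 1))" "continuous_on S (\<lambda>x. sin (f x $ 1))" "continuous_on S (\<lambda>x. sinh (f x $ 2))"
    by (rule continuous_on_cos[OF c(1)] continuous_on_sin[OF c(1)] continuous_on_sinh[OF c(1)])+
  have R: "continuous_on S (\<lambda>x. rem1 (f x $ 1) (f x $ 2))" "continuous_on S (\<lambda>x. rem2 (f x $ 1) (f x $ 2))"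
    by (intro continuous_on_pairD[OF continuous_rem1] continuous_on_pairD[OF continuous_rem2] c)+
  have l: "continuous_on S (\<lambda>x. ln (2 * (gap (f x $ 1) (f x $ 2) + e)))"
    using d' by (intro continuous_on_ln continuous_intros gc) auto
  have q: "continuous_on S (\<lambda>x. h x / (gap (f x $ 1) (f x $ 2) + e))" if "continuous_on S h" for h
    using d that by (intro continuous_on_divide continuous_intros gc) auto
  show ?thesis unfolding dstream_def log_gap_def
    by (intro continuous_on_scaleR continuous_on_const continuous_on_vec2 continuous_on_add continuous_on_diff
        continuous_on_minus continuous_on_mult continuous_on_power q R t c l)
qed

lemma continuous_stream:
  assumes e: "0 < e" and f: "continuous_on S f"
  shows "continuous_on S (\<lambda>x. stream e (f x))"
proof -
  have "continuous_on UNIV (stream e)"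
    using stream_has_derivative[OF e] by (intro continuous_at_imp_continuous_on ballI has_derivative_continuous)
  thus ?thesis using f by (rule continuous_on_compose2) auto
qed

lemma stream_periodic: "stream e (y + vector [2*pi, 0]) - stream e y = stream e (vector [2*pi, 0]) - stream e 0"
proof -
  have L: "log_gap e (a + 2*pi) b = log_gap e a b" for a b by (simp add: log_gap_def gap_def)
  show ?thesis
    using rem_potential_periodic[of "y$1" "y$2"] L[of "y$1" "y$2"] L[of 0 0]
    unfolding stream_def scaleR_diff_right[symmetric] by (simp add: vec2_eq_iff)
qed

text \<open>
  At \<open>e = 0\<close> the two sides agree by the identity
  \<open>((sin a)\<^sup>2 + (sinh b)\<^sup>2) / gap a b = cosh b + cos a\<close>. For \<open>e > 0\<close> the error is controlled by
  \<open>ln (1 + e/gap)\<close> and by \<open>e / (gap + e)\<close>. Both are bounded by the power 1/4 of \<open>e/gap\<close>, chosen because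
  \<open>gap\<close> is of the order of the squared parameter distance: the resulting singularity of order 1/2 is
  integrable.
\<close>

lemma dstream_stokeslet_diff:
  assumes e: "0 < e" and y: "0 < gap (y$1) (y$2)" and B: "\<bar>y$2\<bar> \<le> B"
  shows "norm (dstream e y u - stokeslet y *v perp u) \<le> 4 * (cosh B + 5) * (e / gap (y$1) (y$2)) powr (1/4) * norm u"
proof -
  define a b d H where "a = y$1" and "b = y$2" and "d = gap a b" and "H = cosh B + 1"
  define t where "t = 1/d - 1/(d+e)"
  define l where "l = log_gap e a b - ln (2*d)"
  define x where "x = e / d"
  define r where "r = x powr (1/4)"
  have d: "d > 0" using y by (simp add: d_def a_def b_def)
  have x: "x > 0" using d e by (simp add: x_def)
  have H2: "H \<ge> 2" using cosh_real_ge_1[of B] by (simp add: H_def)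
  have r0: "r \<ge> 0" by (simp add: r_def)
  have t0: "t \<ge> 0" using d e by (simp add: t_def frac_le)
  have dt: "d * t \<le> r"
  proof -
    have "t = e / (d * (d + e))" using d e unfolding t_def by (simp add: field_simps)
    hence "d * t = e / (d + e)" using d by simp
    moreover have "1 + x = (d + e) / d" using d by (simp add: x_def add_divide_distrib)
    hence "x / (1 + x) = e / (d + e)" using d by (simp add: x_def)
    ultimately have "d * t = x / (1 + x)" by simp
    also have "\<dots> \<le> r"
    proof (cases "x \<le> 1")
      case True
      have "x / (1 + x) \<le> x" using x by (simp add: field_simps)
      also have "x \<le> r" unfolding r_def using powr_mono'[of "1/4" 1 x] x True by simp
      finally show ?thesis .
    next
      case False
      have "x / (1 + x) \<le> 1" using x by simp
      also have "1 \<le> r" unfolding r_def using False by (intro ge_one_powr_ge_zero) auto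
      finally show ?thesis .
    qed
    finally show ?thesis .
  qed
  have l: "0 \<le> l" "l \<le> 4 * r"
  proof -
    have "1 + x = (2 * (d + e)) / (2 * d)" using d by (simp add: x_def add_divide_distrib)
    hence "ln (1 + x) = ln (2 * (d + e)) - ln (2 * d)"
      using d e by (simp only:) (subst ln_div, auto)
    hence "l = ln (1 + x)" by (simp only: l_def log_gap_def d_def)
    thus "0 \<le> l" "l \<le> 4 * r" using ln_one_plus_le_powr[of x "1/4"] x by (simp_all add: r_def)
  qed
  have b2: "b\<^sup>2 \<le> H * d"
    using square_le_cosh_minus_cos[of b a] mult_right_mono[OF H2 less_imp_le[OF d]] unfolding d_def gap_def by (rule order_trans)
  have s2: "(sin a)\<^sup>2 \<le> H * d"
    using sin_sq_le_gap[of a b] mult_right_mono[OF H2 less_imp_le[OF d]] unfolding d_def by (rule order_trans)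
  have sh2: "(sinh b)\<^sup>2 \<le> H * d"
  proof -
    have "(sinh b)\<^sup>2 \<le> (cosh b + 1) * d" unfolding d_def by (rule sinh_sq_le_gap)
    also have "\<dots> \<le> H * d" using cosh_mono_abs[OF B] d by (intro mult_right_mono) (auto simp: H_def b_def)
    finally show ?thesis .
  qed
  have prod: "\<bar>p * q\<bar> * t \<le> H * r" if "p\<^sup>2 \<le> H * d" "q\<^sup>2 \<le> H * d" for p q
  proof -
    have "\<bar>p * q\<bar> \<le> H * d"
    proof (rule power2_le_imp_le)
      have "\<bar>p * q\<bar>\<^sup>2 = p\<^sup>2 * q\<^sup>2" by (simp add: power_mult_distrib)
      also have "\<dots> \<le> (H * d) * (H * d)" using that by (intro mult_mono) (auto intro: order_trans[OF zero_le_power2])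
      finally show "\<bar>p * q\<bar>\<^sup>2 \<le> (H * d)\<^sup>2" by (simp add: power2_eq_square)
    qed (use H2 d in simp)
    hence "\<bar>p * q\<bar> * t \<le> H * d * t" using t0 by (intro mult_right_mono)
    also have "\<dots> \<le> H * r" using dt H2 by (simp add: mult.assoc)
    finally show ?thesis .
  qed
  have inv: "1 / (d + e) = 1/d - t" by (simp add: t_def)
  have div: "p / (d + e) = p / d - p * t" for p
    using inv by (metis (no_types) mult.commute mult.left_neutral right_diff_distrib times_divide_eq_left)
  have key: "((sin a)\<^sup>2 + (sinh b)\<^sup>2) / d = cosh b + cos a"
  proof -
    have "(sin a)\<^sup>2 + (sinh b)\<^sup>2 = (cosh b + cos a) * d"
      using cosh_square_eq[of b] sin_cos_squared_add[of a]
      by (simp add: d_def gap_def power2_eq_square algebra_simps)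
    thus ?thesis using d by simp
  qed
  define w where "w = dstream e y u - stokeslet y *v perp u"
  have reg: "log_gap e a b = ln (2*d) + l" by (simp add: l_def)
  have w1: "8 * pi * w$1 = (b * sin a * t) * u$1 + (b * sinh b * t - l) * u$2"
    unfolding w_def dstream_def stokeslet_def
    by (simp add: matrix_vector_mult_def sum_2 mat_def reg div
        flip: a_def b_def d_def gap_def) (simp add: algebra_simps add_divide_distrib diff_divide_distrib)
  have w2: "8 * pi * w$2 = (cos a * l - (sin a)\<^sup>2 * t) * u$1 - (sin a * sinh b * t) * u$2"
  proof -
    have R: "rem1 a b = (1 - cos a) * ln (2 * d) - cosh b - cos a - b * sinh b / d + (sinh b)\<^sup>2 / d"
      "rem2 a b = b * sin a / d - sinh b * sin a / d"
      by (simp_all add: rem1_def rem2_def d_def power2_eq_square algebra_simps diff_divide_distrib)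
    have k: "(sin a)\<^sup>2 / d = cosh b + cos a - (sinh b)\<^sup>2 / d" using key by (simp add: add_divide_distrib)
    show ?thesis
    unfolding w_def dstream_def stokeslet_def
    by (simp add: matrix_vector_mult_def sum_2 mat_def reg div R k
        flip: a_def b_def d_def gap_def) (simp add: algebra_simps add_divide_distrib diff_divide_distrib)
  qed
  let ?K = "(H + 4) * r"
  have u: "\<bar>u$1\<bar> \<le> norm u" "\<bar>u$2\<bar> \<le> norm u" by (rule component_le_norm_cart)+
  have K0: "0 \<le> ?K" using H2 r0 by simp
  have split: "?K = H * r + 4 * r" by (simp add: distrib_right)
  have Hr: "0 \<le> H * r" using H2 r0 by simp
  have c1: "\<bar>b * sin a * t\<bar> \<le> ?K" using prod[OF b2 s2] t0 r0 unfolding split by (simp add: abs_mult)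
  have c2: "\<bar>b * sinh b * t - l\<bar> \<le> ?K"
  proof -
    have "\<bar>b * sinh b * t - l\<bar> \<le> \<bar>b * sinh b\<bar> * t + l" using t0 l by (metis abs_mult abs_of_nonneg abs_triangle_ineq4)
    thus ?thesis using prod[OF b2 sh2] l unfolding split by linarith
  qed
  have c3: "\<bar>cos a * l - (sin a)\<^sup>2 * t\<bar> \<le> ?K"
  proof -
    have "\<bar>cos a * l - (sin a)\<^sup>2 * t\<bar> \<le> \<bar>cos a\<bar> * l + \<bar>sin a * sin a\<bar> * t"
      using t0 l abs_triangle_ineq4[of "cos a * l" "(sin a)\<^sup>2 * t"] by (simp add: abs_mult power2_eq_square)
    moreover have "\<bar>cos a\<bar> * l \<le> 1 * l" using l by (intro mult_right_mono) auto
    ultimately show ?thesis using prod[OF s2 s2] l unfolding split by linarith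
  qed
  have c4: "\<bar>sin a * sinh b * t\<bar> \<le> ?K" using prod[OF s2 sh2] t0 r0 unfolding split by (simp add: abs_mult)
  have lin: "\<bar>p * u$1 + q * u$2\<bar> \<le> 2 * ?K * norm u" if "\<bar>p\<bar> \<le> ?K" "\<bar>q\<bar> \<le> ?K" for p q
  proof -
    have "\<bar>p * u$1 + q * u$2\<bar> \<le> \<bar>p\<bar> * \<bar>u$1\<bar> + \<bar>q\<bar> * \<bar>u$2\<bar>" by (metis abs_mult abs_triangle_ineq)
    also have "\<dots> \<le> ?K * norm u + ?K * norm u" using that u K0 by (intro add_mono mult_mono) auto
    also have "\<dots> = 2 * ?K * norm u" by (simp only: mult_2 distrib_right)
    finally show ?thesis .
  qed
  have A1: "8 * pi * \<bar>w$1\<bar> \<le> 2 * ?K * norm u"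
    using lin[OF c1 c2] unfolding w1[symmetric] by (simp add: abs_mult)
  have A2: "8 * pi * \<bar>w$2\<bar> \<le> 2 * ?K * norm u"
  proof -
    have w2': "8 * pi * w$2 = (cos a * l - (sin a)\<^sup>2 * t) * u$1 + (- (sin a * sinh b * t)) * u$2"
      using w2 by simp
    have "\<bar>- (sin a * sinh b * t)\<bar> \<le> ?K" using c4 by simp
    from lin[OF c3 this] show ?thesis unfolding w2'[symmetric] by (simp add: abs_mult)
  qed
  have A3: "\<bar>w$i\<bar> \<le> 8 * pi * \<bar>w$i\<bar>" for i
    using mult_right_mono[of 1 "8 * pi" "\<bar>w$i\<bar>"] pi_gt3 by simp
  have "\<bar>w$1\<bar> + \<bar>w$2\<bar> \<le> 2 * ?K * norm u + 2 * ?K * norm u"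
    by (intro add_mono order_trans[OF A3 A1] order_trans[OF A3 A2])
  also have "\<dots> = 4 * ?K * norm u" by simp
  finally have "\<bar>w$1\<bar> + \<bar>w$2\<bar> \<le> 4 * ?K * norm u" .
  moreover have "norm w \<le> \<bar>w$1\<bar> + \<bar>w$2\<bar>" using norm_le_l1_cart[of w] by (simp add: sum_2)
  ultimately have "norm w \<le> 4 * ?K * norm u" by (rule order_trans[rotated])
  moreover have "H + 4 = cosh B + 5" by (simp add: H_def)
  ultimately show ?thesis unfolding w_def r_def x_def d_def a_def b_def by (simp only: mult.assoc)
qed

section \<open>The velocity is differentiable along the curve\<close>

definition vel_reg :: "real \<Rightarrow> (real \<Rightarrow> real^2) \<Rightarrow> real \<Rightarrow> real^2" where
  "vel_reg e z \<alpha> = (LINT \<beta>:torus|lborel. (z \<beta> $ 2) *\<^sub>R dstream e (z \<alpha> - z \<beta>) (dcurve z \<beta>))"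

definition dvel_reg :: "real \<Rightarrow> (real \<Rightarrow> real^2) \<Rightarrow> real \<Rightarrow> real^2" where
  "dvel_reg e z \<alpha> = (LINT \<beta>:torus|lborel. (dcurve z \<beta> $ 2) *\<^sub>R dstream e (z \<alpha> - z \<beta>) (dcurve z \<alpha>))"

lemma regular_continuous:
  assumes "regular c A z"
  shows "continuous_on S z" "continuous_on S (dcurve z)" "continuous_on S (\<lambda>\<beta>. z \<beta> $ 2)" "continuous_on S (\<lambda>\<beta>. dcurve z \<beta> $ 2)"
proof -
  show 1: "continuous_on S z" "continuous_on S (dcurve z)"
    using C1_onD(2,3)[OF regularD(3)[OF assms]] by (auto intro: continuous_on_subset)
  show "continuous_on S (\<lambda>\<beta>. z \<beta> $ 2)" "continuous_on S (\<lambda>\<beta>. dcurve z \<beta> $ 2)"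
    using 1 by (auto intro!: continuous_on_component)
qed

lemma reg_integrand_continuous:
  assumes "regular c A z" "0 < e"
  shows "continuous_on S (\<lambda>\<beta>. (z \<beta> $ 2) *\<^sub>R dstream e (z \<alpha> - z \<beta>) (dcurve z \<beta>))"
    "continuous_on S (\<lambda>\<beta>. (dcurve z \<beta> $ 2) *\<^sub>R dstream e (z \<alpha> - z \<beta>) (dcurve z \<alpha>))"
  by (intro continuous_on_scaleR continuous_dstream[OF assms(2)] continuous_on_diff continuous_on_const
      regular_continuous[OF assms(1)])+

lemma dstream_curve_diff:
  assumes z: "regular c A z" and e: "0 < e" and t: "0 < circle_chord (\<alpha> - \<beta>)"
  shows "norm (dstream e (z \<alpha> - z \<beta>) u - stokeslet (z \<alpha> - z \<beta>) *v perp u)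
     \<le> 4 * (cosh (2*A) + 5) * (2 / c\<^sup>2) powr (1/4) * e powr (1/4) * circle_chord (\<alpha> - \<beta>) powr (-(1/2)) * norm u"
proof -
  let ?y = "z \<alpha> - z \<beta>" and ?t = "circle_chord (\<alpha> - \<beta>)"
  let ?g = "gap (?y$1) (?y$2)"
  note zD = regularD[OF z]
  have ct: "0 < c * ?t" using zD(1) t by simp
  have "(c * ?t)\<^sup>2 \<le> (chord ?y)\<^sup>2" using ct zD(6) by (intro power_mono) auto
  hence g: "(c * ?t)\<^sup>2 / 2 \<le> ?g" unfolding chord_sq gap_def by simp
  moreover have "0 < (c * ?t)\<^sup>2 / 2" using zD(1) t by simp
  ultimately have g0: "0 < ?g" by (rule less_le_trans[rotated])
  have "norm (dstream e ?y u - stokeslet ?y *v perp u) \<le> 4 * (cosh (2*A) + 5) * (e / ?g) powr (1/4) * norm u"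
    by (rule dstream_stokeslet_diff[OF e g0 zD(8)])
  also have "\<dots> \<le> 4 * (cosh (2*A) + 5) * (e / ((c * ?t)\<^sup>2 / 2)) powr (1/4) * norm u"
    using g ct e g0 zD(1) t by (intro mult_right_mono mult_left_mono powr_mono2 divide_left_mono) auto
  also have "(e / ((c * ?t)\<^sup>2 / 2)) powr (1/4) = (2 / c\<^sup>2) powr (1/4) * e powr (1/4) * ?t powr (-(1/2))"
  proof -
    have "e / ((c * ?t)\<^sup>2 / 2) = (2 / c\<^sup>2) * e * (1 / ?t\<^sup>2)" by (simp add: power_mult_distrib)
    moreover have "(1 / ?t\<^sup>2) powr (1/4) = ?t powr (-(1/2))"
    proof -
      have "1 / ?t\<^sup>2 = ?t powr (-2)" using t by (simp add: powr_minus_divide)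
      thus ?thesis by (simp add: powr_powr)
    qed
    moreover have "(p * e * q) powr (1/4) = p powr (1/4) * e powr (1/4) * q powr (1/4)" if "0 \<le> p" "0 \<le> q" for p q
      using that e by (simp add: powr_mult)
    ultimately show ?thesis by (metis zero_le_divide_1_iff zero_le_power2 divide_nonneg_nonneg zero_le_numeral)
  qed
  finally show ?thesis by (simp add: mult_ac)
qed

lemma tangent_op_apply:
  assumes "regular c A z"
  shows "tangent_op z \<alpha> *v p = (LINT \<beta>:torus|lborel. (dcurve z \<beta> $ 2) *\<^sub>R (stokeslet (z \<alpha> - z \<beta>) *v p))"
    "set_integrable lborel torus (\<lambda>\<beta>. (dcurve z \<beta> $ 2) *\<^sub>R (stokeslet (z \<alpha> - z \<beta>) *v p))"
proof -
  have bl: "bounded_linear (\<lambda>M::real^2^2. M *v p)"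
    by (rule bounded_bilinear.bounded_linear_left[OF bounded_bilinear_matrix_vector])
  have e: "(indicat_real torus \<beta> *\<^sub>R (dcurve z \<beta> $ 2) *\<^sub>R stokeslet (z \<alpha> - z \<beta>)) *v p
     = indicat_real torus \<beta> *\<^sub>R (dcurve z \<beta> $ 2) *\<^sub>R (stokeslet (z \<alpha> - z \<beta>) *v p)" for \<beta>
    by (simp add: bounded_bilinear.scaleR_left[OF bounded_bilinear_matrix_vector])
  note i = vel_integrable(2)[OF assms, of \<alpha>, unfolded set_integrable_def]
  show "tangent_op z \<alpha> *v p = (LINT \<beta>:torus|lborel. (dcurve z \<beta> $ 2) *\<^sub>R (stokeslet (z \<alpha> - z \<beta>) *v p))"
    using integral_bounded_linear[OF bl i] unfolding tangent_op_def set_lebesgue_integral_def e by simp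
  show "set_integrable lborel torus (\<lambda>\<beta>. (dcurve z \<beta> $ 2) *\<^sub>R (stokeslet (z \<alpha> - z \<beta>) *v p))"
    using integrable_bounded_linear[OF bl i] unfolding set_integrable_def e .
qed

lemma continuous_set_integrable:
  fixes f :: "real \<Rightarrow> 'a::{banach, second_countable_topology}"
  shows "continuous_on UNIV f \<Longrightarrow> set_integrable lborel torus f"
  by (intro borel_integrable_atLeastAtMost') (auto intro: continuous_on_subset)

text \<open>
  The errors are uniform in \<open>\<alpha>\<close>, for the regularised velocity and for its derivative.
\<close>

lemma vel_reg_limit:
  assumes z: "regular c A z"
  obtains K where "0 \<le> K"
    "\<And>e \<alpha>. 0 < e \<Longrightarrow> norm (vel_reg e z \<alpha> - vel z \<alpha>) \<le> K * e powr (1/4)"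
    "\<And>e \<alpha>. 0 < e \<Longrightarrow> norm (dvel_reg e z \<alpha> - tangent_op z \<alpha> *v perp (dcurve z \<alpha>)) \<le> K * e powr (1/4)"
proof -
  note zD = regularD[OF z]
  obtain I where I: "0 \<le> I" "\<And>\<alpha>. set_integrable lborel torus (\<lambda>\<beta>. circle_chord (\<alpha> - \<beta>) powr (-(1/2)))"
     "\<And>\<alpha>. (LINT \<beta>:torus|lborel. circle_chord (\<alpha> - \<beta>) powr (-(1/2))) \<le> I"
    using circle_chord_half_integral by blast
  define C where "C = 4 * (cosh (2*A) + 5) * (2 / c\<^sup>2) powr (1/4)"
  have C0: "0 \<le> C" using cosh_real_ge_1[of "2*A"] by (simp add: C_def)
  have A0: "0 \<le> A" by (rule zD)
  have ee: "norm ((LINT \<beta>:torus|lborel. s \<beta> *\<^sub>R dstream e (z \<alpha> - z \<beta>) (q \<beta>)) - (LINT \<beta>:torus|lborel. s \<beta> *\<^sub>R (stokeslet (z \<alpha> - z \<beta>) *v perp (q \<beta>))))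
      \<le> A * (C * A) * I * e powr (1/4)"
    if e: "0 < e" and s: "\<And>\<beta>. \<bar>s \<beta>\<bar> \<le> A" and q: "\<And>\<beta>. norm (q \<beta>) \<le> A"
      and m1: "continuous_on UNIV (\<lambda>\<beta>. s \<beta> *\<^sub>R dstream e (z \<alpha> - z \<beta>) (q \<beta>))"
      and m2: "(\<lambda>\<beta>. s \<beta> *\<^sub>R (stokeslet (z \<alpha> - z \<beta>) *v perp (q \<beta>))) \<in> borel_measurable borel"
      and i2: "set_integrable lborel torus (\<lambda>\<beta>. s \<beta> *\<^sub>R (stokeslet (z \<alpha> - z \<beta>) *v perp (q \<beta>)))"
    for e \<alpha> and s :: "real \<Rightarrow> real" and q
  proof -
    let ?t = "\<lambda>\<beta>. circle_chord (\<alpha> - \<beta>) powr (-(1/2))"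
    let ?g = "\<lambda>\<beta>. A * (C * A) * e powr (1/4) * ?t \<beta>"
    have pw: "norm (s \<beta> *\<^sub>R dstream e (z \<alpha> - z \<beta>) (q \<beta>) - s \<beta> *\<^sub>R (stokeslet (z \<alpha> - z \<beta>) *v perp (q \<beta>))) \<le> ?g \<beta>"
      if t: "0 < circle_chord (\<alpha> - \<beta>)" for \<beta>
    proof -
      have "norm (dstream e (z \<alpha> - z \<beta>) (q \<beta>) - stokeslet (z \<alpha> - z \<beta>) *v perp (q \<beta>)) \<le> C * e powr (1/4) * ?t \<beta> * norm (q \<beta>)"
        unfolding C_def by (rule dstream_curve_diff[OF z e t])
      also have "\<dots> \<le> C * e powr (1/4) * ?t \<beta> * A" using C0 by (intro mult_left_mono q) auto
      finally have "\<bar>s \<beta>\<bar> * norm (dstream e (z \<alpha> - z \<beta>) (q \<beta>) - stokeslet (z \<alpha> - z \<beta>) *v perp (q \<beta>)) \<le> A * (C * e powr (1/4) * ?t \<beta> * A)"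
        by (intro mult_mono s) (auto simp: A0)
      thus ?thesis unfolding scaleR_diff_right[symmetric] norm_scaleR by (simp only: mult_ac)
    qed
    have ae: "AE \<beta> in lborel. \<beta> \<in> torus \<longrightarrow> norm (s \<beta> *\<^sub>R dstream e (z \<alpha> - z \<beta>) (q \<beta>) - s \<beta> *\<^sub>R (stokeslet (z \<alpha> - z \<beta>) *v perp (q \<beta>))) \<le> ?g \<beta>"
      using AE_circle_chord_pos[of \<alpha>] by eventually_elim (use pw in auto)
    have d: "(LINT \<beta>:torus|lborel. s \<beta> *\<^sub>R dstream e (z \<alpha> - z \<beta>) (q \<beta>)) - (LINT \<beta>:torus|lborel. s \<beta> *\<^sub>R (stokeslet (z \<alpha> - z \<beta>) *v perp (q \<beta>)))
       = (LINT \<beta>:torus|lborel. s \<beta> *\<^sub>R dstream e (z \<alpha> - z \<beta>) (q \<beta>) - s \<beta> *\<^sub>R (stokeslet (z \<alpha> - z \<beta>) *v perp (q \<beta>)))"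
      by (rule set_integral_diff(2)[symmetric, OF continuous_set_integrable[OF m1] i2])
    have gi: "set_integrable lborel torus ?g" by (intro set_integrable_mult_right I(2))
    have "norm ((LINT \<beta>:torus|lborel. s \<beta> *\<^sub>R dstream e (z \<alpha> - z \<beta>) (q \<beta>)) - (LINT \<beta>:torus|lborel. s \<beta> *\<^sub>R (stokeslet (z \<alpha> - z \<beta>) *v perp (q \<beta>))))
      \<le> (LINT \<beta>:torus|lborel. ?g \<beta>)"
      unfolding d
      by (rule set_integral_dominated(2)[OF borel_measurable_diff[OF borel_measurable_continuous_onI[OF m1] m2] gi _ ae]) simp
    also have "\<dots> = A * (C * A) * e powr (1/4) * (LINT \<beta>:torus|lborel. ?t \<beta>)" by simp
    also have "\<dots> \<le> A * (C * A) * e powr (1/4) * I" using A0 C0 by (intro mult_left_mono I(3)) auto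
    finally show ?thesis by (simp only: mult_ac)
  qed
  show thesis
  proof
    show "0 \<le> A * (C * A) * I" using A0 C0 I(1) by simp
    fix e :: real and \<alpha> assume e: "0 < e"
    show "norm (vel_reg e z \<alpha> - vel z \<alpha>) \<le> A * (C * A) * I * e powr (1/4)"
      unfolding vel_reg_def vel_def
      by (rule ee[OF e zD(4) zD(5) reg_integrand_continuous(1)[OF z e] vel_integrand_measurable(1)[OF zD(3)] vel_integrable(1)[OF z]])
    have "set_integrable lborel torus (\<lambda>\<beta>. (dcurve z \<beta> $ 2) *\<^sub>R (stokeslet (z \<alpha> - z \<beta>) *v perp (dcurve z \<alpha>)))"
      by (rule tangent_op_apply(2)[OF z])
    have m: "(\<lambda>\<beta>. (dcurve z \<beta> $ 2) *\<^sub>R (stokeslet (z \<alpha> - z \<beta>) *v perp (dcurve z \<alpha>))) \<in> borel_measurable borel"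
    proof -
      have "(\<lambda>\<beta>. ((dcurve z \<beta> $ 2) *\<^sub>R stokeslet (z \<alpha> - z \<beta>)) *v perp (dcurve z \<alpha>)) \<in> borel_measurable borel"
        by (rule measurable_compose[OF vel_integrand_measurable(2)[OF zD(3)] borel_measurable_continuous_onI])
          (intro bounded_linear.continuous_on[OF bounded_bilinear.bounded_linear_left[OF bounded_bilinear_matrix_vector]] continuous_on_id)
      thus ?thesis by (simp only: bounded_bilinear.scaleR_left[OF bounded_bilinear_matrix_vector])
    qed
    show "norm (dvel_reg e z \<alpha> - tangent_op z \<alpha> *v perp (dcurve z \<alpha>)) \<le> A * (C * A) * I * e powr (1/4)"
      unfolding dvel_reg_def tangent_op_apply(1)[OF z]
      by (rule ee[OF e zD(9) zD(5) reg_integrand_continuous(2)[OF z e] m tangent_op_apply(2)[OF z]])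
  qed
qed

lemma stream_curve_derivative:
  assumes z: "regular c A z" and e: "0 < e"
  shows "((\<lambda>\<alpha>. stream e (z \<alpha> - w)) has_vector_derivative dstream e (z \<alpha> - w) (dcurve z \<alpha>)) (at \<alpha> within S)"
    "((\<lambda>\<beta>. stream e (w - z \<beta>)) has_vector_derivative - dstream e (w - z \<beta>) (dcurve z \<beta>)) (at \<beta> within S)"
proof -
  have l: "linear (dstream e y)" for y
    using stream_has_derivative[OF e, of y] has_derivative_bounded_linear bounded_linear.linear by blast
  have d: "(z has_derivative (\<lambda>h. h *\<^sub>R dcurve z \<alpha>)) (at \<alpha> within S)" for \<alpha> S
    using C1_onD(1)[OF regularD(3)[OF z], of \<alpha>] has_derivative_at_withinI by (simp add: has_vector_derivative_def)
  have P: "(stream e has_derivative dstream e y) (at y within T)" for y T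
    by (rule has_derivative_at_withinI[OF stream_has_derivative[OF e]])
  have "((\<lambda>\<alpha>. z \<alpha> - w) has_derivative (\<lambda>h. h *\<^sub>R dcurve z \<alpha>)) (at \<alpha> within S)"
    using has_derivative_diff[OF d has_derivative_const] by simp
  from diff_chain_within[OF this P]
  show "((\<lambda>\<alpha>. stream e (z \<alpha> - w)) has_vector_derivative dstream e (z \<alpha> - w) (dcurve z \<alpha>)) (at \<alpha> within S)"
    by (simp add: has_vector_derivative_def o_def linear_cmul[OF l])
  have "((\<lambda>\<beta>. w - z \<beta>) has_derivative (\<lambda>h. h *\<^sub>R (- dcurve z \<beta>))) (at \<beta> within S)"
    using has_derivative_diff[OF has_derivative_const d] by simp
  from diff_chain_within[OF this P]
  show "((\<lambda>\<beta>. stream e (w - z \<beta>)) has_vector_derivative - dstream e (w - z \<beta>) (dcurve z \<beta>)) (at \<beta> within S)"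
    by (simp add: has_vector_derivative_def o_def linear_cmul[OF l] linear_neg[OF l])
qed

text \<open>
  The boundary terms combine to the increment of the potential over one period, which does not
  depend on \<open>\<alpha>\<close>.
\<close>

lemma vel_reg_by_parts:
  assumes z: "regular c A z" and e: "0 < e"
  shows "vel_reg e z \<alpha> = integral torus (\<lambda>\<beta>. (dcurve z \<beta> $ 2) *\<^sub>R stream e (z \<alpha> - z \<beta>))
     + (z pi $ 2) *\<^sub>R (stream e (vector [2*pi, 0]) - stream e 0)"
proof -
  note zD = regularD[OF z]
  let ?f = "\<lambda>\<beta>. (z \<beta> $ 2) *\<^sub>R dstream e (z \<alpha> - z \<beta>) (dcurve z \<beta>)"
  let ?g = "\<lambda>\<beta>. (dcurve z \<beta> $ 2) *\<^sub>R stream e (z \<alpha> - z \<beta>)"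
  have fi: "?f integrable_on torus" by (intro integrable_continuous_real reg_integrand_continuous(1)[OF z e])
  have gc: "continuous_on torus ?g"
    by (intro continuous_on_scaleR continuous_stream[OF e] continuous_on_diff continuous_on_const regular_continuous[OF z])
  have gi: "?g integrable_on torus" by (rule integrable_continuous_real[OF gc])
  have eq: "vel_reg e z \<alpha> = integral torus ?f"
    unfolding vel_reg_def
    by (rule set_borel_integral_eq_integral(2)[OF continuous_set_integrable[OF reg_integrand_continuous(1)[OF z e]]])
  have "((\<lambda>\<beta>. (z \<beta> $ 2) *\<^sub>R stream e (z \<alpha> - z \<beta>)) has_vector_derivative ?g \<beta> - ?f \<beta>) (at \<beta> within torus)" for \<beta>
  proof -
    have "((\<lambda>\<beta>. z \<beta> $ 2) has_vector_derivative dcurve z \<beta> $ 2) (at \<beta> within torus)"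
      by (rule bounded_linear.has_vector_derivative[OF bounded_linear_vec_nth])
        (rule has_vector_derivative_at_within[OF C1_onD(1)[OF zD(3)]])
    hence "((\<lambda>\<beta>. z \<beta> $ 2) has_real_derivative dcurve z \<beta> $ 2) (at \<beta> within torus)"
      by (simp add: has_real_derivative_iff_has_vector_derivative)
    from has_vector_derivative_scaleR[OF this stream_curve_derivative(2)[OF z e]]
    show ?thesis by (simp add: add.commute)
  qed
  hence "((\<lambda>\<beta>. ?g \<beta> - ?f \<beta>) has_integral ((z pi $ 2) *\<^sub>R stream e (z \<alpha> - z pi) - (z (-pi) $ 2) *\<^sub>R stream e (z \<alpha> - z (-pi)))) torus"
    by (intro fundamental_theorem_of_calculus) auto
  moreover have "((\<lambda>\<beta>. ?g \<beta> - ?f \<beta>) has_integral (integral torus ?g - integral torus ?f)) torus"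
    using fi gi by (intro has_integral_diff integrable_integral)
  ultimately have k: "integral torus ?g - integral torus ?f = (z pi $ 2) *\<^sub>R stream e (z \<alpha> - z pi) - (z (-pi) $ 2) *\<^sub>R stream e (z \<alpha> - z (-pi))"
    using has_integral_unique by blast
  have zp: "z pi = vector [2*pi, 0] + z (-pi)"
    using zD(2) unfolding horizontally_periodic_def by (metis (no_types) add.inverse_inverse add_diff_cancel_left' diff_add_cancel minus_add_cancel mult_2 of_int_1 mult.right_neutral)
  have "z \<alpha> - z (-pi) = (z \<alpha> - z pi) + vector [2*pi, 0]" using zp by simp
  hence P: "stream e (z \<alpha> - z (-pi)) = stream e (z \<alpha> - z pi) + (stream e (vector [2*pi, 0]) - stream e 0)"
    using stream_periodic[of e "z \<alpha> - z pi"] by (simp add: algebra_simps)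
  have q: "z (-pi) $ 2 = z pi $ 2" unfolding zp by simp
  have "integral torus ?g - integral torus ?f = - ((z pi $ 2) *\<^sub>R (stream e (vector [2*pi, 0]) - stream e 0))"
    unfolding k q P scaleR_add_right by simp
  thus ?thesis unfolding eq by (simp add: algebra_simps)
qed

lemma vel_reg_deriv:
  assumes z: "regular c A z" and e: "0 < e"
  shows "(vel_reg e z has_vector_derivative dvel_reg e z \<alpha>) (at \<alpha>)"
proof -
  let ?h = "\<lambda>\<alpha> \<beta>. (dcurve z \<beta> $ 2) *\<^sub>R dstream e (z \<alpha> - z \<beta>) (dcurve z \<alpha>)"
  have c: "continuous_on (UNIV \<times> cbox (-pi) pi) (\<lambda>(\<alpha>, \<beta>). ?h \<alpha> \<beta>)"
  proof -
    have s: "continuous_on T (\<lambda>p. z (fst p))" "continuous_on T (\<lambda>p. z (snd p))" "continuous_on T (\<lambda>p. dcurve z (fst p))"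
      "continuous_on T (\<lambda>p. dcurve z (snd p) $ 2)" for T :: "(real \<times> real) set"
      by (rule continuous_on_compose2[OF regular_continuous(1)[OF z, of UNIV]] continuous_on_compose2[OF regular_continuous(2)[OF z, of UNIV]]
          continuous_on_compose2[OF regular_continuous(4)[OF z, of UNIV]]; auto intro: continuous_intros)+
    show ?thesis unfolding case_prod_unfold
      by (intro continuous_on_scaleR continuous_dstream[OF e] continuous_on_diff s)
  qed
  have "((\<lambda>\<alpha>. integral (cbox (-pi) pi) (\<lambda>\<beta>. (dcurve z \<beta> $ 2) *\<^sub>R stream e (z \<alpha> - z \<beta>))) has_vector_derivative
     integral (cbox (-pi) pi) (?h \<alpha>)) (at \<alpha> within UNIV)"
  proof (rule leibniz_rule_vector_derivative[OF _ _ c])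
    show "((\<lambda>\<alpha>. (dcurve z \<beta> $ 2) *\<^sub>R stream e (z \<alpha> - z \<beta>)) has_vector_derivative ?h \<alpha> \<beta>) (at \<alpha> within UNIV)" for \<alpha> \<beta>
      by (intro bounded_linear.has_vector_derivative[OF bounded_linear_scaleR_right] stream_curve_derivative(1)[OF z e])
    show "(\<lambda>\<beta>. (dcurve z \<beta> $ 2) *\<^sub>R stream e (z \<alpha> - z \<beta>)) integrable_on cbox (-pi) pi" for \<alpha>
      by (intro integrable_continuous continuous_on_scaleR continuous_stream[OF e] continuous_on_diff continuous_on_const regular_continuous[OF z])
  qed auto
  moreover have "integral (cbox (-pi) pi) (?h \<alpha>) = dvel_reg e z \<alpha>"
    unfolding dvel_reg_def
    by (simp add: set_borel_integral_eq_integral(2)[OF continuous_set_integrable[OF reg_integrand_continuous(2)[OF z e]]])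
  ultimately have "((\<lambda>\<alpha>. integral torus (\<lambda>\<beta>. (dcurve z \<beta> $ 2) *\<^sub>R stream e (z \<alpha> - z \<beta>))
      + (z pi $ 2) *\<^sub>R (stream e (vector [2*pi, 0]) - stream e 0)) has_vector_derivative dvel_reg e z \<alpha>) (at \<alpha>)"
    using has_vector_derivative_add_const by (simp add: has_vector_derivative_add_const)
  moreover have "vel_reg e z = (\<lambda>\<alpha>. integral torus (\<lambda>\<beta>. (dcurve z \<beta> $ 2) *\<^sub>R stream e (z \<alpha> - z \<beta>))
      + (z pi $ 2) *\<^sub>R (stream e (vector [2*pi, 0]) - stream e 0))"
    by (rule ext) (rule vel_reg_by_parts[OF z e])
  ultimately show ?thesis by (simp only:)
qed

text \<open>
  The regularised velocities and their derivatives converge uniformly, so the limits are related by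
  differentiation.
\<close>

theorem vel_has_derivative:
  assumes z: "regular c A z"
  shows "(vel z has_vector_derivative tangent_op z \<alpha> *v perp (dcurve z \<alpha>)) (at \<alpha>)"
proof -
  let ?G = "\<lambda>\<alpha>. tangent_op z \<alpha> *v perp (dcurve z \<alpha>)"
  let ?e = "\<lambda>n. 1 / real (Suc n)"
  obtain K where K: "0 \<le> K"
    "\<And>e \<alpha>. 0 < e \<Longrightarrow> norm (vel_reg e z \<alpha> - vel z \<alpha>) \<le> K * e powr (1/4)"
    "\<And>e \<alpha>. 0 < e \<Longrightarrow> norm (dvel_reg e z \<alpha> - ?G \<alpha>) \<le> K * e powr (1/4)"
    using vel_reg_limit[OF z] by blast
  have e0: "0 < ?e n" for n by simp
  have lim: "(\<lambda>n. K * ?e n powr (1/4)) \<longlonglongrightarrow> 0"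
  proof -
    have "(\<lambda>n. ?e n powr (1/4)) \<longlonglongrightarrow> 0 powr (1/4)"
      by (intro tendsto_powr2 tendsto_const) (use LIMSEQ_Suc[OF lim_inverse_n'] in \<open>auto intro!: always_eventually simp: field_simps\<close>)
    from tendsto_mult_left[OF this, of K] show ?thesis by simp
  qed
  have pw: "(\<lambda>n. vel_reg (?e n) z a) \<longlonglongrightarrow> vel z a" for a
    by (rule LIM_zero_cancel, rule Lim_null_comparison[OF _ lim]) (use K(2)[OF e0] in \<open>auto intro!: always_eventually\<close>)
  have "\<exists>g. \<forall>a\<in>UNIV. (\<lambda>n. vel_reg (?e n) z a) \<longlonglongrightarrow> g a \<and> (g has_derivative (\<lambda>h. h *\<^sub>R ?G a)) (at a within UNIV)"
  proof (rule has_derivative_sequence)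
    show "convex (UNIV::real set)" "0 \<in> (UNIV::real set)" by auto
    show "(\<lambda>n. vel_reg (?e n) z 0) \<longlonglongrightarrow> vel z 0" by (rule pw)
    show "(vel_reg (?e n) z has_derivative (\<lambda>h. h *\<^sub>R dvel_reg (?e n) z a)) (at a within UNIV)" for n a
      using vel_reg_deriv[OF z e0, of n a] by (simp add: has_vector_derivative_def)
    fix \<epsilon> :: real assume "0 < \<epsilon>"
    hence "\<forall>\<^sub>F n in sequentially. K * ?e n powr (1/4) < \<epsilon>" using lim by (rule order_tendstoD(2)[rotated])
    thus "\<forall>\<^sub>F n in sequentially. \<forall>a\<in>UNIV. \<forall>h. norm (h *\<^sub>R dvel_reg (?e n) z a - h *\<^sub>R ?G a) \<le> \<epsilon> * norm h"
    proof eventually_elim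
      case (elim n)
      have "norm (h *\<^sub>R dvel_reg (?e n) z a - h *\<^sub>R ?G a) \<le> \<epsilon> * norm h" for a h
      proof -
        have "norm (dvel_reg (?e n) z a - ?G a) \<le> \<epsilon>" using K(3)[OF e0[of n], of a] elim by linarith
        hence "\<bar>h\<bar> * norm (dvel_reg (?e n) z a - ?G a) \<le> \<bar>h\<bar> * \<epsilon>" by (intro mult_left_mono) auto
        thus ?thesis unfolding scaleR_diff_right[symmetric] norm_scaleR by (simp add: mult.commute)
      qed
      thus ?case by blast
    qed
  qed
  then obtain g where g: "\<And>a. (\<lambda>n. vel_reg (?e n) z a) \<longlonglongrightarrow> g a" "\<And>a. (g has_derivative (\<lambda>h. h *\<^sub>R ?G a)) (at a)" by auto
  have "g = vel z" using LIMSEQ_unique[OF g(1) pw] by auto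
  thus ?thesis using g(2) by (simp add: has_vector_derivative_def)
qed

section \<open>Picard iteration in a closed subspace\<close>

lemma norm_primitive_le:
  assumes c: "continuous_on UNIV f" and b: "\<And>s. norm (f s) \<le> B"
  shows "norm (primitive f t) \<le> B * \<bar>t\<bar>"
proof -
  have c': "continuous_on S f" for S using c by (rule continuous_on_subset) auto
  show ?thesis
    using integral_bound[of 0 t f B] integral_bound[of t 0 f B] c' b by (auto simp: primitive_def)
qed

lemma primitive_diff:
  assumes "continuous_on UNIV f" "continuous_on UNIV g"
  shows "primitive f t - primitive g t = primitive (\<lambda>s. f s - g s) t"
proof -
  have "f integrable_on {u..v}" "g integrable_on {u..v}" for u v
    using assms by (auto intro!: integrable_continuous_real intro: continuous_on_subset)
  thus ?thesis by (simp add: primitive_def Henstock_Kurzweil_Integration.integral_diff)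
qed

text \<open>
  Riemann sums stay in the subspace.
\<close>

lemma integral_in_closed_subspace:
  fixes f :: "real \<Rightarrow> 'a::banach"
  assumes E: "subspace E" "closed E" and f: "f integrable_on {a..b}" "\<And>s. f s \<in> E"
  shows "integral {a..b} f \<in> E"
proof -
  have "(f has_integral integral {a..b} f) (cbox a b)" using f(1) by (simp add: has_integral_integral)
  hence lim: "((\<lambda>p. \<Sum>(x,k)\<in>p. measure lborel k *\<^sub>R f x) \<longlongrightarrow> integral {a..b} f) (division_filter (cbox a b))"
    by (simp only: has_integral_cbox)
  show ?thesis
  proof (rule Lim_in_closed_set[OF E(2) _ division_filter_not_empty lim])
    show "\<forall>\<^sub>F p in division_filter (cbox a b). (\<Sum>(x,k)\<in>p. measure lborel k *\<^sub>R f x) \<in> E"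
      by (intro always_eventually allI subspace_sum[OF E(1)]) (auto intro: subspace_scale[OF E(1)] f(2))
  qed
qed

lemma primitive_in_closed_subspace:
  assumes "subspace E" "closed E" "continuous_on UNIV f" "\<And>s. f s \<in> E"
  shows "primitive f t \<in> E"
proof -
  have "f integrable_on {u..v}" for u v
    using assms(3) by (auto intro!: integrable_continuous_real intro: continuous_on_subset)
  thus ?thesis using assms unfolding primitive_def
    by (auto intro!: integral_in_closed_subspace subspace_neg)
qed

text \<open>
  The field need only be defined and Lipschitz on the part of a ball that lies in a closed subspace,
  provided that it takes values in this subspace. Trajectories are bounded continuous functions on
  the whole line, frozen outside \<open>[-T, T]\<close>, so that they form a complete space to which the
  contraction principle applies.
\<close>

theorem picard_lindelof_subspace:
  fixes F :: "'a::banach \<Rightarrow> 'a"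
  assumes E: "subspace E" "closed E"
    and FE: "\<And>u. u \<in> E \<Longrightarrow> norm u \<le> r \<Longrightarrow> F u \<in> E"
    and FM: "\<And>u. u \<in> E \<Longrightarrow> norm u \<le> r \<Longrightarrow> norm (F u) \<le> M"
    and FL: "\<And>u v. u \<in> E \<Longrightarrow> norm u \<le> r \<Longrightarrow> v \<in> E \<Longrightarrow> norm v \<le> r \<Longrightarrow> norm (F u - F v) \<le> L * norm (u - v)"
    and T: "0 < T" "T * M \<le> r" "T * L \<le> 1/2" and L: "0 \<le> L" and r: "0 \<le> r"
  obtains u where "u 0 = 0" "\<And>t. u t \<in> E" "\<And>t. norm (u t) \<le> r"
    "\<And>t. t \<in> {-T..T} \<Longrightarrow> (u has_vector_derivative F (u t)) (at t within {-T..T})"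
proof -
  define K where "K = E \<inter> cball 0 r"
  define s where "s = PiC (UNIV::real set) (\<lambda>_. K)"
  have K: "x \<in> K \<longleftrightarrow> x \<in> E \<and> norm x \<le> r" for x by (simp add: K_def)
  have sK: "u \<in> s \<longleftrightarrow> (\<forall>t. apply_bcontfun u t \<in> K)" for u by (auto simp: s_def mem_PiC_iff)
  have "closed s" unfolding s_def by (intro closed_PiC) (auto simp: K_def E(2) closed_Int)
  hence cs: "complete s" by (simp add: complete_eq_closed)
  have "0 \<in> s" by (simp add: sK K subspace_0[OF E(1)] r)
  hence ne: "s \<noteq> {}" by blast
  define cl where "cl t = max (-T) (min t T)" for t
  have cl: "\<bar>cl t\<bar> \<le> T" for t using T(1) by (auto simp: cl_def)
  have clc: "continuous_on UNIV cl" unfolding cl_def by (intro continuous_intros)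
  have Fc: "continuous_on UNIV (\<lambda>t. F (apply_bcontfun u t))" if u: "u \<in> s" for u
  proof -
    have "L-lipschitz_on K F" using FL L by (intro lipschitz_onI) (auto simp: K dist_norm)
    hence "continuous_on K F" by (rule lipschitz_on_continuous_on)
    thus ?thesis by (rule continuous_on_compose2) (use u sK in auto)
  qed
  define G where "G u t = primitive (\<lambda>t. F (apply_bcontfun u t)) (cl t)" for u t
  have Gn: "norm (G u t) \<le> r" if u: "u \<in> s" for u t
  proof -
    have "norm (G u t) \<le> M * \<bar>cl t\<bar>" unfolding G_def
      using u sK K FM by (intro norm_primitive_le Fc) auto
    also have "\<dots> \<le> M * T"
    proof (rule mult_left_mono[OF cl])
      show "0 \<le> M" using FM[of 0] subspace_0[OF E(1)] r order_trans[OF norm_ge_zero[of "F 0"]] by simp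
    qed
    finally show ?thesis using T(2) by (simp add: mult.commute)
  qed
  have Gc: "continuous_on UNIV (G u)" if u: "u \<in> s" for u
  proof -
    have "continuous_on UNIV (primitive (\<lambda>t. F (apply_bcontfun u t)))"
      using primitive_has_vector_derivative[OF Fc[OF u]] has_vector_derivative_continuous
      by (intro continuous_at_imp_continuous_on) blast
    thus ?thesis unfolding G_def by (rule continuous_on_compose2[OF _ clc]) auto
  qed
  have Gb: "apply_bcontfun (Bcontfun (G u)) = G u" if "u \<in> s" for u
    using Gc[OF that] Gn[OF that] by (intro Bcontfun_inverse bcontfun_normI) auto
  have GE: "G u t \<in> E" if u: "u \<in> s" for u t
    unfolding G_def using u sK K FE by (intro primitive_in_closed_subspace E Fc) auto
  have "\<exists>!u\<in>s. Bcontfun (G u) = u"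
  proof (rule Banach_fix[OF cs ne, where c = "1/2"])
    show "(\<lambda>u. Bcontfun (G u)) ` s \<subseteq> s" using Gn GE Gb by (auto simp: sK K)
    fix u v assume uv: "u \<in> s" "v \<in> s"
    show "dist (Bcontfun (G u)) (Bcontfun (G v)) \<le> 1/2 * dist u v"
    proof (rule dist_bound)
      fix t
      let ?f = "\<lambda>u t. F (apply_bcontfun u t)"
      have d: "norm (apply_bcontfun u s - apply_bcontfun v s) \<le> dist u v" for s
        using dist_bounded[of u s v] by (simp add: dist_norm)
      have "dist (G u t) (G v t) = norm (primitive (\<lambda>t. ?f u t - ?f v t) (cl t))"
        unfolding dist_norm G_def by (subst primitive_diff) (auto intro: Fc uv)
      also have "\<dots> \<le> (L * dist u v) * \<bar>cl t\<bar>"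
      proof (rule norm_primitive_le)
        show "continuous_on UNIV (\<lambda>t. ?f u t - ?f v t)" by (intro continuous_intros Fc uv)
        fix s
        have "norm (?f u s - ?f v s) \<le> L * norm (apply_bcontfun u s - apply_bcontfun v s)"
          using uv sK K by (intro FL) auto
        also have "\<dots> \<le> L * dist u v" using d L by (intro mult_left_mono)
        finally show "norm (?f u s - ?f v s) \<le> L * dist u v" .
      qed
      also have "\<dots> \<le> (L * dist u v) * T" using L by (intro mult_left_mono cl) auto
      also have "\<dots> = (T * L) * dist u v" by simp
      also have "\<dots> \<le> 1/2 * dist u v" by (intro mult_right_mono T(3)) auto
      finally show "dist (apply_bcontfun (Bcontfun (G u)) t) (apply_bcontfun (Bcontfun (G v)) t) \<le> 1/2 * dist u v"
        by (simp only: Gb[OF uv(1)] Gb[OF uv(2)])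
    qed
  qed auto
  then obtain u where u: "u \<in> s" "Bcontfun (G u) = u" by blast
  have uG: "apply_bcontfun u = G u" using Gb[OF u(1)] u(2) by simp
  show thesis
  proof
    have "cl 0 = 0" using T(1) by (simp add: cl_def)
    thus "apply_bcontfun u 0 = 0" by (metis uG G_def primitive_0)
    show "apply_bcontfun u t \<in> E" "norm (apply_bcontfun u t) \<le> r" for t
      using u(1) sK K by auto
    fix t assume t: "t \<in> {-T..T}"
    have "(primitive (\<lambda>t. F (apply_bcontfun u t)) has_vector_derivative F (apply_bcontfun u t)) (at t within {-T..T})"
      by (rule has_vector_derivative_at_within[OF primitive_has_vector_derivative[OF Fc[OF u(1)]]])
    thus "(apply_bcontfun u has_vector_derivative F (apply_bcontfun u t)) (at t within {-T..T})"
    proof (rule has_vector_derivative_transform[OF t, rotated])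
      fix x assume "x \<in> {-T..T}"
      hence "cl x = x" by (simp add: cl_def)
      thus "apply_bcontfun u x = primitive (\<lambda>t. F (apply_bcontfun u t)) x" by (metis uG G_def)
    qed
  qed
qed

section \<open>Arc-chord bounds and Hoelder norms\<close>

lemma cos_sin_shift: "cos (x + 2 * pi * of_int k) = cos x" "sin (x + 2 * pi * of_int k) = sin x"
  by (simp_all add: cos_add sin_add cos_int_2pin sin_int_2pin)

lemma shift_diff:
  assumes "horizontally_periodic z"
  shows "z (\<alpha> + 2 * pi * of_int k) - z (\<beta> + 2 * pi * of_int l) = z \<alpha> - z \<beta> + vector [2 * pi * of_int (k - l), 0]"
  using assms by (simp add: horizontally_periodic_def vec2_eq_iff algebra_simps)

lemma chord_shift: "chord (y + vector [2 * pi * of_int k, 0]) = chord y"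
  and stokeslet_shift: "stokeslet (y + vector [2 * pi * of_int k, 0]) = stokeslet y"
  by (simp_all add: chord_def stokeslet_def cos_sin_shift)

lemma chord_curve_shift:
  assumes "horizontally_periodic z"
  shows "chord (z (\<alpha> + 2 * pi * of_int k) - z (\<beta> + 2 * pi * of_int l)) = chord (z \<alpha> - z \<beta>)"
  unfolding shift_diff[OF assms] by (rule chord_shift)

lemma vel_periodic:
  assumes "horizontally_periodic z" shows "periodic (vel z)"
proof -
  have "z (\<alpha> + 2 * pi * of_int k) - z \<beta> = (z \<alpha> - z \<beta>) + vector [2 * pi * of_int k, 0]" for \<alpha> k \<beta>
    using assms by (simp add: horizontally_periodic_def)
  hence "stokeslet (z (\<alpha> + 2 * pi * of_int k) - z \<beta>) = stokeslet (z \<alpha> - z \<beta>)" for \<alpha> k \<beta>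
    by (simp only: stokeslet_shift)
  thus ?thesis by (simp add: periodic_def vel_def)
qed

lemma periodic_continuous_bounded:
  fixes f :: "real \<Rightarrow> real^2"
  assumes "periodic f" "continuous_on UNIV f"
  obtains B where "0 \<le> B" "\<And>\<alpha>. norm (f \<alpha>) \<le> B"
proof -
  have "compact (f ` torus)" using assms(2) by (intro compact_continuous_image) (auto intro: continuous_on_subset)
  then obtain B where B: "0 < B" "\<And>y. y \<in> f ` torus \<Longrightarrow> norm y \<le> B"
    using compact_imp_bounded bounded_pos by metis
  have "norm (f \<alpha>) \<le> B" for \<alpha> by (rule periodic_bound_torus[OF assms(1)]) (use B in auto)
  thus thesis using that B(1) by (meson less_imp_le)
qed

text \<open>
  The arc-chord function controls parameters in the fundamental domain. Since both \<open>chord\<close> along the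
  curve and \<open>circle_chord\<close> are periodic in each parameter, the bound extends to all of them.
\<close>

lemma chord_lower_bound_of_arc_chord:
  assumes hp: "horizontally_periodic z" and N: "arc_chord_norm z < \<infinity>"
  obtains c where "0 < c" "\<And>\<alpha> \<beta>. c * circle_chord (\<alpha> - \<beta>) \<le> chord (z \<alpha> - z \<beta>)"
proof -
  obtain n where n: "arc_chord_norm z = ennreal n" "0 \<le> n" using N by (cases "arc_chord_norm z") auto
  have le: "arc_chord z \<alpha> \<beta> \<le> ennreal n" if "\<alpha> \<in> torus" "\<beta> \<in> torus" for \<alpha> \<beta>
    using that n(1) unfolding arc_chord_norm_def by (metis (no_types, lifting) SUP_upper2 SUP_upper)
  define c where "c = 1 / sqrt (n + 1)"
  have c: "0 < c" using n by (simp add: c_def)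
  have key: "c * \<bar>\<beta>\<bar> \<le> chord (z \<alpha> - z (\<alpha> - \<beta>))" if ab: "\<alpha> \<in> torus" "\<beta> \<in> torus" for \<alpha> \<beta>
  proof (cases "\<beta> = 0")
    case False
    define g where "g = cosh (z \<alpha> $ 2 - z (\<alpha> - \<beta>) $ 2) - cos (z \<alpha> $ 1 - z (\<alpha> - \<beta>) $ 1)"
    have g2: "(chord (z \<alpha> - z (\<alpha> - \<beta>)))\<^sup>2 = 2 * g" unfolding chord_sq g_def by simp
    have g0: "0 \<le> g" unfolding g_def using cos_le_cosh by (simp add: le_diff_eq)
    have q: "ennreal (\<beta>\<^sup>2) / ennreal g \<le> ennreal n" using le[OF ab] False by (simp add: arc_chord_def g_def)
    have "g \<noteq> 0"
    proof
      assume "g = 0"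
      hence "ennreal (\<beta>\<^sup>2) / ennreal g = \<infinity>" using False by (simp add: ennreal_divide_zero)
      thus False using q by (simp add: top_unique)
    qed
    hence gp: "0 < g" using g0 by simp
    hence "\<beta>\<^sup>2 / g \<le> n" using q n(2) by (simp add: divide_ennreal)
    hence "\<beta>\<^sup>2 \<le> n * g" using gp by (simp add: field_simps)
    also have "n * g \<le> (n + 1) * (chord (z \<alpha> - z (\<alpha> - \<beta>)))\<^sup>2"
      unfolding g2 using n(2) gp by (simp add: algebra_simps)
    finally have "sqrt (\<beta>\<^sup>2) \<le> sqrt ((n + 1) * (chord (z \<alpha> - z (\<alpha> - \<beta>)))\<^sup>2)" by (rule real_sqrt_le_mono)
    hence "\<bar>\<beta>\<bar> \<le> sqrt (n + 1) * chord (z \<alpha> - z (\<alpha> - \<beta>))" by (simp add: real_sqrt_mult)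
    thus ?thesis using n by (simp add: c_def field_simps)
  qed simp
  show thesis
  proof
    show "0 < c" by (rule c)
    fix \<alpha> \<beta>
    obtain k :: int where k: "\<bar>\<alpha> + 2 * pi * of_int k\<bar> \<le> pi" using reduce_mod_2pi by blast
    obtain j :: int where j: "\<bar>\<alpha> - \<beta> + 2 * pi * of_int j\<bar> \<le> pi" using reduce_mod_2pi by blast
    let ?a = "\<alpha> + 2 * pi * of_int k" and ?b = "\<alpha> - \<beta> + 2 * pi * of_int j"
    have "c * circle_chord (\<alpha> - \<beta>) = c * circle_chord ?b" by (simp add: circle_chord_periodic)
    also have "\<dots> \<le> c * \<bar>?b\<bar>" using c by (intro mult_left_mono circle_chord_le) auto
    also have "\<dots> \<le> chord (z ?a - z (?a - ?b))" using k j by (intro key) (auto simp: abs_le_iff)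
    also have "?a - ?b = \<beta> + 2 * pi * of_int (k - j)" by (simp add: algebra_simps)
    also have "chord (z ?a - z (\<beta> + 2 * pi * of_int (k - j))) = chord (z \<alpha> - z \<beta>)" by (rule chord_curve_shift[OF hp])
    finally show "c * circle_chord (\<alpha> - \<beta>) \<le> chord (z \<alpha> - z \<beta>)" .
  qed
qed

lemma regular_of_arc_chord:
  assumes "C1_holder_curve \<gamma> z" "arc_chord_norm z < \<infinity>"
  obtains c A where "regular c A z"
proof -
  have hp: "horizontally_periodic z" and C1: "z C1_differentiable_on UNIV"
    using assms(1) by (auto simp: C1_holder_curve_def C1_holder_def)
  obtain c where c: "0 < c" "\<And>\<alpha> \<beta>. c * circle_chord (\<alpha> - \<beta>) \<le> chord (z \<alpha> - z \<beta>)"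
    using chord_lower_bound_of_arc_chord[OF hp assms(2)] by blast
  have "continuous_on UNIV (\<lambda>\<alpha>. z \<alpha> - vector [\<alpha>, 0])"
    by (intro continuous_intros C1_onD(3)[OF C1])
  from periodic_continuous_bounded[OF hp_diff_periodic[OF hp hp_id] this]
  obtain B1 where B1: "0 \<le> B1" "\<And>\<alpha>. norm (z \<alpha> - vector [\<alpha>, 0]) \<le> B1" by blast
  obtain B2 where B2: "0 \<le> B2" "\<And>\<alpha>. norm (dcurve z \<alpha>) \<le> B2"
    using periodic_continuous_bounded[OF hp_dcurve_periodic[OF hp C1] C1_onD(2)[OF C1]] by blast
  have z2: "\<bar>z \<alpha> $ 2\<bar> \<le> B1" for \<alpha>
    using order_trans[OF component_le_norm_cart B1(2), of \<alpha> 2] by simp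
  have "regular c (max B1 B2) z"
    unfolding regular_def using c hp C1 z2 B2 by (auto simp: le_max_iff_disj)
  thus thesis by (rule that)
qed

text \<open>
  Gives finiteness of the arc-chord function on the diagonal, where it is defined through \<open>z'\<close>.
\<close>

lemma regular_derivative_lower_bound:
  assumes z: "regular c A z"
  shows "c * (2/pi) / cosh (2*A) \<le> norm (dcurve z \<alpha>)" (is "?m \<le> _")
proof (rule ccontr)
  assume n: "\<not> ?m \<le> norm (dcurve z \<alpha>)"
  note zD = regularD[OF z]
  have H: "0 < cosh (2*A)" by simp
  have low: "?m * \<bar>h\<bar> \<le> norm (z (\<alpha> + h) - z \<alpha>)" if "\<bar>h\<bar> \<le> pi" for h
  proof -
    have "c * (2/pi) * \<bar>h\<bar> \<le> c * circle_chord h" using abs_le_circle_chord[OF that] zD(1) by (simp add: field_simps)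
    also have "\<dots> \<le> chord (z (\<alpha> + h) - z \<alpha>)" using zD(6)[of "\<alpha> + h" \<alpha>] by simp
    also have "\<dots> \<le> cosh (2*A) * norm (z (\<alpha> + h) - z \<alpha>)" by (rule chord_le[OF zD(8)])
    finally show ?thesis using H by (simp add: field_simps)
  qed
  have "((\<lambda>h. norm (z (\<alpha> + h) - z \<alpha> - h *\<^sub>R dcurve z \<alpha>) / norm h) \<longlongrightarrow> 0) (at 0)"
    using C1_onD(1)[OF zD(3), of \<alpha>] by (simp add: has_vector_derivative_def has_derivative_at)
  hence "\<forall>\<^sub>F h in at 0. norm (z (\<alpha> + h) - z \<alpha> - h *\<^sub>R dcurve z \<alpha>) / norm h < ?m - norm (dcurve z \<alpha>)"
    using n by (intro order_tendstoD(2)) auto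
  then obtain d where d: "0 < d" "\<And>h. h \<noteq> 0 \<Longrightarrow> \<bar>h\<bar> < d \<Longrightarrow> norm (z (\<alpha> + h) - z \<alpha> - h *\<^sub>R dcurve z \<alpha>) / \<bar>h\<bar> < ?m - norm (dcurve z \<alpha>)"
    unfolding eventually_at by auto
  define h where "h = min (d/2) pi"
  have h: "0 < h" "h < d" "h \<le> pi" using d(1) by (auto simp: h_def)
  have "norm (z (\<alpha> + h) - z \<alpha> - h *\<^sub>R dcurve z \<alpha>) < (?m - norm (dcurve z \<alpha>)) * h"
    using d(2)[of h] h by (simp add: pos_divide_less_eq)
  moreover have "norm (z (\<alpha> + h) - z \<alpha>) \<le> norm (z (\<alpha> + h) - z \<alpha> - h *\<^sub>R dcurve z \<alpha>) + h * norm (dcurve z \<alpha>)"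
    using norm_triangle_ineq[of "z (\<alpha> + h) - z \<alpha> - h *\<^sub>R dcurve z \<alpha>" "h *\<^sub>R dcurve z \<alpha>"] h by simp
  ultimately have "norm (z (\<alpha> + h) - z \<alpha>) < (?m - norm (dcurve z \<alpha>)) * h + h * norm (dcurve z \<alpha>)" by linarith
  also have "\<dots> = ?m * h" by (simp only: left_diff_distrib mult.commute[of h] diff_add_cancel)
  finally have "norm (z (\<alpha> + h) - z \<alpha>) < ?m * h" .
  thus False using low[of h] h by simp
qed

lemma arc_chord_finite_of_regular:
  assumes z: "regular c A z"
  shows "arc_chord_norm z < \<infinity>"
proof -
  note zD = regularD[OF z]
  define m where "m = c * (2/pi) / cosh (2*A)"
  have m: "0 < m" using zD(1) by (simp add: m_def)
  define k where "k = (c * (2/pi))\<^sup>2 / 2"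
  have k: "0 < k" using zD(1) by (simp add: k_def)
  define K where "K = max (2 / m\<^sup>2) (1 / k)"
  have "arc_chord z \<alpha> \<beta> \<le> ennreal K" if b: "\<beta> \<in> torus" for \<alpha> \<beta>
  proof (cases "\<beta> = 0")
    case True
    have d: "m \<le> norm (dcurve z \<alpha>)" unfolding m_def by (rule regular_derivative_lower_bound[OF z])
    have dp: "0 < (norm (dcurve z \<alpha>))\<^sup>2" by (rule zero_less_power[OF less_le_trans[OF m d]])
    have "arc_chord z \<alpha> \<beta> = ennreal 2 / ennreal ((norm (dcurve z \<alpha>))\<^sup>2)" using True by (simp add: arc_chord_def)
    also have "\<dots> = ennreal (2 / (norm (dcurve z \<alpha>))\<^sup>2)" by (rule divide_ennreal[OF _ dp]) simp
    also have "\<dots> \<le> ennreal (2 / m\<^sup>2)"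
      using d m by (intro ennreal_leI divide_left_mono power_mono) (auto intro!: mult_pos_pos dp)
    also have "\<dots> \<le> ennreal K" by (intro ennreal_leI) (simp add: K_def)
    finally show ?thesis .
  next
    case False
    let ?y = "z \<alpha> - z (\<alpha> - \<beta>)"
    define g where "g = cosh (z \<alpha> $ 2 - z (\<alpha> - \<beta>) $ 2) - cos (z \<alpha> $ 1 - z (\<alpha> - \<beta>) $ 1)"
    have g2: "(chord ?y)\<^sup>2 = 2 * g" unfolding chord_sq g_def by simp
    have "c * (2/pi) * \<bar>\<beta>\<bar> \<le> c * circle_chord \<beta>" using abs_le_circle_chord[of \<beta>] b zD(1) by (simp add: field_simps abs_le_iff)
    also have "\<dots> \<le> chord ?y" using zD(6)[of \<alpha> "\<alpha> - \<beta>"] by simp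
    finally have "(c * (2/pi) * \<bar>\<beta>\<bar>)\<^sup>2 \<le> 2 * g" unfolding g2[symmetric] using zD(1) by (intro power_mono) auto
    moreover have "(c * (2/pi) * \<bar>\<beta>\<bar>)\<^sup>2 = 2 * (k * \<beta>\<^sup>2)"
      unfolding k_def power_mult_distrib power2_abs by simp
    ultimately have kg: "k * \<beta>\<^sup>2 \<le> g" by simp
    have b2: "0 < \<beta>\<^sup>2" using False by simp
    have gp: "0 < g" using kg mult_pos_pos[OF k b2] by linarith
    have "arc_chord z \<alpha> \<beta> = ennreal (\<beta>\<^sup>2) / ennreal g" using False by (simp add: arc_chord_def g_def)
    also have "\<dots> = ennreal (\<beta>\<^sup>2 / g)" by (rule divide_ennreal[OF _ gp]) simp
    also have "\<dots> \<le> ennreal (1 / k)"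
      using kg k gp by (intro ennreal_leI) (simp add: field_simps)
    also have "\<dots> \<le> ennreal K" by (intro ennreal_leI) (simp add: K_def)
    finally show ?thesis .
  qed
  hence "arc_chord_norm z \<le> ennreal K" unfolding arc_chord_norm_def by (intro SUP_least) auto
  thus ?thesis by (simp add: le_less_trans ennreal_less_top)
qed

text \<open>
  The function \<open>chord\<close> is Lipschitz, and the perturbation of \<open>z(\<alpha>) - z(\<beta>)\<close> is of the order of
  \<open>circle_chord (\<alpha> - \<beta>)\<close>. A small \<open>C\<^sup>1\<close> perturbation therefore costs a small multiple of
  \<open>circle_chord (\<alpha> - \<beta>)\<close>.
\<close>

lemma regular_stability:
  assumes z: "regular c A z"
  obtains \<delta> where "0 < \<delta>"
    "\<And>w. \<lbrakk>horizontally_periodic w; w C1_differentiable_on UNIV; \<And>\<alpha>. norm (w \<alpha> - z \<alpha>) \<le> \<delta>;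
       \<And>\<alpha>. norm (dcurve w \<alpha> - dcurve z \<alpha>) \<le> \<delta>\<rbrakk> \<Longrightarrow> regular (c/2) (A+1) w"
proof -
  note zD = regularD[OF z]
  define H where "H = cosh (2 * (A + 1))"
  have H: "1 \<le> H" by (simp add: H_def cosh_real_ge_1)
  define \<delta> where "\<delta> = min 1 (c / (pi * H))"
  have \<delta>: "0 < \<delta>" "\<delta> \<le> 1" using zD(1) H by (auto simp: \<delta>_def)
  have "\<delta> \<le> c / (pi * H)" by (simp add: \<delta>_def)
  hence small: "H * (\<delta> * (pi/2)) \<le> c/2" using H by (simp add: field_simps)
  show thesis
  proof (rule that[OF \<delta>(1)])
    fix w assume hp: "horizontally_periodic w" and C1: "w C1_differentiable_on UNIV"
      and d: "\<And>\<alpha>. norm (w \<alpha> - z \<alpha>) \<le> \<delta>" "\<And>\<alpha>. norm (dcurve w \<alpha> - dcurve z \<alpha>) \<le> \<delta>"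
    have w2: "\<bar>w \<alpha> $ 2\<bar> \<le> A + 1" for \<alpha>
    proof -
      have "\<bar>w \<alpha> $ 2 - z \<alpha> $ 2\<bar> \<le> \<delta>" using order_trans[OF component_le_norm_cart d(1), of \<alpha> 2] by simp
      thus ?thesis using zD(4)[of \<alpha>] \<delta>(2) by linarith
    qed
    have dw: "norm (dcurve w \<alpha>) \<le> A + 1" for \<alpha>
    proof -
      have "norm (dcurve w \<alpha>) \<le> norm (dcurve z \<alpha>) + norm (dcurve w \<alpha> - dcurve z \<alpha>)" by (rule norm_triangle_sub)
      thus ?thesis using zD(5)[of \<alpha>] d(2)[of \<alpha>] \<delta>(2) by linarith
    qed
    have ch: "c/2 * circle_chord (\<alpha> - \<beta>) \<le> chord (w \<alpha> - w \<beta>)" for \<alpha> \<beta>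
    proof -
      have "norm ((w \<alpha> - z \<alpha>) - (w \<beta> - z \<beta>)) \<le> \<delta> * (pi/2) * circle_chord (\<alpha> - \<beta>)"
        by (rule periodic_lipschitz_circle_chord[OF hp_diff_periodic[OF hp zD(2)] has_vector_derivative_diff[OF C1_onD(1)[OF C1] C1_onD(1)[OF zD(3)]] d(2)])
      hence n: "norm ((w \<alpha> - w \<beta>) - (z \<alpha> - z \<beta>)) \<le> \<delta> * (pi/2) * circle_chord (\<alpha> - \<beta>)" by (simp add: algebra_simps)
      have "\<bar>chord (w \<alpha> - w \<beta>) - chord (z \<alpha> - z \<beta>)\<bar> \<le> H * norm ((w \<alpha> - w \<beta>) - (z \<alpha> - z \<beta>))"
        unfolding H_def
      proof (rule chord_lipschitz)
        have "\<bar>w \<alpha> $ 2 - w \<beta> $ 2\<bar> \<le> (A + 1) + (A + 1)" using w2[of \<alpha>] w2[of \<beta>] by linarith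
        thus "\<bar>(w \<alpha> - w \<beta>) $ 2\<bar> \<le> 2 * (A + 1)" by simp
        have "\<bar>(z \<alpha> - z \<beta>) $ 2\<bar> \<le> 2 * A" by (rule zD(8))
        also have "2 * A \<le> 2 * (A + 1)" by simp
        finally show "\<bar>(z \<alpha> - z \<beta>) $ 2\<bar> \<le> 2 * (A + 1)" .
      qed
      also have "\<dots> \<le> H * (\<delta> * (pi/2) * circle_chord (\<alpha> - \<beta>))" using H n by (intro mult_left_mono) auto
      also have "\<dots> = (H * (\<delta> * (pi/2))) * circle_chord (\<alpha> - \<beta>)" by simp
      also have "\<dots> \<le> c/2 * circle_chord (\<alpha> - \<beta>)" using small by (intro mult_right_mono) auto
      finally have "chord (z \<alpha> - z \<beta>) - chord (w \<alpha> - w \<beta>) \<le> c/2 * circle_chord (\<alpha> - \<beta>)" by linarith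
      moreover have "c/2 * circle_chord (\<alpha> - \<beta>) + c/2 * circle_chord (\<alpha> - \<beta>) \<le> chord (z \<alpha> - z \<beta>)"
        using zD(6)[of \<alpha> \<beta>] by (simp flip: distrib_right)
      ultimately show ?thesis by linarith
    qed
    show "regular (c/2) (A+1) w"
      unfolding regular_def using zD(1) hp C1 w2 dw ch by simp
  qed
qed

lemma bdd_above_norm_torus:
  fixes f :: "real \<Rightarrow> real^2"
  assumes "continuous_on UNIV f" shows "bdd_above ((\<lambda>\<alpha>. norm (f \<alpha>)) ` torus)"
proof -
  have "continuous_on torus (\<lambda>\<alpha>. norm (f \<alpha>))"
    using assms by (intro continuous_on_norm) (rule continuous_on_subset, auto)
  hence "compact ((\<lambda>\<alpha>. norm (f \<alpha>)) ` torus)" by (intro compact_continuous_image) auto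
  thus ?thesis by (intro bounded_imp_bdd_above compact_imp_bounded)
qed

lemma norm_le_sup_norm:
  assumes "continuous_on UNIV f" "\<alpha> \<in> torus" shows "norm (f \<alpha>) \<le> sup_norm f"
  unfolding sup_norm_def by (rule cSUP_upper[OF assms(2) bdd_above_norm_torus[OF assms(1)]])

lemma holder_quotients_nonempty: "norm (f pi - f 0) / \<bar>pi - 0\<bar> powr \<gamma> \<in> holder_quotients \<gamma> f"
  unfolding holder_quotients_def
  by (intro CollectI exI[of _ pi] exI[of _ 0]) (use pi_gt_zero in simp)

lemma le_holder_seminorm:
  assumes b: "bdd_above (holder_quotients \<gamma> f)" and ab: "\<alpha> \<in> torus" "\<beta> \<in> torus"
  shows "norm (f \<alpha> - f \<beta>) \<le> holder_seminorm \<gamma> f * \<bar>\<alpha> - \<beta>\<bar> powr \<gamma>"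
proof (cases "\<alpha> = \<beta>")
  case False
  have "norm (f \<alpha> - f \<beta>) / \<bar>\<alpha> - \<beta>\<bar> powr \<gamma> \<le> holder_seminorm \<gamma> f"
    unfolding holder_seminorm_def using ab False by (intro cSup_upper[OF _ b]) (auto simp: holder_quotients_def)
  thus ?thesis using False by (simp add: divide_le_eq)
qed simp

lemma C1_holder_normD:
  assumes "C1_holder \<gamma> f"
  shows "\<alpha> \<in> torus \<Longrightarrow> norm (f \<alpha>) \<le> C1_holder_norm \<gamma> f"
    and "\<alpha> \<in> torus \<Longrightarrow> norm (dcurve f \<alpha>) \<le> C1_holder_norm \<gamma> f"
    and "\<alpha> \<in> torus \<Longrightarrow> \<beta> \<in> torus \<Longrightarrow> norm (dcurve f \<alpha> - dcurve f \<beta>) \<le> C1_holder_norm \<gamma> f * \<bar>\<alpha> - \<beta>\<bar> powr \<gamma>"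
proof -
  have C1: "f C1_differentiable_on UNIV" and b: "bdd_above (holder_quotients \<gamma> (dcurve f))"
    using assms by (auto simp: C1_holder_def)
  have t0: "0 \<in> torus" by simp
  have s1: "0 \<le> sup_norm f" using norm_le_sup_norm[OF C1_onD(3)[OF C1] t0] norm_ge_zero order_trans by blast
  have s2: "0 \<le> sup_norm (dcurve f)" using norm_le_sup_norm[OF C1_onD(2)[OF C1] t0] norm_ge_zero order_trans by blast
  have "norm (dcurve f pi - dcurve f 0) / \<bar>pi - 0\<bar> powr \<gamma> \<le> holder_seminorm \<gamma> (dcurve f)"
    unfolding holder_seminorm_def by (rule cSup_upper[OF holder_quotients_nonempty b])
  hence s3: "0 \<le> holder_seminorm \<gamma> (dcurve f)"
    by (rule order_trans[rotated]) simp
  show "norm (f \<alpha>) \<le> C1_holder_norm \<gamma> f" if "\<alpha> \<in> torus"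
    using norm_le_sup_norm[OF C1_onD(3)[OF C1] that] s2 s3 by (simp add: C1_holder_norm_def)
  show "norm (dcurve f \<alpha>) \<le> C1_holder_norm \<gamma> f" if "\<alpha> \<in> torus"
    using norm_le_sup_norm[OF C1_onD(2)[OF C1] that] s1 s3 by (simp add: C1_holder_norm_def)
  show "norm (dcurve f \<alpha> - dcurve f \<beta>) \<le> C1_holder_norm \<gamma> f * \<bar>\<alpha> - \<beta>\<bar> powr \<gamma>" if "\<alpha> \<in> torus" "\<beta> \<in> torus"
  proof -
    have "norm (dcurve f \<alpha> - dcurve f \<beta>) \<le> holder_seminorm \<gamma> (dcurve f) * \<bar>\<alpha> - \<beta>\<bar> powr \<gamma>"
      by (rule le_holder_seminorm[OF b that])
    also have "\<dots> \<le> C1_holder_norm \<gamma> f * \<bar>\<alpha> - \<beta>\<bar> powr \<gamma>"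
      using s1 s2 by (intro mult_right_mono) (auto simp: C1_holder_norm_def)
    finally show ?thesis .
  qed
qed

lemma C1_holderI:
  assumes "f C1_differentiable_on UNIV"
    and "\<And>\<alpha> \<beta>. \<alpha> \<in> torus \<Longrightarrow> \<beta> \<in> torus \<Longrightarrow> norm (dcurve f \<alpha> - dcurve f \<beta>) \<le> k * \<bar>\<alpha> - \<beta>\<bar> powr \<gamma>"
  shows "C1_holder \<gamma> f"
proof -
  have "x \<le> k" if "x \<in> holder_quotients \<gamma> (dcurve f)" for x
    using that assms(2) by (auto simp: holder_quotients_def divide_le_eq)
  thus ?thesis unfolding C1_holder_def using assms(1) by (auto intro: bdd_aboveI[of _ k])
qed

lemma C1_holder_normI:
  assumes C1: "f C1_differentiable_on UNIV"
    and a: "\<And>\<alpha>. \<alpha> \<in> torus \<Longrightarrow> norm (f \<alpha>) \<le> a" and b: "\<And>\<alpha>. \<alpha> \<in> torus \<Longrightarrow> norm (dcurve f \<alpha>) \<le> b"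
    and k: "\<And>\<alpha> \<beta>. \<alpha> \<in> torus \<Longrightarrow> \<beta> \<in> torus \<Longrightarrow> norm (dcurve f \<alpha> - dcurve f \<beta>) \<le> k * \<bar>\<alpha> - \<beta>\<bar> powr \<gamma>"
  shows "C1_holder \<gamma> f" "C1_holder_norm \<gamma> f \<le> a + b + k"
proof -
  have q: "x \<le> k" if "x \<in> holder_quotients \<gamma> (dcurve f)" for x
    using that k by (auto simp: holder_quotients_def divide_le_eq)
  show "C1_holder \<gamma> f" by (rule C1_holderI[OF C1 k])
  have "sup_norm f \<le> a" unfolding sup_norm_def by (rule cSUP_least) (use a in auto)
  moreover have "sup_norm (dcurve f) \<le> b" unfolding sup_norm_def by (rule cSUP_least) (use b in auto)
  moreover have "holder_seminorm \<gamma> (dcurve f) \<le> k"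
    unfolding holder_seminorm_def by (rule cSup_least) (use q holder_quotients_nonempty in auto)
  ultimately show "C1_holder_norm \<gamma> f \<le> a + b + k" by (simp add: C1_holder_norm_def)
qed

lemma C1_holder_norm_nonneg: "C1_holder \<gamma> f \<Longrightarrow> 0 \<le> C1_holder_norm \<gamma> f"
  using order_trans[OF norm_ge_zero C1_holder_normD(1)[of \<gamma> f 0]] by simp

lemma C1_lincomb:
  assumes "f C1_differentiable_on UNIV" "g C1_differentiable_on UNIV"
  shows "(\<lambda>\<alpha>. a *\<^sub>R f \<alpha> + b *\<^sub>R g \<alpha>) C1_differentiable_on UNIV"
    "dcurve (\<lambda>\<alpha>. a *\<^sub>R f \<alpha> + b *\<^sub>R g \<alpha>) \<alpha> = a *\<^sub>R dcurve f \<alpha> + b *\<^sub>R dcurve g \<alpha>"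
proof -
  have d: "((\<lambda>\<alpha>. a *\<^sub>R f \<alpha> + b *\<^sub>R g \<alpha>) has_vector_derivative (a *\<^sub>R dcurve f \<alpha> + b *\<^sub>R dcurve g \<alpha>)) (at \<alpha>)" for \<alpha>
    by (intro has_vector_derivative_add bounded_linear.has_vector_derivative[OF bounded_linear_scaleR_right] C1_onD(1) assms)
  have c: "continuous_on UNIV (\<lambda>\<alpha>. a *\<^sub>R dcurve f \<alpha> + b *\<^sub>R dcurve g \<alpha>)"
    by (intro continuous_intros C1_onD(2) assms)
  show "(\<lambda>\<alpha>. a *\<^sub>R f \<alpha> + b *\<^sub>R g \<alpha>) C1_differentiable_on UNIV" by (rule C1_onI(1)[OF d c])
  show "dcurve (\<lambda>\<alpha>. a *\<^sub>R f \<alpha> + b *\<^sub>R g \<alpha>) \<alpha> = a *\<^sub>R dcurve f \<alpha> + b *\<^sub>R dcurve g \<alpha>"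
    by (rule vector_derivative_at[OF d])
qed

lemma norm_lincomb_le:
  fixes x y :: "'a::real_normed_vector"
  assumes "norm x \<le> k * e" "norm y \<le> l * e"
  shows "norm (a *\<^sub>R x + b *\<^sub>R y) \<le> (\<bar>a\<bar> * k + \<bar>b\<bar> * l) * e"
proof -
  have "norm (a *\<^sub>R x + b *\<^sub>R y) \<le> \<bar>a\<bar> * norm x + \<bar>b\<bar> * norm y"
    by (rule order_trans[OF norm_triangle_ineq]) simp
  also have "\<dots> \<le> \<bar>a\<bar> * (k * e) + \<bar>b\<bar> * (l * e)" using assms by (intro add_mono mult_left_mono) auto
  finally show ?thesis by (simp add: algebra_simps)
qed

lemma C1_holder_lincomb:
  assumes f: "C1_holder \<gamma> f" and g: "C1_holder \<gamma> g"
  shows "C1_holder \<gamma> (\<lambda>\<alpha>. a *\<^sub>R f \<alpha> + b *\<^sub>R g \<alpha>)"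
proof -
  have C1: "f C1_differentiable_on UNIV" "g C1_differentiable_on UNIV" using f g by (auto simp: C1_holder_def)
  note fD = C1_holder_normD[OF f] and gD = C1_holder_normD[OF g] and L = C1_lincomb[OF C1, of a b]
  let ?K = "\<bar>a\<bar> * C1_holder_norm \<gamma> f + \<bar>b\<bar> * C1_holder_norm \<gamma> g"
  show ?thesis
  proof (rule C1_holder_normI(1)[OF L(1), where a = ?K and b = ?K and k = ?K])
    fix \<alpha> assume \<alpha>: "\<alpha> \<in> torus"
    show "norm (a *\<^sub>R f \<alpha> + b *\<^sub>R g \<alpha>) \<le> ?K"
      using norm_lincomb_le[of "f \<alpha>" _ 1 "g \<alpha>"] fD(1)[OF \<alpha>] gD(1)[OF \<alpha>] by simp
    show "norm (dcurve (\<lambda>\<alpha>. a *\<^sub>R f \<alpha> + b *\<^sub>R g \<alpha>) \<alpha>) \<le> ?K"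
      using norm_lincomb_le[of "dcurve f \<alpha>" _ 1 "dcurve g \<alpha>"] fD(2)[OF \<alpha>] gD(2)[OF \<alpha>] by (simp add: L(2))
    fix \<beta> assume \<beta>: "\<beta> \<in> torus"
    have "dcurve (\<lambda>\<alpha>. a *\<^sub>R f \<alpha> + b *\<^sub>R g \<alpha>) \<alpha> - dcurve (\<lambda>\<alpha>. a *\<^sub>R f \<alpha> + b *\<^sub>R g \<alpha>) \<beta>
       = a *\<^sub>R (dcurve f \<alpha> - dcurve f \<beta>) + b *\<^sub>R (dcurve g \<alpha> - dcurve g \<beta>)"
      unfolding L(2) by (simp add: algebra_simps)
    thus "norm (dcurve (\<lambda>\<alpha>. a *\<^sub>R f \<alpha> + b *\<^sub>R g \<alpha>) \<alpha> - dcurve (\<lambda>\<alpha>. a *\<^sub>R f \<alpha> + b *\<^sub>R g \<alpha>) \<beta>) \<le> ?K * \<bar>\<alpha> - \<beta>\<bar> powr \<gamma>"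
      using norm_lincomb_le[OF fD(3)[OF \<alpha> \<beta>] gD(3)[OF \<alpha> \<beta>]] by simp
  qed
qed

section \<open>Estimates for the tangential derivative of the velocity\<close>

definition dvel :: "(real \<Rightarrow> real^2) \<Rightarrow> real \<Rightarrow> real^2" where
  "dvel z \<alpha> = tangent_op z \<alpha> *v perp (dcurve z \<alpha>)"

lemma tangent_op_continuous:
  assumes "regular c A z" shows "continuous_on UNIV (tangent_op z)"
proof -
  obtain C where C: "0 \<le> C" "\<And>z \<alpha> \<alpha>'. regular c A z \<Longrightarrow> norm (tangent_op z \<alpha> - tangent_op z \<alpha>') \<le> C * \<bar>\<alpha> - \<alpha>'\<bar> powr (1/2)"
    using tangent_op_holder[of "1/2" c A] by auto
  have "isCont (tangent_op z) a" for a
  proof -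
    have "((\<lambda>x. \<bar>x - a\<bar>) \<longlongrightarrow> \<bar>a - a\<bar>) (at a)" by (intro tendsto_intros)
    hence "((\<lambda>x. \<bar>x - a\<bar> powr (1/2)) \<longlongrightarrow> \<bar>a - a\<bar> powr (1/2)) (at a)"
      by (rule tendsto_powr2[OF _ tendsto_const]) auto
    hence "((\<lambda>x. C * \<bar>x - a\<bar> powr (1/2)) \<longlongrightarrow> C * \<bar>a - a\<bar> powr (1/2)) (at a)"
      by (rule tendsto_mult_left)
    hence l: "((\<lambda>x. C * \<bar>x - a\<bar> powr (1/2)) \<longlongrightarrow> 0) (at a)" by simp
    have "((\<lambda>x. tangent_op z x - tangent_op z a) \<longlongrightarrow> 0) (at a)"
      by (rule Lim_null_comparison[OF _ l], rule always_eventually, rule allI, rule C(2)[OF assms])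
    thus ?thesis unfolding isCont_def by (rule LIM_zero_cancel)
  qed
  thus ?thesis by (simp add: continuous_at_imp_continuous_on)
qed

lemma dvel_continuous:
  assumes "regular c A z" shows "continuous_on UNIV (dvel z)"
  unfolding dvel_def
  by (intro bounded_bilinear.continuous_on[OF bounded_bilinear_matrix_vector] tangent_op_continuous[OF assms]
      bounded_linear.continuous_on[OF bounded_linear_perp] C1_onD(2)[OF regularD(3)[OF assms]])

lemma vel_C1:
  assumes "regular c A z"
  shows "vel z C1_differentiable_on UNIV" "dcurve (vel z) \<alpha> = dvel z \<alpha>" "(vel z has_vector_derivative dvel z \<alpha>) (at \<alpha>)"
proof -
  show d: "(vel z has_vector_derivative dvel z \<alpha>) (at \<alpha>)" for \<alpha>
    unfolding dvel_def by (rule vel_has_derivative[OF assms])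
  show "vel z C1_differentiable_on UNIV" by (rule C1_onI(1)[OF d dvel_continuous[OF assms]])
  show "dcurve (vel z) \<alpha> = dvel z \<alpha>" by (rule vector_derivative_at[OF d])
qed

lemma vel_dvel_bounded:
  obtains V where "0 \<le> V" "\<And>z \<alpha>. regular c A z \<Longrightarrow> norm (vel z \<alpha>) \<le> V" "\<And>z \<alpha>. regular c A z \<Longrightarrow> norm (dvel z \<alpha>) \<le> V"
proof -
  obtain C where C: "0 \<le> C" "\<And>z \<alpha> \<beta>. regular c A z \<Longrightarrow> norm (stokeslet (z \<alpha> - z \<beta>)) \<le> C * circle_chord (\<alpha> - \<beta>) powr (-(1/2))"
    using regular_stokeslet_bound by blast
  obtain I where I: "0 \<le> I" "\<And>\<alpha>. set_integrable lborel torus (\<lambda>\<beta>. circle_chord (\<alpha> - \<beta>) powr (-(1/2)))"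
     "\<And>\<alpha>. (LINT \<beta>:torus|lborel. circle_chord (\<alpha> - \<beta>) powr (-(1/2))) \<le> I"
    using circle_chord_half_integral by blast
  obtain G where G: "0 \<le> G" "\<And>z \<alpha>. regular c A z \<Longrightarrow> norm (tangent_op z \<alpha>) \<le> G" using tangent_op_bounded by blast
  define V1 where "V1 = \<bar>A\<bar> * (C * I * \<bar>A\<bar>)"
  define V2 where "V2 = G * \<bar>A\<bar>"
  have V: "0 \<le> V1" "0 \<le> V2" using C I G by (auto simp: V1_def V2_def)
  show thesis
  proof
    show "0 \<le> V1 + V2" using V by simp
    fix z and \<alpha> :: real assume z: "regular c A z"
    note zD = regularD[OF z]
    have b: "norm ((z \<beta> $ 2) *\<^sub>R (stokeslet (z \<alpha> - z \<beta>) *v perp (dcurve z \<beta>))) \<le> A * C * A * circle_chord (\<alpha> - \<beta>) powr (-(1/2))" for \<beta>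
    proof -
      have "norm (stokeslet (z \<alpha> - z \<beta>) *v perp (dcurve z \<beta>)) \<le> C * circle_chord (\<alpha> - \<beta>) powr (-(1/2)) * A"
        by (rule order_trans[OF norm_matrix_vector_le mult_mono], rule C(2)[OF z]) (simp_all add: zD(5) C(1))
      hence "\<bar>z \<beta> $ 2\<bar> * norm (stokeslet (z \<alpha> - z \<beta>) *v perp (dcurve z \<beta>)) \<le> A * (C * circle_chord (\<alpha> - \<beta>) powr (-(1/2)) * A)"
        by (intro mult_mono zD(4)) (simp_all add: zD(7))
      thus ?thesis unfolding norm_scaleR by (simp only: mult_ac)
    qed
    have "norm (vel z \<alpha>) \<le> (LINT \<beta>:torus|lborel. A * C * A * circle_chord (\<alpha> - \<beta>) powr (-(1/2)))"
      unfolding vel_def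
    proof (rule set_integral_dominated(2)[OF vel_integrand_measurable(1)[OF zD(3)]])
      show "set_integrable lborel torus (\<lambda>\<beta>. A * C * A * circle_chord (\<alpha> - \<beta>) powr (-(1/2)))"
        by (intro set_integrable_mult_right I(2))
    qed (use b in auto)
    also have "\<dots> \<le> A * C * A * I" using I(3)[of \<alpha>] C(1) zD(7) by (simp add: mult_left_mono)
    also have "\<dots> = V1" using zD(7) by (simp add: V1_def)
    finally show "norm (vel z \<alpha>) \<le> V1 + V2" using V by linarith
    have "norm (dvel z \<alpha>) \<le> G * A" unfolding dvel_def
      by (rule order_trans[OF norm_matrix_vector_le mult_mono], rule G(2)[OF z]) (simp_all add: zD(5) G(1))
    also have "\<dots> = V2" using zD(7) by (simp add: V2_def)
    finally show "norm (dvel z \<alpha>) \<le> V1 + V2" using V by linarith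
  qed
qed

lemma bilinear_product_diff:
  fixes M N :: "real^2^2"
  shows "M *v perp p - N *v perp q = (M - N) *v perp p + N *v perp (p - q)"
  by (simp add: perp_diff bounded_bilinear.diff_left[OF bounded_bilinear_matrix_vector]
      bounded_bilinear.diff_right[OF bounded_bilinear_matrix_vector])

lemma norm_mv_perp_le: "norm (M *v perp p) \<le> m * k" if "norm M \<le> m" "norm p \<le> k" for M :: "real^2^2"
proof -
  have "0 \<le> m" using that(1) norm_ge_zero order_trans by blast
  have "norm M * norm (perp p) \<le> m * k" by (rule mult_mono) (use that \<open>0 \<le> m\<close> in simp_all)
  thus ?thesis by (rule order_trans[OF norm_matrix_vector_le])
qed

lemma norm_product_diff_le:
  fixes M N :: "real^2^2"
  assumes "norm (M - N) \<le> d" "norm p \<le> k" "norm N \<le> m" "norm (p - q) \<le> e"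
  shows "norm (M *v perp p - N *v perp q) \<le> d * k + m * e"
  unfolding bilinear_product_diff
  by (rule order_trans[OF norm_triangle_ineq add_mono]; rule norm_mv_perp_le) (fact assms)+

lemma vel_dvel_lipschitz:
  obtains C where "0 \<le> C"
    "\<And>z w \<delta> \<alpha>. \<lbrakk>regular c A z; regular c A w; \<And>\<alpha>. norm (z \<alpha> - w \<alpha>) \<le> \<delta>; \<And>\<alpha>. norm (dcurve z \<alpha> - dcurve w \<alpha>) \<le> \<delta>\<rbrakk> \<Longrightarrow>
       norm (vel z \<alpha> - vel w \<alpha>) \<le> C * \<delta> \<and> norm (dvel z \<alpha> - dvel w \<alpha>) \<le> C * \<delta>"
proof -
  obtain L where L: "0 \<le> L"
    "\<And>z w \<delta> \<alpha>. \<lbrakk>regular c A z; regular c A w; \<And>\<alpha>. norm (z \<alpha> - w \<alpha>) \<le> \<delta>; \<And>\<alpha>. norm (dcurve z \<alpha> - dcurve w \<alpha>) \<le> \<delta>\<rbrakk> \<Longrightarrow>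
       norm (vel z \<alpha> - vel w \<alpha>) \<le> L * \<delta> \<and> norm (tangent_op z \<alpha> - tangent_op w \<alpha>) \<le> L * \<delta>"
    using vel_lipschitz by blast
  obtain G where G: "0 \<le> G" "\<And>z \<alpha>. regular c A z \<Longrightarrow> norm (tangent_op z \<alpha>) \<le> G" using tangent_op_bounded by blast
  show thesis
  proof
    show "0 \<le> L + L * \<bar>A\<bar> + G" using L G by simp
    fix z w \<delta> and \<alpha> :: real
    assume z: "regular c A z" and w: "regular c A w"
      and \<delta>: "\<And>\<alpha>. norm (z \<alpha> - w \<alpha>) \<le> \<delta>" "\<And>\<alpha>. norm (dcurve z \<alpha> - dcurve w \<alpha>) \<le> \<delta>"
    have \<delta>0: "\<delta> \<ge> 0" using \<delta>(1) norm_ge_zero order_trans by blast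
    have A: "0 \<le> A" by (rule regularD(7)[OF z])
    have l: "norm (vel z \<alpha> - vel w \<alpha>) \<le> L * \<delta>" "norm (tangent_op z \<alpha> - tangent_op w \<alpha>) \<le> L * \<delta>"
      using L(2)[OF z w \<delta>] by auto
    have d: "norm (dvel z \<alpha> - dvel w \<alpha>) \<le> L * \<delta> * A + G * \<delta>"
      unfolding dvel_def by (rule norm_product_diff_le[OF l(2) regularD(5)[OF z] G(2)[OF w] \<delta>(2)])
    have e: "(L + L * \<bar>A\<bar> + G) * \<delta> = L * \<delta> + L * \<delta> * A + G * \<delta>" using A by (simp add: algebra_simps)
    have "0 \<le> L * \<delta>" "0 \<le> L * \<delta> * A" "0 \<le> G * \<delta>" using L G \<delta>0 A by auto
    thus "norm (vel z \<alpha> - vel w \<alpha>) \<le> (L + L * \<bar>A\<bar> + G) * \<delta> \<and> norm (dvel z \<alpha> - dvel w \<alpha>) \<le> (L + L * \<bar>A\<bar> + G) * \<delta>"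
      unfolding e using l(1) d by linarith
  qed
qed

text \<open>
  The dependence on the Hoelder seminorm of \<open>z'\<close> is linear, with a coefficient that does not involve
  it. This is why a time of existence that depends on \<open>C\<^sup>1\<close> bounds alone suffices to propagate it.
\<close>

lemma dvel_holder:
  assumes "0 < \<gamma>" "\<gamma> < 1"
  obtains C where "0 \<le> C"
    "\<And>z \<alpha> \<beta>. regular c A z \<Longrightarrow> norm (dvel z \<alpha> - dvel z \<beta>) \<le> C * (\<bar>\<alpha> - \<beta>\<bar> powr \<gamma> + norm (dcurve z \<alpha> - dcurve z \<beta>))"
proof -
  obtain H where H: "0 \<le> H" "\<And>z \<alpha> \<alpha>'. regular c A z \<Longrightarrow> norm (tangent_op z \<alpha> - tangent_op z \<alpha>') \<le> H * \<bar>\<alpha> - \<alpha>'\<bar> powr \<gamma>"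
    using tangent_op_holder[OF assms, of c A] by blast
  obtain G where G: "0 \<le> G" "\<And>z \<alpha>. regular c A z \<Longrightarrow> norm (tangent_op z \<alpha>) \<le> G" using tangent_op_bounded by blast
  show thesis
  proof
    show "0 \<le> H * \<bar>A\<bar> + G" using H G by simp
    fix z \<alpha> \<beta> assume z: "regular c A z"
    let ?n = "norm (dcurve z \<alpha> - dcurve z \<beta>)" and ?d = "\<bar>\<alpha> - \<beta>\<bar> powr \<gamma>"
    have A: "0 \<le> A" by (rule regularD(7)[OF z])
    have "norm (dvel z \<alpha> - dvel z \<beta>) \<le> H * ?d * A + G * ?n"
      unfolding dvel_def by (rule norm_product_diff_le[OF H(2)[OF z] regularD(5)[OF z] G(2)[OF z] order_refl])
    moreover have "(H * \<bar>A\<bar> + G) * (?d + ?n) = H * ?d * A + G * ?n + (H * A * ?n + G * ?d)" using A by (simp add: algebra_simps)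
    moreover have "0 \<le> H * A * ?n + G * ?d" using H G A by simp
    ultimately show "norm (dvel z \<alpha> - dvel z \<beta>) \<le> (H * \<bar>A\<bar> + G) * (?d + ?n)" by linarith
  qed
qed

lemma le_interpolate:
  fixes v a b l :: real
  assumes "0 \<le> v" "v \<le> a" "v \<le> b" "0 \<le> l" "l \<le> 1"
  shows "v \<le> a powr l * b powr (1 - l)"
proof (cases "v = 0")
  case False
  hence "v = v powr l * v powr (1 - l)" using assms by (simp flip: powr_add)
  also have "\<dots> \<le> a powr l * b powr (1 - l)" using assms by (intro mult_mono powr_mono2) auto
  finally show ?thesis .
qed simp

text \<open>
  Interpolation: the difference is of order \<open>\<delta>\<close> uniformly and, with \<open>\<theta>\<close> halfway between \<open>\<gamma>\<close> and 1, of
  order \<open>|\<alpha> - \<beta>|\<close> to the power \<open>\<theta>\<close>. The geometric mean with weight \<open>\<gamma>/\<theta>\<close> keeps the exponent \<open>\<gamma>\<close> in the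
  parameter and leaves a positive power of \<open>\<delta>\<close>. It avoids second differences of the kernel.
\<close>

lemma tangent_op_diff_holder:
  assumes \<gamma>: "0 < \<gamma>" "\<gamma> < 1"
  obtains C \<mu> where "0 \<le> C" "0 < \<mu>" "\<mu> \<le> 1"
    "\<And>z w \<delta> \<alpha> \<beta>. \<lbrakk>regular c A z; regular c A w; \<And>\<alpha>. norm (z \<alpha> - w \<alpha>) \<le> \<delta>; \<And>\<alpha>. norm (dcurve z \<alpha> - dcurve w \<alpha>) \<le> \<delta>\<rbrakk> \<Longrightarrow>
       norm ((tangent_op z \<alpha> - tangent_op w \<alpha>) - (tangent_op z \<beta> - tangent_op w \<beta>)) \<le> C * \<delta> powr \<mu> * \<bar>\<alpha> - \<beta>\<bar> powr \<gamma>"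
proof -
  define \<theta> where "\<theta> = (1 + \<gamma>) / 2"
  have \<theta>: "0 < \<theta>" "\<theta> < 1" "\<gamma> < \<theta>" using \<gamma> by (auto simp: \<theta>_def)
  define l where "l = \<gamma> / \<theta>"
  have l: "0 < l" "l < 1" using \<theta> \<gamma> by (auto simp: l_def)
  obtain H where H: "0 \<le> H" "\<And>z \<alpha> \<alpha>'. regular c A z \<Longrightarrow> norm (tangent_op z \<alpha> - tangent_op z \<alpha>') \<le> H * \<bar>\<alpha> - \<alpha>'\<bar> powr \<theta>"
    using tangent_op_holder[OF \<theta>(1,2), of c A] by blast
  obtain L where L: "0 \<le> L"
    "\<And>z w \<delta> \<alpha>. \<lbrakk>regular c A z; regular c A w; \<And>\<alpha>. norm (z \<alpha> - w \<alpha>) \<le> \<delta>; \<And>\<alpha>. norm (dcurve z \<alpha> - dcurve w \<alpha>) \<le> \<delta>\<rbrakk> \<Longrightarrow>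
       norm (vel z \<alpha> - vel w \<alpha>) \<le> L * \<delta> \<and> norm (tangent_op z \<alpha> - tangent_op w \<alpha>) \<le> L * \<delta>"
    using vel_lipschitz by blast
  show thesis
  proof
    show "0 \<le> (2 * H) powr l * (2 * L) powr (1 - l)" by simp
    show "0 < 1 - l" "1 - l \<le> 1" using l by auto
    fix z w \<delta> \<alpha> \<beta>
    assume z: "regular c A z" and w: "regular c A w"
      and \<delta>: "\<And>\<alpha>. norm (z \<alpha> - w \<alpha>) \<le> \<delta>" "\<And>\<alpha>. norm (dcurve z \<alpha> - dcurve w \<alpha>) \<le> \<delta>"
    have \<delta>0: "\<delta> \<ge> 0" using \<delta>(1) norm_ge_zero order_trans by blast
    let ?v = "(tangent_op z \<alpha> - tangent_op w \<alpha>) - (tangent_op z \<beta> - tangent_op w \<beta>)"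
    have g: "norm (tangent_op z a - tangent_op w a) \<le> L * \<delta>" for a using L(2)[OF z w \<delta>] by auto
    have 1: "norm ?v \<le> 2 * L * \<delta>"
      using norm_triangle_ineq4[of "tangent_op z \<alpha> - tangent_op w \<alpha>" "tangent_op z \<beta> - tangent_op w \<beta>"] g[of \<alpha>] g[of \<beta>] by linarith
    have "?v = (tangent_op z \<alpha> - tangent_op z \<beta>) - (tangent_op w \<alpha> - tangent_op w \<beta>)" by simp
    hence "norm ?v \<le> norm (tangent_op z \<alpha> - tangent_op z \<beta>) + norm (tangent_op w \<alpha> - tangent_op w \<beta>)" by (simp only: norm_triangle_ineq4)
    hence 2: "norm ?v \<le> 2 * H * \<bar>\<alpha> - \<beta>\<bar> powr \<theta>" using H(2)[OF z, of \<alpha> \<beta>] H(2)[OF w, of \<alpha> \<beta>] by linarith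
    have "norm ?v \<le> (2 * H * \<bar>\<alpha> - \<beta>\<bar> powr \<theta>) powr l * (2 * L * \<delta>) powr (1 - l)"
      using l by (intro le_interpolate 1 2) auto
    also have "(2 * H * \<bar>\<alpha> - \<beta>\<bar> powr \<theta>) powr l = (2 * H) powr l * \<bar>\<alpha> - \<beta>\<bar> powr \<gamma>"
      using H(1) \<theta> by (simp add: powr_mult powr_powr l_def)
    also have "(2 * L * \<delta>) powr (1 - l) = (2 * L) powr (1 - l) * \<delta> powr (1 - l)"
      using L(1) \<delta>0 by (simp add: powr_mult)
    finally show "norm ?v \<le> (2 * H) powr l * (2 * L) powr (1 - l) * \<delta> powr (1 - l) * \<bar>\<alpha> - \<beta>\<bar> powr \<gamma>"
      by (simp only: mult_ac)
  qed
qed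

lemma product_second_diff:
  fixes M1 M2 N1 N2 :: "real^2^2"
  shows "(M1 *v perp p1 - N1 *v perp q1) - (M2 *v perp p2 - N2 *v perp q2) =
    ((M1 - N1) - (M2 - N2)) *v perp p1 + (M2 - N2) *v perp (p1 - p2)
    + (N1 - N2) *v perp (p1 - q1) + N2 *v perp ((p1 - q1) - (p2 - q2))"
  by (simp add: perp_diff bounded_bilinear.diff_left[OF bounded_bilinear_matrix_vector]
      bounded_bilinear.diff_right[OF bounded_bilinear_matrix_vector])

lemma dvel_diff_holder:
  assumes \<gamma>: "0 < \<gamma>" "\<gamma> < 1"
  obtains C \<mu> where "0 \<le> C" "0 < \<mu>" "\<mu> \<le> 1"
    "\<And>z w \<delta> k e \<alpha> \<beta>. \<lbrakk>regular c A z; regular c A w; \<And>\<alpha>. norm (z \<alpha> - w \<alpha>) \<le> \<delta>; \<And>\<alpha>. norm (dcurve z \<alpha> - dcurve w \<alpha>) \<le> \<delta>;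
        norm (dcurve z \<alpha> - dcurve z \<beta>) \<le> k * \<bar>\<alpha> - \<beta>\<bar> powr \<gamma>;
        norm ((dcurve z \<alpha> - dcurve w \<alpha>) - (dcurve z \<beta> - dcurve w \<beta>)) \<le> e * \<bar>\<alpha> - \<beta>\<bar> powr \<gamma>; 0 \<le> k; 0 \<le> e\<rbrakk> \<Longrightarrow>
       norm ((dvel z \<alpha> - dvel w \<alpha>) - (dvel z \<beta> - dvel w \<beta>)) \<le> C * (\<delta> powr \<mu> + \<delta> * k + \<delta> + e) * \<bar>\<alpha> - \<beta>\<bar> powr \<gamma>"
proof -
  obtain H where H: "0 \<le> H" "\<And>z \<alpha> \<alpha>'. regular c A z \<Longrightarrow> norm (tangent_op z \<alpha> - tangent_op z \<alpha>') \<le> H * \<bar>\<alpha> - \<alpha>'\<bar> powr \<gamma>"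
    using tangent_op_holder[OF \<gamma>, of c A] by blast
  obtain L where L: "0 \<le> L"
    "\<And>z w \<delta> \<alpha>. \<lbrakk>regular c A z; regular c A w; \<And>\<alpha>. norm (z \<alpha> - w \<alpha>) \<le> \<delta>; \<And>\<alpha>. norm (dcurve z \<alpha> - dcurve w \<alpha>) \<le> \<delta>\<rbrakk> \<Longrightarrow>
       norm (vel z \<alpha> - vel w \<alpha>) \<le> L * \<delta> \<and> norm (tangent_op z \<alpha> - tangent_op w \<alpha>) \<le> L * \<delta>"
    using vel_lipschitz by blast
  obtain G where G: "0 \<le> G" "\<And>z \<alpha>. regular c A z \<Longrightarrow> norm (tangent_op z \<alpha>) \<le> G" using tangent_op_bounded by blast
  obtain D \<mu> where D: "0 \<le> D" "0 < \<mu>" "\<mu> \<le> 1"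
    "\<And>z w \<delta> \<alpha> \<beta>. \<lbrakk>regular c A z; regular c A w; \<And>\<alpha>. norm (z \<alpha> - w \<alpha>) \<le> \<delta>; \<And>\<alpha>. norm (dcurve z \<alpha> - dcurve w \<alpha>) \<le> \<delta>\<rbrakk> \<Longrightarrow>
       norm ((tangent_op z \<alpha> - tangent_op w \<alpha>) - (tangent_op z \<beta> - tangent_op w \<beta>)) \<le> D * \<delta> powr \<mu> * \<bar>\<alpha> - \<beta>\<bar> powr \<gamma>"
    using tangent_op_diff_holder[OF \<gamma>, of c A] by blast
  define C where "C = D * \<bar>A\<bar> + L + H + G"
  show thesis
  proof (rule that[of C \<mu>])
    show "0 \<le> C" using D L H G by (simp add: C_def)
    show "0 < \<mu>" "\<mu> \<le> 1" by (fact D)+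
    fix z w \<delta> k e \<alpha> \<beta>
    assume z: "regular c A z" and w: "regular c A w"
      and \<delta>: "\<And>\<alpha>. norm (z \<alpha> - w \<alpha>) \<le> \<delta>" "\<And>\<alpha>. norm (dcurve z \<alpha> - dcurve w \<alpha>) \<le> \<delta>"
      and k: "norm (dcurve z \<alpha> - dcurve z \<beta>) \<le> k * \<bar>\<alpha> - \<beta>\<bar> powr \<gamma>"
      and e: "norm ((dcurve z \<alpha> - dcurve w \<alpha>) - (dcurve z \<beta> - dcurve w \<beta>)) \<le> e * \<bar>\<alpha> - \<beta>\<bar> powr \<gamma>"
      and ke: "0 \<le> k" "0 \<le> e"
    let ?d = "\<bar>\<alpha> - \<beta>\<bar> powr \<gamma>"
    have \<delta>0: "\<delta> \<ge> 0" using \<delta>(1) norm_ge_zero order_trans by blast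
    have A: "0 \<le> A" by (rule regularD(7)[OF z])
    have g: "norm (tangent_op z \<beta> - tangent_op w \<beta>) \<le> L * \<delta>" using L(2)[OF z w \<delta>] by auto
    define T1 T2 T3 T4 where
      "T1 = ((tangent_op z \<alpha> - tangent_op w \<alpha>) - (tangent_op z \<beta> - tangent_op w \<beta>)) *v perp (dcurve z \<alpha>)" and
      "T2 = (tangent_op z \<beta> - tangent_op w \<beta>) *v perp (dcurve z \<alpha> - dcurve z \<beta>)" and
      "T3 = (tangent_op w \<alpha> - tangent_op w \<beta>) *v perp (dcurve z \<alpha> - dcurve w \<alpha>)" and
      "T4 = tangent_op w \<beta> *v perp ((dcurve z \<alpha> - dcurve w \<alpha>) - (dcurve z \<beta> - dcurve w \<beta>))"
    have "norm T1 \<le> (D * \<delta> powr \<mu> * ?d) * A" unfolding T1_def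
      by (rule norm_mv_perp_le[OF D(4)[OF z w \<delta>] regularD(5)[OF z]])
    moreover have "norm T2 \<le> (L * \<delta>) * (k * ?d)" unfolding T2_def by (rule norm_mv_perp_le[OF g k])
    moreover have "norm T3 \<le> (H * ?d) * \<delta>" unfolding T3_def by (rule norm_mv_perp_le[OF H(2)[OF w] \<delta>(2)])
    moreover have "norm T4 \<le> G * (e * ?d)" unfolding T4_def by (rule norm_mv_perp_le[OF G(2)[OF w] e])
    moreover have "norm (T1 + T2 + T3 + T4) \<le> norm T1 + norm T2 + norm T3 + norm T4"
      using norm_triangle_ineq[of "T1 + T2 + T3" T4] norm_triangle3[of T1 T2 T3] by linarith
    moreover have "(dvel z \<alpha> - dvel w \<alpha>) - (dvel z \<beta> - dvel w \<beta>) = T1 + T2 + T3 + T4"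
      unfolding dvel_def T1_def T2_def T3_def T4_def by (rule product_second_diff)
    ultimately have n: "norm ((dvel z \<alpha> - dvel w \<alpha>) - (dvel z \<beta> - dvel w \<beta>)) \<le>
       (D * \<delta> powr \<mu> * ?d) * A + (L * \<delta>) * (k * ?d) + (H * ?d) * \<delta> + G * (e * ?d)" by (simp only:)
    also have "\<dots> = ((D * A) * \<delta> powr \<mu> + L * (\<delta> * k) + H * \<delta> + G * e) * ?d" by (simp add: algebra_simps)
    also have "\<dots> \<le> (C * \<delta> powr \<mu> + C * (\<delta> * k) + C * \<delta> + C * e) * ?d"
      using D L H G A \<delta>0 ke by (intro mult_right_mono add_mono) (auto simp: C_def)
    also have "\<dots> = C * (\<delta> powr \<mu> + \<delta> * k + \<delta> + e) * ?d" by (simp only: distrib_left)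
    finally show "norm ((dvel z \<alpha> - dvel w \<alpha>) - (dvel z \<beta> - dvel w \<beta>)) \<le> C * (\<delta> powr \<mu> + \<delta> * k + \<delta> + e) * ?d" .
  qed
qed

section \<open>Existence in C1\<close>

instance bcontfun :: (metric_space, banach) banach ..

text \<open>
  A perturbation of the initial curve and its derivative, as independent functions. The
  compatibility of the two is the closed linear condition \<open>C1_periodic\<close>, so that the \<open>C\<^sup>1\<close> norm becomes
  a norm on a product of spaces of bounded continuous functions.
\<close>

type_synonym C1_pair = "(real \<Rightarrow>\<^sub>C (real^2)) \<times> (real \<Rightarrow>\<^sub>C (real^2))"

definition C1_periodic :: "C1_pair set" where
  "C1_periodic = {u. periodic (apply_bcontfun (fst u)) \<and>
     (\<forall>\<alpha>. (apply_bcontfun (fst u) has_vector_derivative apply_bcontfun (snd u) \<alpha>) (at \<alpha>))}"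

lemma subspace_C1_periodic: "subspace C1_periodic"
  unfolding subspace_def C1_periodic_def
  by (auto simp: periodic_def plus_bcontfun.rep_eq scaleR_bcontfun.rep_eq
      intro!: derivative_eq_intros has_vector_derivative_add bounded_linear.has_vector_derivative[OF bounded_linear_scaleR_right])

lemma closed_C1_periodic: "closed C1_periodic"
  unfolding closed_sequential_limits
proof (intro allI impI, elim conjE)
  fix x :: "nat \<Rightarrow> C1_pair" and l assume x: "\<forall>n. x n \<in> C1_periodic" and lim: "x \<longlonglongrightarrow> l"
  let ?f = "\<lambda>n. apply_bcontfun (fst (x n))" and ?g = "\<lambda>n. apply_bcontfun (snd (x n))"
  have d1: "norm (apply_bcontfun (fst (x n)) a - apply_bcontfun (fst l) a) \<le> dist (x n) l" for n a
    using dist_bounded[of "fst (x n)" a "fst l"] dist_fst_le[of "x n" l]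
    by (simp add: dist_norm)
  have d2: "norm (apply_bcontfun (snd (x n)) a - apply_bcontfun (snd l) a) \<le> dist (x n) l" for n a
    using dist_bounded[of "snd (x n)" a "snd l"] dist_snd_le[of "x n" l] by (simp add: dist_norm)
  have dl: "(\<lambda>n. dist (x n) l) \<longlonglongrightarrow> 0" using lim by (rule tendsto_dist_iff[THEN iffD1])
  have pw: "(\<lambda>n. ?f n a) \<longlonglongrightarrow> apply_bcontfun (fst l) a" for a
    by (rule LIM_zero_cancel, rule Lim_null_comparison[OF _ dl]) (use d1 in \<open>auto intro: always_eventually\<close>)
  have "periodic (apply_bcontfun (fst l))"
    unfolding periodic_def
  proof (intro allI)
    fix a and k :: int
    have "?f n (a + 2 * pi * of_int k) = ?f n a" for n using x by (auto simp: C1_periodic_def periodic_def)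
    hence "(\<lambda>n. ?f n a) \<longlonglongrightarrow> apply_bcontfun (fst l) (a + 2 * pi * of_int k)" using pw[of "a + 2 * pi * of_int k"] by simp
    thus "apply_bcontfun (fst l) (a + 2 * pi * of_int k) = apply_bcontfun (fst l) a" using LIMSEQ_unique pw by blast
  qed
  moreover have "\<exists>g. \<forall>a\<in>UNIV. (\<lambda>n. ?f n a) \<longlonglongrightarrow> g a \<and> (g has_derivative (\<lambda>h. h *\<^sub>R apply_bcontfun (snd l) a)) (at a within UNIV)"
  proof (rule has_derivative_sequence)
    show "convex (UNIV::real set)" "0 \<in> (UNIV::real set)" by auto
    show "(\<lambda>n. ?f n 0) \<longlonglongrightarrow> apply_bcontfun (fst l) 0" by (rule pw)
    show "(?f n has_derivative (\<lambda>h. h *\<^sub>R ?g n a)) (at a within UNIV)" for n a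
      using x by (auto simp: C1_periodic_def has_vector_derivative_def)
    fix \<epsilon> :: real assume "0 < \<epsilon>"
    hence "\<forall>\<^sub>F n in sequentially. dist (x n) l < \<epsilon>" using dl by (rule order_tendstoD(2)[rotated])
    thus "\<forall>\<^sub>F n in sequentially. \<forall>a\<in>UNIV. \<forall>h. norm (h *\<^sub>R ?g n a - h *\<^sub>R apply_bcontfun (snd l) a) \<le> \<epsilon> * norm h"
    proof eventually_elim
      case (elim n)
      have "norm (h *\<^sub>R ?g n a - h *\<^sub>R apply_bcontfun (snd l) a) \<le> \<epsilon> * norm h" for a h
      proof -
        have "norm (?g n a - apply_bcontfun (snd l) a) \<le> \<epsilon>" using d2[of n a] elim by linarith
        hence "\<bar>h\<bar> * norm (?g n a - apply_bcontfun (snd l) a) \<le> \<bar>h\<bar> * \<epsilon>" by (intro mult_left_mono) auto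
        thus ?thesis unfolding scaleR_diff_right[symmetric] norm_scaleR by (simp add: mult.commute)
      qed
      thus ?case by blast
    qed
  qed
  then obtain g where g: "\<And>a. (\<lambda>n. ?f n a) \<longlonglongrightarrow> g a" "\<And>a. (g has_derivative (\<lambda>h. h *\<^sub>R apply_bcontfun (snd l) a)) (at a)" by auto
  have "g = apply_bcontfun (fst l)" using LIMSEQ_unique[OF g(1) pw] by auto
  hence "(apply_bcontfun (fst l) has_vector_derivative apply_bcontfun (snd l) a) (at a)" for a
    using g(2) by (simp add: has_vector_derivative_def)
  ultimately show "l \<in> C1_periodic" by (simp add: C1_periodic_def)
qed

definition curve_of :: "(real \<Rightarrow> real^2) \<Rightarrow> C1_pair \<Rightarrow> real \<Rightarrow> real^2" where
  "curve_of z0 u \<alpha> = z0 \<alpha> + apply_bcontfun (fst u) \<alpha>"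

lemma curve_of_C1:
  assumes "z0 C1_differentiable_on UNIV" "u \<in> C1_periodic"
  shows "curve_of z0 u C1_differentiable_on UNIV" "dcurve (curve_of z0 u) \<alpha> = dcurve z0 \<alpha> + apply_bcontfun (snd u) \<alpha>"
proof -
  have d: "(curve_of z0 u has_vector_derivative (dcurve z0 \<alpha> + apply_bcontfun (snd u) \<alpha>)) (at \<alpha>)" for \<alpha>
    unfolding curve_of_def[abs_def] using assms(2)
    by (intro has_vector_derivative_add C1_onD(1)[OF assms(1)]) (auto simp: C1_periodic_def)
  have c: "continuous_on UNIV (\<lambda>\<alpha>. dcurve z0 \<alpha> + apply_bcontfun (snd u) \<alpha>)"
    by (intro continuous_on_add C1_onD(2)[OF assms(1)] continuous_on_apply_bcontfun)
  show "curve_of z0 u C1_differentiable_on UNIV" by (rule C1_onI(1)[OF d c])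
  show "dcurve (curve_of z0 u) \<alpha> = dcurve z0 \<alpha> + apply_bcontfun (snd u) \<alpha>" by (rule vector_derivative_at[OF d])
qed

definition velocity_field :: "real \<Rightarrow> (real \<Rightarrow> real^2) \<Rightarrow> C1_pair \<Rightarrow> C1_pair" where
  "velocity_field \<kappa> z0 u = (Bcontfun (\<lambda>\<alpha>. \<kappa> *\<^sub>R vel (curve_of z0 u) \<alpha>), Bcontfun (\<lambda>\<alpha>. \<kappa> *\<^sub>R dvel (curve_of z0 u) \<alpha>))"

lemma velocity_field_apply:
  assumes "regular c A (curve_of z0 u)"
  shows "apply_bcontfun (fst (velocity_field \<kappa> z0 u)) = (\<lambda>\<alpha>. \<kappa> *\<^sub>R vel (curve_of z0 u) \<alpha>)"
    "apply_bcontfun (snd (velocity_field \<kappa> z0 u)) = (\<lambda>\<alpha>. \<kappa> *\<^sub>R dvel (curve_of z0 u) \<alpha>)"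
proof -
  obtain V where V: "0 \<le> V" "\<And>z \<alpha>. regular c A z \<Longrightarrow> norm (vel z \<alpha>) \<le> V" "\<And>z \<alpha>. regular c A z \<Longrightarrow> norm (dvel z \<alpha>) \<le> V"
    using vel_dvel_bounded by blast
  show "apply_bcontfun (fst (velocity_field \<kappa> z0 u)) = (\<lambda>\<alpha>. \<kappa> *\<^sub>R vel (curve_of z0 u) \<alpha>)"
    unfolding velocity_field_def fst_conv
    by (intro Bcontfun_inverse bcontfun_normI[where b = "\<bar>\<kappa>\<bar> * V"] continuous_on_scaleR continuous_on_const C1_onD(3)[OF vel_C1(1)[OF assms]])
      (simp add: mult_left_mono V(2)[OF assms])
  show "apply_bcontfun (snd (velocity_field \<kappa> z0 u)) = (\<lambda>\<alpha>. \<kappa> *\<^sub>R dvel (curve_of z0 u) \<alpha>)"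
    unfolding velocity_field_def snd_conv
    by (intro Bcontfun_inverse bcontfun_normI[where b = "\<bar>\<kappa>\<bar> * V"] continuous_on_scaleR continuous_on_const dvel_continuous[OF assms])
      (simp add: mult_left_mono V(3)[OF assms])
qed

lemma norm_C1_pair_le:
  fixes u :: C1_pair
  assumes "\<And>\<alpha>. norm (apply_bcontfun (fst u) \<alpha>) \<le> a" "\<And>\<alpha>. norm (apply_bcontfun (snd u) \<alpha>) \<le> b"
  shows "norm u \<le> a + b"
proof -
  have "norm u \<le> norm (fst u) + norm (snd u)" using norm_Pair_le[of "fst u" "snd u"] by simp
  thus ?thesis using norm_bound[of "fst u" a] norm_bound[of "snd u" b] assms by fastforce
qed

lemma C1_pair_le_norm:
  fixes u :: C1_pair
  shows "norm (apply_bcontfun (fst u) \<alpha>) \<le> norm u" "norm (apply_bcontfun (snd u) \<alpha>) \<le> norm u"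
  using norm_bounded[of "fst u" \<alpha>] norm_bounded[of "snd u" \<alpha>] norm_fst_le[of "fst u" "snd u"] norm_snd_le[of "snd u" "fst u"]
  by (auto intro: order_trans)

text \<open>
  The upper bound \<open>T0\<close> on the time of existence is free, so that later steps can impose smallness
  conditions on it.
\<close>

theorem C1_solution_exists:
  assumes z0: "regular c A z0" and T0: "0 < T0"
  obtains T z V where "0 < T" "T \<le> T0" "z 0 = z0" "0 \<le> V"
    "\<And>t. regular (c/2) (A+1) (z t)"
    "\<And>t \<alpha>. t \<in> {-T..T} \<Longrightarrow> ((\<lambda>t. z t \<alpha>) has_vector_derivative \<kappa> *\<^sub>R vel (z t) \<alpha>) (at t within {-T..T})"
    "\<And>t \<alpha>. t \<in> {-T..T} \<Longrightarrow> ((\<lambda>t. dcurve (z t) \<alpha>) has_vector_derivative \<kappa> *\<^sub>R dvel (z t) \<alpha>) (at t within {-T..T})"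
    "\<And>t \<alpha>. norm (\<kappa> *\<^sub>R vel (z t) \<alpha>) \<le> V" "\<And>t \<alpha>. norm (\<kappa> *\<^sub>R dvel (z t) \<alpha>) \<le> V"
proof -
  note z0D = regularD[OF z0]
  let ?F = "velocity_field \<kappa> z0"
  obtain r where r: "0 < r"
    "\<And>w. \<lbrakk>horizontally_periodic w; w C1_differentiable_on UNIV; \<And>\<alpha>. norm (w \<alpha> - z0 \<alpha>) \<le> r;
       \<And>\<alpha>. norm (dcurve w \<alpha> - dcurve z0 \<alpha>) \<le> r\<rbrakk> \<Longrightarrow> regular (c/2) (A+1) w"
    using regular_stability[OF z0] by blast
  have reg: "regular (c/2) (A+1) (curve_of z0 u)" if u: "u \<in> C1_periodic" "norm u \<le> r" for u
  proof (rule r(2))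
    show "horizontally_periodic (curve_of z0 u)"
      unfolding curve_of_def[abs_def] using u(1) by (intro hp_add_periodic z0D(2)) (auto simp: C1_periodic_def)
    show "curve_of z0 u C1_differentiable_on UNIV" by (rule curve_of_C1(1)[OF z0D(3) u(1)])
    show "norm (curve_of z0 u \<alpha> - z0 \<alpha>) \<le> r" for \<alpha>
      using C1_pair_le_norm(1)[of u \<alpha>] u(2) by (simp add: curve_of_def)
    show "norm (dcurve (curve_of z0 u) \<alpha> - dcurve z0 \<alpha>) \<le> r" for \<alpha>
      using C1_pair_le_norm(2)[of u \<alpha>] u(2) by (simp add: curve_of_C1(2)[OF z0D(3) u(1)])
  qed
  obtain V where V: "0 \<le> V" "\<And>z \<alpha>. regular (c/2) (A+1) z \<Longrightarrow> norm (vel z \<alpha>) \<le> V"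
     "\<And>z \<alpha>. regular (c/2) (A+1) z \<Longrightarrow> norm (dvel z \<alpha>) \<le> V"
    using vel_dvel_bounded by blast
  obtain C where C: "0 \<le> C"
    "\<And>z w \<delta> \<alpha>. \<lbrakk>regular (c/2) (A+1) z; regular (c/2) (A+1) w; \<And>\<alpha>. norm (z \<alpha> - w \<alpha>) \<le> \<delta>; \<And>\<alpha>. norm (dcurve z \<alpha> - dcurve w \<alpha>) \<le> \<delta>\<rbrakk> \<Longrightarrow>
       norm (vel z \<alpha> - vel w \<alpha>) \<le> C * \<delta> \<and> norm (dvel z \<alpha> - dvel w \<alpha>) \<le> C * \<delta>"
    using vel_dvel_lipschitz by blast
  define M where "M = \<bar>\<kappa>\<bar> * V"
  define L where "L = 2 * (\<bar>\<kappa>\<bar> * C)"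
  have MandL: "0 \<le> M" "0 \<le> L" using V(1) C(1) by (auto simp: M_def L_def)
  have vb: "norm (\<kappa> *\<^sub>R vel (curve_of z0 u) \<alpha>) \<le> M" "norm (\<kappa> *\<^sub>R dvel (curve_of z0 u) \<alpha>) \<le> M"
    if "u \<in> C1_periodic" "norm u \<le> r" for u \<alpha>
    unfolding M_def norm_scaleR by (intro mult_left_mono V(2,3)[OF reg[OF that]]; simp)+
  have FE: "?F u \<in> C1_periodic" if u: "u \<in> C1_periodic" "norm u \<le> r" for u
  proof -
    note R = reg[OF u]
    have "periodic (\<lambda>\<alpha>. \<kappa> *\<^sub>R vel (curve_of z0 u) \<alpha>)"
      using vel_periodic[OF regularD(2)[OF R]] by (simp add: periodic_def)
    moreover have "((\<lambda>\<alpha>. \<kappa> *\<^sub>R vel (curve_of z0 u) \<alpha>) has_vector_derivative \<kappa> *\<^sub>R dvel (curve_of z0 u) \<alpha>) (at \<alpha>)" for \<alpha>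
      by (intro bounded_linear.has_vector_derivative[OF bounded_linear_scaleR_right] vel_C1(3)[OF R])
    ultimately show ?thesis unfolding C1_periodic_def velocity_field_apply[OF R] mem_Collect_eq by blast
  qed
  have FM: "norm (?F u) \<le> M + M" if u: "u \<in> C1_periodic" "norm u \<le> r" for u
    by (rule norm_C1_pair_le) (simp_all only: velocity_field_apply[OF reg[OF u]] vb[OF u])
  have FL: "norm (?F u - ?F v) \<le> L * norm (u - v)"
    if u: "u \<in> C1_periodic" "norm u \<le> r" and v: "v \<in> C1_periodic" "norm v \<le> r" for u v
  proof -
    have 1: "norm (curve_of z0 u \<alpha> - curve_of z0 v \<alpha>) \<le> norm (u - v)" for \<alpha>
      using C1_pair_le_norm(1)[of "u - v" \<alpha>] by (simp add: curve_of_def minus_bcontfun.rep_eq)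
    have 2: "norm (dcurve (curve_of z0 u) \<alpha> - dcurve (curve_of z0 v) \<alpha>) \<le> norm (u - v)" for \<alpha>
      using C1_pair_le_norm(2)[of "u - v" \<alpha>]
      by (simp add: curve_of_C1(2)[OF z0D(3) u(1)] curve_of_C1(2)[OF z0D(3) v(1)] minus_bcontfun.rep_eq)
    note l = C(2)[OF reg[OF u] reg[OF v] 1 2]
    have "norm (?F u - ?F v) \<le> \<bar>\<kappa>\<bar> * (C * norm (u - v)) + \<bar>\<kappa>\<bar> * (C * norm (u - v))"
    proof (rule norm_C1_pair_le)
      fix \<alpha>
      show "norm (apply_bcontfun (fst (?F u - ?F v)) \<alpha>) \<le> \<bar>\<kappa>\<bar> * (C * norm (u - v))"
        unfolding fst_diff minus_bcontfun.rep_eq velocity_field_apply[OF reg[OF u]] velocity_field_apply[OF reg[OF v]]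
          scaleR_diff_right[symmetric] norm_scaleR using l by (intro mult_left_mono) auto
      show "norm (apply_bcontfun (snd (?F u - ?F v)) \<alpha>) \<le> \<bar>\<kappa>\<bar> * (C * norm (u - v))"
        unfolding snd_diff minus_bcontfun.rep_eq velocity_field_apply[OF reg[OF u]] velocity_field_apply[OF reg[OF v]]
          scaleR_diff_right[symmetric] norm_scaleR using l by (intro mult_left_mono) auto
    qed
    thus ?thesis by (simp only: L_def mult_2 distrib_right mult.assoc)
  qed
  define T where "T = min T0 (min (r / (M + M + 1)) (1 / (2 * (L + 1))))"
  have T: "0 < T" "T \<le> T0" using T0 r(1) MandL by (auto simp: T_def)
  have TM: "T * (M + M) \<le> r"
  proof -
    have "T * (M + M) \<le> (r / (M + M + 1)) * (M + M)" using MandL by (intro mult_right_mono) (auto simp: T_def)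
    also have "\<dots> \<le> r" using MandL r(1) by (simp add: field_simps)
    finally show ?thesis .
  qed
  have TL: "T * L \<le> 1/2"
  proof -
    have "T * L \<le> (1 / (2 * (L + 1))) * L" using MandL by (intro mult_right_mono) (auto simp: T_def)
    also have "\<dots> \<le> 1/2" using MandL by (simp add: field_simps)
    finally show ?thesis .
  qed
  obtain u where u: "u 0 = 0" "\<And>t. u t \<in> C1_periodic" "\<And>t. norm (u t) \<le> r"
    "\<And>t. t \<in> {-T..T} \<Longrightarrow> (u has_vector_derivative ?F (u t)) (at t within {-T..T})"
  proof (rule picard_lindelof_subspace[where F = ?F and E = C1_periodic and r = r and M = "M + M" and L = L and T = T])
    show "subspace C1_periodic" "closed C1_periodic" by (rule subspace_C1_periodic closed_C1_periodic)+
    show "0 < T" "T * (M + M) \<le> r" "T * L \<le> 1/2" "0 \<le> L" by (fact T(1) TM TL MandL(2))+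
    show "0 \<le> r" using r(1) by simp
  qed (blast intro: FE FM FL)+
  define z where "z t = curve_of z0 (u t)" for t
  have R: "regular (c/2) (A+1) (curve_of z0 (u t))" for t by (rule reg[OF u(2,3)])
  have ap: "bounded_linear (\<lambda>f :: real \<Rightarrow>\<^sub>C (real^2). apply_bcontfun f \<alpha>)" for \<alpha>
    by (rule bounded_linear_intro[where K = 1]) (auto simp: plus_bcontfun.rep_eq scaleR_bcontfun.rep_eq norm_bounded)
  have ap1: "bounded_linear (\<lambda>u :: C1_pair. apply_bcontfun (fst u) \<alpha>)" for \<alpha>
    by (rule bounded_linear_compose[OF ap bounded_linear_fst])
  have ap2: "bounded_linear (\<lambda>u :: C1_pair. apply_bcontfun (snd u) \<alpha>)" for \<alpha>
    by (rule bounded_linear_compose[OF ap bounded_linear_snd])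
  have zd: "dcurve (z t) \<alpha> = dcurve z0 \<alpha> + apply_bcontfun (snd (u t)) \<alpha>" for t \<alpha>
    unfolding z_def by (rule curve_of_C1(2)[OF z0D(3) u(2)])
  show thesis
  proof (rule that[OF T])
    show "z 0 = z0" by (auto simp: z_def curve_of_def u(1))
    show "0 \<le> M" by (rule MandL)
    show "regular (c/2) (A+1) (z t)" for t unfolding z_def by (rule R)
    show "norm (\<kappa> *\<^sub>R vel (z t) \<alpha>) \<le> M" "norm (\<kappa> *\<^sub>R dvel (z t) \<alpha>) \<le> M" for t \<alpha>
      unfolding z_def by (rule vb[OF u(2,3)])+
    fix t \<alpha> assume t: "t \<in> {-T..T}"
    have "((\<lambda>t. apply_bcontfun (fst (u t)) \<alpha>) has_vector_derivative \<kappa> *\<^sub>R vel (z t) \<alpha>) (at t within {-T..T})"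
      using bounded_linear.has_vector_derivative[OF ap1 u(4)[OF t]] velocity_field_apply(1)[OF R[of t], of \<kappa>]
      by (simp add: z_def)
    thus "((\<lambda>t. z t \<alpha>) has_vector_derivative \<kappa> *\<^sub>R vel (z t) \<alpha>) (at t within {-T..T})"
      unfolding z_def curve_of_def[of z0 "u _" \<alpha>] by (auto intro!: derivative_eq_intros)
    have "((\<lambda>t. apply_bcontfun (snd (u t)) \<alpha>) has_vector_derivative \<kappa> *\<^sub>R dvel (z t) \<alpha>) (at t within {-T..T})"
      using bounded_linear.has_vector_derivative[OF ap2 u(4)[OF t]] velocity_field_apply(2)[OF R[of t], of \<kappa>]
      by (simp add: z_def)
    thus "((\<lambda>t. dcurve (z t) \<alpha>) has_vector_derivative \<kappa> *\<^sub>R dvel (z t) \<alpha>) (at t within {-T..T})"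
      unfolding zd by (auto intro!: derivative_eq_intros)
  qed
qed

section \<open>Existence in the Hoelder class\<close>

lemma stokes_velocity_eq: "stokes_velocity \<rho>p \<rho>m z \<alpha> = (\<rho>m - \<rho>p) *\<^sub>R vel z \<alpha>"
  by (simp only: stokes_velocity_def vel_def)

lemma scaled_vel_C1:
  assumes "regular c A z"
  shows "(\<lambda>\<alpha>. \<kappa> *\<^sub>R vel z \<alpha>) C1_differentiable_on UNIV" "dcurve (\<lambda>\<alpha>. \<kappa> *\<^sub>R vel z \<alpha>) \<alpha> = \<kappa> *\<^sub>R dvel z \<alpha>"
proof -
  have d: "((\<lambda>\<alpha>. \<kappa> *\<^sub>R vel z \<alpha>) has_vector_derivative \<kappa> *\<^sub>R dvel z \<alpha>) (at \<alpha>)" for \<alpha>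
    by (intro bounded_linear.has_vector_derivative[OF bounded_linear_scaleR_right] vel_C1(3)[OF assms])
  have c: "continuous_on UNIV (\<lambda>\<alpha>. \<kappa> *\<^sub>R dvel z \<alpha>)"
    by (intro continuous_on_scaleR continuous_on_const dvel_continuous[OF assms])
  show "(\<lambda>\<alpha>. \<kappa> *\<^sub>R vel z \<alpha>) C1_differentiable_on UNIV" by (rule C1_onI(1)[OF d c])
  show "dcurve (\<lambda>\<alpha>. \<kappa> *\<^sub>R vel z \<alpha>) \<alpha> = \<kappa> *\<^sub>R dvel z \<alpha>" by (rule vector_derivative_at[OF d])
qed

lemma abs_powr_tendsto_0:
  fixes t C \<mu> :: real assumes "0 < \<mu>" shows "((\<lambda>s. C * \<bar>s - t\<bar> powr \<mu>) \<longlongrightarrow> 0) (at t)"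
proof -
  have "((\<lambda>s. \<bar>s - t\<bar>) \<longlongrightarrow> \<bar>t - t\<bar>) (at t)" by (intro tendsto_intros)
  hence "((\<lambda>s. \<bar>s - t\<bar> powr \<mu>) \<longlongrightarrow> \<bar>t - t\<bar> powr \<mu>) (at t)"
    by (rule tendsto_powr2[OF _ tendsto_const]) (use assms in auto)
  hence "((\<lambda>s. C * \<bar>s - t\<bar> powr \<mu>) \<longlongrightarrow> C * \<bar>t - t\<bar> powr \<mu>) (at t)" by (rule tendsto_mult_left)
  thus ?thesis using assms by simp
qed

lemma mean_value_within:
  fixes g :: "real \<Rightarrow> 'a::real_normed_vector"
  assumes "convex S" "\<And>x. x \<in> S \<Longrightarrow> (g has_vector_derivative g' x) (at x within S)" "\<And>x. x \<in> S \<Longrightarrow> norm (g' x) \<le> B"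
    and "x \<in> S" "y \<in> S"
  shows "norm (g x - g y) \<le> B * \<bar>x - y\<bar>"
proof -
  have "norm (g x - g y) \<le> B * norm (x - y)"
  proof (rule differentiable_bound[OF assms(1) _ _ assms(4,5)])
    show "(g has_derivative (\<lambda>h. h *\<^sub>R g' x)) (at x within S)" if "x \<in> S" for x
      using assms(2)[OF that] by (simp add: has_vector_derivative_def)
    show "onorm (\<lambda>h. h *\<^sub>R g' x) \<le> B" if "x \<in> S" for x
      by (rule onorm_le) (use mult_left_mono[OF assms(3)[OF that] abs_ge_zero] in \<open>simp add: mult.commute\<close>)
  qed
  thus ?thesis by simp
qed

lemma difference_quotient_bound:
  fixes g :: "real \<Rightarrow> 'a::real_normed_vector"
  assumes d: "\<And>x. x \<in> closed_segment t (t + h) \<Longrightarrow> (g has_vector_derivative g' x) (at x)"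
    and b: "\<And>x. x \<in> closed_segment t (t + h) \<Longrightarrow> norm (g' x - g' t) \<le> B" and h: "h \<noteq> 0"
  shows "norm ((g (t + h) - g t) /\<^sub>R h - g' t) \<le> B"
proof -
  have "norm (g (t + h) - g t - (t + h - t) *\<^sub>R g' t) \<le> norm (t + h - t) * B"
    by (rule vector_differentiable_bound_linearization[where S = "closed_segment t (t + h)"])
      (use d b in \<open>auto intro: has_vector_derivative_at_within\<close>)
  hence n: "norm (g (t + h) - g t - h *\<^sub>R g' t) \<le> \<bar>h\<bar> * B" by simp
  have "(g (t + h) - g t) /\<^sub>R h - g' t = inverse h *\<^sub>R (g (t + h) - g t - h *\<^sub>R g' t)"
    using h by (simp add: scaleR_diff_right)
  hence "norm ((g (t + h) - g t) /\<^sub>R h - g' t) = inverse \<bar>h\<bar> * norm (g (t + h) - g t - h *\<^sub>R g' t)" by simp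
  also have "\<dots> \<le> inverse \<bar>h\<bar> * (\<bar>h\<bar> * B)" using n by (intro mult_left_mono) auto
  also have "\<dots> = B" using h by simp
  finally show ?thesis .
qed

lemma C1_difference_quotient:
  assumes "f C1_differentiable_on UNIV" "g C1_differentiable_on UNIV" "k C1_differentiable_on UNIV"
  shows "(\<lambda>\<alpha>. (f \<alpha> - g \<alpha>) /\<^sub>R h - k \<alpha>) C1_differentiable_on UNIV"
    "dcurve (\<lambda>\<alpha>. (f \<alpha> - g \<alpha>) /\<^sub>R h - k \<alpha>) \<alpha> = (dcurve f \<alpha> - dcurve g \<alpha>) /\<^sub>R h - dcurve k \<alpha>"
proof -
  have d: "((\<lambda>\<alpha>. (f \<alpha> - g \<alpha>) /\<^sub>R h - k \<alpha>) has_vector_derivative (dcurve f \<alpha> - dcurve g \<alpha>) /\<^sub>R h - dcurve k \<alpha>) (at \<alpha>)" for \<alpha>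
    by (intro has_vector_derivative_diff bounded_linear.has_vector_derivative[OF bounded_linear_scaleR_right] C1_onD(1) assms)
  have c: "continuous_on UNIV (\<lambda>\<alpha>. (dcurve f \<alpha> - dcurve g \<alpha>) /\<^sub>R h - dcurve k \<alpha>)"
    by (intro continuous_on_diff continuous_on_scaleR continuous_on_const C1_onD(2) assms)
  show "(\<lambda>\<alpha>. (f \<alpha> - g \<alpha>) /\<^sub>R h - k \<alpha>) C1_differentiable_on UNIV" by (rule C1_onI(1)[OF d c])
  show "dcurve (\<lambda>\<alpha>. (f \<alpha> - g \<alpha>) /\<^sub>R h - k \<alpha>) \<alpha> = (dcurve f \<alpha> - dcurve g \<alpha>) /\<^sub>R h - dcurve k \<alpha>"
    by (rule vector_derivative_at[OF d])
qed

lemma C1_holder_difference_quotient: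
  assumes "C1_holder \<gamma> f" "C1_holder \<gamma> g" "C1_holder \<gamma> k"
  shows "C1_holder \<gamma> (\<lambda>\<alpha>. (f \<alpha> - g \<alpha>) /\<^sub>R h - k \<alpha>)"
proof -
  have "(\<lambda>\<alpha>. (f \<alpha> - g \<alpha>) /\<^sub>R h - k \<alpha>) = (\<lambda>\<alpha>. 1 *\<^sub>R (inverse h *\<^sub>R f \<alpha> + (- inverse h) *\<^sub>R g \<alpha>) + (-1) *\<^sub>R k \<alpha>)"
    by (simp add: scaleR_diff_right)
  thus ?thesis using C1_holder_lincomb[OF C1_holder_lincomb[OF assms(1,2)] assms(3)] by (simp only:)
qed

text \<open>
  A Hoelder modulus of continuity of \<open>z'\<close> in time, measured in the Hoelder norm in the parameter,
  makes the difference quotients converge: apply the mean value inequality to \<open>z\<close>, to its parameter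
  derivative and to the increments of the latter.
\<close>

lemma C1_in_time_criterion:
  assumes z: "\<And>t. t \<in> {-T<..<T} \<Longrightarrow> C1_holder_curve \<gamma> (z t)"
    and z': "\<And>t. t \<in> {-T<..<T} \<Longrightarrow> periodic (z' t) \<and> C1_holder \<gamma> (z' t)"
    and D1: "\<And>t \<alpha>. t \<in> {-T<..<T} \<Longrightarrow> ((\<lambda>t. z t \<alpha>) has_vector_derivative z' t \<alpha>) (at t)"
    and D2: "\<And>t \<alpha>. t \<in> {-T<..<T} \<Longrightarrow> ((\<lambda>t. dcurve (z t) \<alpha>) has_vector_derivative dcurve (z' t) \<alpha>) (at t)"
    and \<mu>: "0 < \<mu>" and K: "0 \<le> K"
    and m1: "\<And>s t \<alpha>. s \<in> {-T<..<T} \<Longrightarrow> t \<in> {-T<..<T} \<Longrightarrow> norm (z' s \<alpha> - z' t \<alpha>) \<le> K * \<bar>s - t\<bar> powr \<mu>"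
    and m2: "\<And>s t \<alpha>. s \<in> {-T<..<T} \<Longrightarrow> t \<in> {-T<..<T} \<Longrightarrow> norm (dcurve (z' s) \<alpha> - dcurve (z' t) \<alpha>) \<le> K * \<bar>s - t\<bar> powr \<mu>"
    and m3: "\<And>s t \<alpha> \<beta>. s \<in> {-T<..<T} \<Longrightarrow> t \<in> {-T<..<T} \<Longrightarrow> \<alpha> \<in> torus \<Longrightarrow> \<beta> \<in> torus \<Longrightarrow>
       norm ((dcurve (z' s) \<alpha> - dcurve (z' t) \<alpha>) - (dcurve (z' s) \<beta> - dcurve (z' t) \<beta>)) \<le> K * \<bar>s - t\<bar> powr \<mu> * \<bar>\<alpha> - \<beta>\<bar> powr \<gamma>"
  shows "C1_in_time \<gamma> T z z'"
proof -
  let ?I = "{-T<..<T}"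
  have C1z: "z t C1_differentiable_on UNIV" if "t \<in> ?I" for t using z[OF that] by (auto simp: C1_holder_curve_def C1_holder_def)
  have C1z': "z' t C1_differentiable_on UNIV" if "t \<in> ?I" for t using z'[OF that] by (auto simp: C1_holder_def)
  have lim4: "((\<lambda>s. C1_holder_norm \<gamma> (\<lambda>\<alpha>. z' s \<alpha> - z' t \<alpha>)) \<longlongrightarrow> 0) (at t)" if t: "t \<in> ?I" for t
  proof (rule Lim_null_comparison[OF _ abs_powr_tendsto_0[OF \<mu>, of "3 * K" t]])
    have "\<forall>\<^sub>F s in at t. s \<in> ?I" using t by (intro eventually_at_in_open') auto
    thus "\<forall>\<^sub>F s in at t. norm (C1_holder_norm \<gamma> (\<lambda>\<alpha>. z' s \<alpha> - z' t \<alpha>)) \<le> 3 * K * \<bar>s - t\<bar> powr \<mu>"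
    proof eventually_elim
      case (elim s)
      let ?k = "K * \<bar>s - t\<bar> powr \<mu>"
      have e: "(\<lambda>\<alpha>. z' s \<alpha> - z' t \<alpha>) = (\<lambda>\<alpha>. 1 *\<^sub>R z' s \<alpha> + (-1) *\<^sub>R z' t \<alpha>)" by simp
      note L = C1_lincomb[OF C1z'[OF elim] C1z'[OF t], of 1 "-1", folded e]
      have L2: "dcurve (\<lambda>\<alpha>. z' s \<alpha> - z' t \<alpha>) \<alpha> = dcurve (z' s) \<alpha> - dcurve (z' t) \<alpha>" for \<alpha> using L(2)[of \<alpha>] by simp
      have b: "norm (dcurve (\<lambda>\<alpha>. z' s \<alpha> - z' t \<alpha>) \<alpha>) \<le> ?k" for \<alpha> unfolding L2 by (rule m2[OF elim t])
      have c: "norm (dcurve (\<lambda>\<alpha>. z' s \<alpha> - z' t \<alpha>) \<alpha> - dcurve (\<lambda>\<alpha>. z' s \<alpha> - z' t \<alpha>) \<beta>) \<le> ?k * \<bar>\<alpha> - \<beta>\<bar> powr \<gamma>"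
        if "\<alpha> \<in> torus" "\<beta> \<in> torus" for \<alpha> \<beta> unfolding L2 by (rule m3[OF elim t that])
      note N = C1_holder_normI[OF L(1) m1[OF elim t] b c]
      have "0 \<le> C1_holder_norm \<gamma> (\<lambda>\<alpha>. z' s \<alpha> - z' t \<alpha>)" by (rule C1_holder_norm_nonneg[OF N(1)])
      thus ?case using N(2) by simp
    qed
  qed
  have lim3: "((\<lambda>h. C1_holder_norm \<gamma> (\<lambda>\<alpha>. (z (t + h) \<alpha> - z t \<alpha>) /\<^sub>R h - z' t \<alpha>)) \<longlongrightarrow> 0) (at 0)" if t: "t \<in> ?I" for t
  proof (rule Lim_null_comparison[OF _ abs_powr_tendsto_0[OF \<mu>, of "3 * K" 0]])
    have "\<forall>\<^sub>F h in at (0::real). h \<in> {-T-t<..<T-t} - {0}" using t by (intro eventually_at_in_open) auto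
    thus "\<forall>\<^sub>F h in at 0. norm (C1_holder_norm \<gamma> (\<lambda>\<alpha>. (z (t + h) \<alpha> - z t \<alpha>) /\<^sub>R h - z' t \<alpha>)) \<le> 3 * K * \<bar>h - 0\<bar> powr \<mu>"
    proof eventually_elim
      case (elim h)
      let ?k = "K * \<bar>h\<bar> powr \<mu>" and ?e = "\<lambda>\<alpha>. (z (t + h) \<alpha> - z t \<alpha>) /\<^sub>R h - z' t \<alpha>"
      have h: "h \<noteq> 0" and th: "t + h \<in> ?I" using elim by auto
      have seg: "closed_segment t (t + h) \<subseteq> ?I" using t th by (intro closed_segment_subset) auto
      have sd: "\<bar>x - t\<bar> powr \<mu> \<le> \<bar>h\<bar> powr \<mu>" if "x \<in> closed_segment t (t + h)" for x
      proof (rule powr_mono2)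
        show "\<bar>x - t\<bar> \<le> \<bar>h\<bar>" using dist_in_closed_segment[OF that] by (simp add: dist_real_def)
      qed (use \<mu> in auto)
      have sK: "K * \<bar>x - t\<bar> powr \<mu> \<le> ?k" if "x \<in> closed_segment t (t + h)" for x
        using sd[OF that] K by (intro mult_left_mono)
      note L = C1_difference_quotient[OF C1z[OF th] C1z[OF t] C1z'[OF t], of h]
      have a: "norm (?e \<alpha>) \<le> ?k" for \<alpha>
        by (rule difference_quotient_bound[where g = "\<lambda>s. z s \<alpha>" and g' = "\<lambda>s. z' s \<alpha>"])
          (use D1 seg h in \<open>auto intro: order_trans[OF m1[OF _ t] sK]\<close>)
      have b: "norm (dcurve ?e \<alpha>) \<le> ?k" for \<alpha>
        unfolding L(2)
        by (rule difference_quotient_bound[where g = "\<lambda>s. dcurve (z s) \<alpha>" and g' = "\<lambda>s. dcurve (z' s) \<alpha>"])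
          (use D2 seg h in \<open>auto intro: order_trans[OF m2[OF _ t] sK]\<close>)
      have c: "norm (dcurve ?e \<alpha> - dcurve ?e \<beta>) \<le> ?k * \<bar>\<alpha> - \<beta>\<bar> powr \<gamma>" if ab: "\<alpha> \<in> torus" "\<beta> \<in> torus" for \<alpha> \<beta>
      proof -
        let ?g = "\<lambda>s. dcurve (z s) \<alpha> - dcurve (z s) \<beta>" and ?g' = "\<lambda>s. dcurve (z' s) \<alpha> - dcurve (z' s) \<beta>"
        have "norm ((?g (t + h) - ?g t) /\<^sub>R h - ?g' t) \<le> ?k * \<bar>\<alpha> - \<beta>\<bar> powr \<gamma>"
        proof (rule difference_quotient_bound[where g = ?g and g' = ?g'])
          fix x assume x: "x \<in> closed_segment t (t + h)"
          hence xI: "x \<in> ?I" using seg by blast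
          show "(?g has_vector_derivative ?g' x) (at x)" by (intro has_vector_derivative_diff D2[OF xI])
          have "?g' x - ?g' t = (dcurve (z' x) \<alpha> - dcurve (z' t) \<alpha>) - (dcurve (z' x) \<beta> - dcurve (z' t) \<beta>)" by simp
          also have "norm \<dots> \<le> K * \<bar>x - t\<bar> powr \<mu> * \<bar>\<alpha> - \<beta>\<bar> powr \<gamma>" by (rule m3[OF xI t ab])
          also have "\<dots> \<le> ?k * \<bar>\<alpha> - \<beta>\<bar> powr \<gamma>" by (intro mult_right_mono sK[OF x]) auto
          finally show "norm (?g' x - ?g' t) \<le> ?k * \<bar>\<alpha> - \<beta>\<bar> powr \<gamma>" .
        qed (rule h)
        moreover have "(?g (t + h) - ?g t) /\<^sub>R h - ?g' t = dcurve ?e \<alpha> - dcurve ?e \<beta>"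
          unfolding L(2) by (simp add: scaleR_diff_right)
        ultimately show ?thesis by (simp only:)
      qed
      note N = C1_holder_normI[OF L(1) a b c]
      have "0 \<le> C1_holder_norm \<gamma> ?e" by (rule C1_holder_norm_nonneg[OF N(1)])
      thus ?case using N(2) by simp
    qed
  qed
  show ?thesis unfolding C1_in_time_def using z z' lim3 lim4 by blast
qed

lemma continuous_norm_attains_max:
  fixes g :: "real \<Rightarrow> 'a::real_normed_vector"
  assumes "0 \<le> T" "continuous_on {-T..T} g"
  obtains s where "s \<in> {-T..T}" "\<And>t. t \<in> {-T..T} \<Longrightarrow> norm (g t) \<le> norm (g s)"
proof -
  have "\<exists>s\<in>{-T..T}. \<forall>t\<in>{-T..T}. norm (g t) \<le> norm (g s)"
    by (rule continuous_attains_sup) (use assms in \<open>auto intro: continuous_on_norm\<close>)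
  thus thesis using that by blast
qed

text \<open>
  For fixed \<open>\<alpha>\<close> and \<open>\<beta>\<close> let \<open>g\<close> be the increment of the parameter derivative. By \<open>dvel_holder\<close> its time
  derivative is at most \<open>k (|\<alpha> - \<beta>| powr \<gamma> + |g|)\<close>. At a time where \<open>|g|\<close> is maximal, \<open>T k \<le> 1/2\<close> lets the
  term with \<open>|g|\<close> be absorbed.
\<close>

theorem holder_solution_exists:
  assumes \<gamma>: "0 < \<gamma>" "\<gamma> < 1" and z0: "C1_holder_curve \<gamma> z0" and arc: "arc_chord_norm z0 < \<infinity>"
  obtains T z where "0 < T" "z 0 = z0" "C1_in_time \<gamma> T z (\<lambda>t \<alpha>. \<kappa> *\<^sub>R vel (z t) \<alpha>)" "\<And>t. arc_chord_norm (z t) < \<infinity>"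
proof -
  obtain c A where reg0: "regular c A z0" using regular_of_arc_chord[OF z0 arc] by blast
  define K0 where "K0 = C1_holder_norm \<gamma> z0"
  have h0: "C1_holder \<gamma> z0" using z0 by (simp add: C1_holder_curve_def)
  have K0: "0 \<le> K0" unfolding K0_def by (rule C1_holder_norm_nonneg[OF h0])
  have hold0: "norm (dcurve z0 \<alpha> - dcurve z0 \<beta>) \<le> K0 * \<bar>\<alpha> - \<beta>\<bar> powr \<gamma>" if "\<alpha> \<in> torus" "\<beta> \<in> torus" for \<alpha> \<beta>
    unfolding K0_def by (rule C1_holder_normD(3)[OF h0 that])
  obtain Ch where Ch: "0 \<le> Ch"
    "\<And>z \<alpha> \<beta>. regular (c/2) (A+1) z \<Longrightarrow> norm (dvel z \<alpha> - dvel z \<beta>) \<le> Ch * (\<bar>\<alpha> - \<beta>\<bar> powr \<gamma> + norm (dcurve z \<alpha> - dcurve z \<beta>))"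
    using dvel_holder[OF \<gamma>, of "c/2" "A+1"] by blast
  obtain Cd \<mu> where Cd: "0 \<le> Cd" "0 < \<mu>" "\<mu> \<le> 1"
    "\<And>z w \<delta> k e \<alpha> \<beta>. \<lbrakk>regular (c/2) (A+1) z; regular (c/2) (A+1) w; \<And>\<alpha>. norm (z \<alpha> - w \<alpha>) \<le> \<delta>; \<And>\<alpha>. norm (dcurve z \<alpha> - dcurve w \<alpha>) \<le> \<delta>;
        norm (dcurve z \<alpha> - dcurve z \<beta>) \<le> k * \<bar>\<alpha> - \<beta>\<bar> powr \<gamma>;
        norm ((dcurve z \<alpha> - dcurve w \<alpha>) - (dcurve z \<beta> - dcurve w \<beta>)) \<le> e * \<bar>\<alpha> - \<beta>\<bar> powr \<gamma>; 0 \<le> k; 0 \<le> e\<rbrakk> \<Longrightarrow>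
       norm ((dvel z \<alpha> - dvel w \<alpha>) - (dvel z \<beta> - dvel w \<beta>)) \<le> Cd * (\<delta> powr \<mu> + \<delta> * k + \<delta> + e) * \<bar>\<alpha> - \<beta>\<bar> powr \<gamma>"
    using dvel_diff_holder[OF \<gamma>, of "c/2" "A+1"] by blast
  obtain Cl where Cl: "0 \<le> Cl"
    "\<And>z w \<delta> \<alpha>. \<lbrakk>regular (c/2) (A+1) z; regular (c/2) (A+1) w; \<And>\<alpha>. norm (z \<alpha> - w \<alpha>) \<le> \<delta>; \<And>\<alpha>. norm (dcurve z \<alpha> - dcurve w \<alpha>) \<le> \<delta>\<rbrakk> \<Longrightarrow>
       norm (vel z \<alpha> - vel w \<alpha>) \<le> Cl * \<delta> \<and> norm (dvel z \<alpha> - dvel w \<alpha>) \<le> Cl * \<delta>"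
    using vel_dvel_lipschitz by blast
  define k where "k = \<bar>\<kappa>\<bar> * Ch"
  have k: "0 \<le> k" using Ch(1) by (simp add: k_def)
  \<comment> \<open>The bound 1/2 makes time differences at most 1, hence dominated by their power \<open>\<mu>\<close>.\<close>
  define T0 where "T0 = min (1/2) (1 / (2 * (k + 1)))"
  have T0: "0 < T0" using k by (simp add: T0_def)
  obtain T z V where T: "0 < T" "T \<le> T0" and z00: "z 0 = z0" and V: "0 \<le> V"
    and R: "\<And>t. regular (c/2) (A+1) (z t)"
    and D1: "\<And>t \<alpha>. t \<in> {-T..T} \<Longrightarrow> ((\<lambda>t. z t \<alpha>) has_vector_derivative \<kappa> *\<^sub>R vel (z t) \<alpha>) (at t within {-T..T})"
    and D2: "\<And>t \<alpha>. t \<in> {-T..T} \<Longrightarrow> ((\<lambda>t. dcurve (z t) \<alpha>) has_vector_derivative \<kappa> *\<^sub>R dvel (z t) \<alpha>) (at t within {-T..T})"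
    and B1: "\<And>t \<alpha>. norm (\<kappa> *\<^sub>R vel (z t) \<alpha>) \<le> V" and B2: "\<And>t \<alpha>. norm (\<kappa> *\<^sub>R dvel (z t) \<alpha>) \<le> V"
    using C1_solution_exists[OF reg0 T0, of \<kappa>] by blast
  have Tk: "T * k \<le> 1/2"
  proof -
    have "T * k \<le> (1 / (2 * (k + 1))) * k" using T(2) k by (intro mult_right_mono) (auto simp: T0_def)
    also have "\<dots> \<le> 1/2" using k by (simp add: field_simps)
    finally show ?thesis .
  qed
  have T1: "T \<le> 1/2" using T(2) by (simp add: T0_def)
  let ?J = "{-T..T}"
  have cv: "convex ?J" by simp
  have L1: "norm (z s \<alpha> - z t \<alpha>) \<le> V * \<bar>s - t\<bar>" if "s \<in> ?J" "t \<in> ?J" for s t \<alpha>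
    by (rule mean_value_within[OF cv D1 B1 that])
  have L2: "norm (dcurve (z s) \<alpha> - dcurve (z t) \<alpha>) \<le> V * \<bar>s - t\<bar>" if "s \<in> ?J" "t \<in> ?J" for s t \<alpha>
    by (rule mean_value_within[OF cv D2 B2 that])
  define K1 where "K1 = 2 * K0 + 1"
  have K1: "0 \<le> K1" using K0 by (simp add: K1_def)
  have Dg: "((\<lambda>t. dcurve (z t) \<alpha> - dcurve (z t) \<beta>) has_vector_derivative \<kappa> *\<^sub>R (dvel (z t) \<alpha> - dvel (z t) \<beta>)) (at t within ?J)"
    if "t \<in> ?J" for t \<alpha> \<beta>
    unfolding scaleR_diff_right by (intro has_vector_derivative_diff D2 that)
  have Bg: "norm (\<kappa> *\<^sub>R (dvel (z t) \<alpha> - dvel (z t) \<beta>)) \<le> k * (\<bar>\<alpha> - \<beta>\<bar> powr \<gamma> + norm (dcurve (z t) \<alpha> - dcurve (z t) \<beta>))" for t \<alpha> \<beta>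
    unfolding norm_scaleR k_def mult.assoc by (intro mult_left_mono Ch(2)[OF R]) auto
  have hold: "norm (dcurve (z t) \<alpha> - dcurve (z t) \<beta>) \<le> K1 * \<bar>\<alpha> - \<beta>\<bar> powr \<gamma>"
    if t: "t \<in> ?J" and ab: "\<alpha> \<in> torus" "\<beta> \<in> torus" for t \<alpha> \<beta>
  proof -
    let ?d = "\<bar>\<alpha> - \<beta>\<bar> powr \<gamma>" and ?g = "\<lambda>t. dcurve (z t) \<alpha> - dcurve (z t) \<beta>"
    have "continuous_on ?J ?g"
      unfolding continuous_on_eq_continuous_within by (auto intro: has_vector_derivative_continuous[OF Dg])
    then obtain s where s: "s \<in> ?J" "\<And>t. t \<in> ?J \<Longrightarrow> norm (?g t) \<le> norm (?g s)"
      using continuous_norm_attains_max[of T ?g] T(1) by auto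
    have "norm (?g s - ?g 0) \<le> (k * (?d + norm (?g s))) * \<bar>s - 0\<bar>"
    proof (rule mean_value_within[OF cv Dg])
      show "norm (\<kappa> *\<^sub>R (dvel (z x) \<alpha> - dvel (z x) \<beta>)) \<le> k * (?d + norm (?g s))" if "x \<in> ?J" for x
        using s(2)[OF that] k by (intro order_trans[OF Bg] mult_left_mono add_left_mono)
    qed (use s(1) T(1) in auto)
    also have "\<dots> \<le> (k * (?d + norm (?g s))) * T" using s(1) k by (intro mult_left_mono) auto
    also have "\<dots> = (T * k) * (?d + norm (?g s))" by simp
    also have "\<dots> \<le> 1/2 * (?d + norm (?g s))" by (intro mult_right_mono Tk) auto
    finally have "norm (?g s - ?g 0) \<le> ?d / 2 + norm (?g s) / 2" by simp
    moreover have "norm (?g 0) \<le> K0 * ?d" unfolding z00 by (rule hold0[OF ab])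
    moreover have "norm (?g s) \<le> norm (?g 0) + norm (?g s - ?g 0)" by (rule norm_triangle_sub)
    ultimately have "norm (?g s) \<le> 2 * (K0 * ?d) + ?d" by linarith
    also have "\<dots> = K1 * ?d" by (simp add: K1_def algebra_simps)
    finally show ?thesis using s(2)[OF t] by linarith
  qed
  define K2 where "K2 = k * (1 + K1)"
  have K2: "0 \<le> K2" using k K1 by (simp add: K2_def)
  have Bg2: "norm (\<kappa> *\<^sub>R (dvel (z t) \<alpha> - dvel (z t) \<beta>)) \<le> K2 * \<bar>\<alpha> - \<beta>\<bar> powr \<gamma>"
    if "t \<in> ?J" "\<alpha> \<in> torus" "\<beta> \<in> torus" for t \<alpha> \<beta>
  proof -
    have "k * (\<bar>\<alpha> - \<beta>\<bar> powr \<gamma> + norm (dcurve (z t) \<alpha> - dcurve (z t) \<beta>)) \<le> k * (\<bar>\<alpha> - \<beta>\<bar> powr \<gamma> + K1 * \<bar>\<alpha> - \<beta>\<bar> powr \<gamma>)"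
      using hold[OF that] k by (intro mult_left_mono add_left_mono)
    also have "\<dots> = K2 * \<bar>\<alpha> - \<beta>\<bar> powr \<gamma>" by (simp add: K2_def algebra_simps)
    finally show ?thesis by (rule order_trans[OF Bg])
  qed
  have L3: "norm ((dcurve (z s) \<alpha> - dcurve (z t) \<alpha>) - (dcurve (z s) \<beta> - dcurve (z t) \<beta>)) \<le> K2 * \<bar>s - t\<bar> * \<bar>\<alpha> - \<beta>\<bar> powr \<gamma>"
    if st: "s \<in> ?J" "t \<in> ?J" and ab: "\<alpha> \<in> torus" "\<beta> \<in> torus" for s t \<alpha> \<beta>
  proof -
    have "norm ((dcurve (z s) \<alpha> - dcurve (z s) \<beta>) - (dcurve (z t) \<alpha> - dcurve (z t) \<beta>)) \<le> (K2 * \<bar>\<alpha> - \<beta>\<bar> powr \<gamma>) * \<bar>s - t\<bar>"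
      by (rule mean_value_within[OF cv Dg Bg2[OF _ ab] st])
    moreover have "(dcurve (z s) \<alpha> - dcurve (z t) \<alpha>) - (dcurve (z s) \<beta> - dcurve (z t) \<beta>)
       = (dcurve (z s) \<alpha> - dcurve (z s) \<beta>) - (dcurve (z t) \<alpha> - dcurve (z t) \<beta>)" by simp
    ultimately show ?thesis by (simp only: mult_ac)
  qed
  define E1 where "E1 = \<bar>\<kappa>\<bar> * (Cl * V)"
  define E2 where "E2 = \<bar>\<kappa>\<bar> * (Cd * (V powr \<mu> + V * K1 + V + K2))"
  have E: "0 \<le> E1" "0 \<le> E2" using Cl(1) Cd(1) V K1 K2 by (auto simp: E1_def E2_def)
  have small: "\<bar>s - t\<bar> \<le> \<bar>s - t\<bar> powr \<mu>" if "s \<in> ?J" "t \<in> ?J" for s t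
  proof (cases "s = t")
    case False
    have "\<bar>s - t\<bar> \<le> 1" using that T1 by (auto simp: abs_le_iff)
    thus ?thesis using powr_mono'[of \<mu> 1 "\<bar>s - t\<bar>"] Cd(3) False by simp
  qed simp
  have IJ: "t \<in> ?J" "at t within ?J = at t" if "t \<in> {-T<..<T}" for t
    using that at_within_interior[of t ?J] by auto
  have m12: "norm (\<kappa> *\<^sub>R vel (z s) \<alpha> - \<kappa> *\<^sub>R vel (z t) \<alpha>) \<le> (E1 + E2) * \<bar>s - t\<bar> powr \<mu>"
       "norm (\<kappa> *\<^sub>R dvel (z s) \<alpha> - \<kappa> *\<^sub>R dvel (z t) \<alpha>) \<le> (E1 + E2) * \<bar>s - t\<bar> powr \<mu>"
    if st: "s \<in> ?J" "t \<in> ?J" for s t \<alpha>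
  proof -
    have l: "norm (vel (z s) \<alpha> - vel (z t) \<alpha>) \<le> Cl * (V * \<bar>s - t\<bar>) \<and> norm (dvel (z s) \<alpha> - dvel (z t) \<alpha>) \<le> Cl * (V * \<bar>s - t\<bar>)"
      by (rule Cl(2)[OF R R L1[OF st] L2[OF st]])
    have "\<bar>\<kappa>\<bar> * (Cl * (V * \<bar>s - t\<bar>)) = E1 * \<bar>s - t\<bar>" by (simp add: E1_def)
    also have "\<dots> \<le> (E1 + E2) * \<bar>s - t\<bar> powr \<mu>" using E small[OF st] by (intro mult_mono) auto
    finally have e: "\<bar>\<kappa>\<bar> * (Cl * (V * \<bar>s - t\<bar>)) \<le> (E1 + E2) * \<bar>s - t\<bar> powr \<mu>" .
    show "norm (\<kappa> *\<^sub>R vel (z s) \<alpha> - \<kappa> *\<^sub>R vel (z t) \<alpha>) \<le> (E1 + E2) * \<bar>s - t\<bar> powr \<mu>"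
       "norm (\<kappa> *\<^sub>R dvel (z s) \<alpha> - \<kappa> *\<^sub>R dvel (z t) \<alpha>) \<le> (E1 + E2) * \<bar>s - t\<bar> powr \<mu>"
      unfolding scaleR_diff_right[symmetric] norm_scaleR
      using l by (auto intro!: order_trans[OF mult_left_mono e])
  qed
  have m3: "norm ((\<kappa> *\<^sub>R dvel (z s) \<alpha> - \<kappa> *\<^sub>R dvel (z t) \<alpha>) - (\<kappa> *\<^sub>R dvel (z s) \<beta> - \<kappa> *\<^sub>R dvel (z t) \<beta>)) \<le> (E1 + E2) * \<bar>s - t\<bar> powr \<mu> * \<bar>\<alpha> - \<beta>\<bar> powr \<gamma>"
    if st: "s \<in> ?J" "t \<in> ?J" and ab: "\<alpha> \<in> torus" "\<beta> \<in> torus" for s t \<alpha> \<beta>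
  proof -
    let ?x = "\<bar>s - t\<bar>" and ?d = "\<bar>\<alpha> - \<beta>\<bar> powr \<gamma>"
    have n: "norm ((dvel (z s) \<alpha> - dvel (z t) \<alpha>) - (dvel (z s) \<beta> - dvel (z t) \<beta>))
      \<le> Cd * ((V * ?x) powr \<mu> + (V * ?x) * K1 + V * ?x + K2 * ?x) * ?d"
      by (rule Cd(4)[OF R R L1[OF st] L2[OF st] hold[OF st(1) ab] L3[OF st ab] K1]) (use K2 in simp)
    have "(V * ?x) powr \<mu> + (V * ?x) * K1 + V * ?x + K2 * ?x = V powr \<mu> * ?x powr \<mu> + (V * K1) * ?x + V * ?x + K2 * ?x"
      using V by (simp add: powr_mult)
    also have "\<dots> \<le> V powr \<mu> * ?x powr \<mu> + (V * K1) * ?x powr \<mu> + V * ?x powr \<mu> + K2 * ?x powr \<mu>"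
      using V K1 K2 small[OF st] by (intro add_mono mult_left_mono) auto
    also have "\<dots> = (V powr \<mu> + V * K1 + V + K2) * ?x powr \<mu>" by (simp only: distrib_right)
    finally have x: "(V * ?x) powr \<mu> + (V * ?x) * K1 + V * ?x + K2 * ?x \<le> (V powr \<mu> + V * K1 + V + K2) * ?x powr \<mu>" .
    have "\<bar>\<kappa>\<bar> * norm ((dvel (z s) \<alpha> - dvel (z t) \<alpha>) - (dvel (z s) \<beta> - dvel (z t) \<beta>))
      \<le> \<bar>\<kappa>\<bar> * (Cd * ((V powr \<mu> + V * K1 + V + K2) * ?x powr \<mu>) * ?d)"
      using Cd(1) by (intro mult_left_mono order_trans[OF n] mult_right_mono x) auto
    also have "\<dots> = E2 * ?x powr \<mu> * ?d" by (simp only: E2_def mult_ac)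
    also have "\<dots> \<le> (E1 + E2) * ?x powr \<mu> * ?d" using E by (intro mult_right_mono) auto
    finally show ?thesis unfolding scaleR_diff_right[symmetric] norm_scaleR .
  qed
  have "C1_in_time \<gamma> T z (\<lambda>t \<alpha>. \<kappa> *\<^sub>R vel (z t) \<alpha>)"
  proof (rule C1_in_time_criterion[OF _ _ _ _ Cd(2)])
    show "0 \<le> E1 + E2" using E by simp
    fix t assume t: "t \<in> {-T<..<T}"
    show "C1_holder_curve \<gamma> (z t)"
      unfolding C1_holder_curve_def using regularD(2)[OF R] C1_holderI[OF regularD(3)[OF R] hold[OF IJ(1)[OF t]]] by blast
    have "periodic (\<lambda>\<alpha>. \<kappa> *\<^sub>R vel (z t) \<alpha>)" using vel_periodic[OF regularD(2)[OF R]] by (simp add: periodic_def)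
    moreover have "C1_holder \<gamma> (\<lambda>\<alpha>. \<kappa> *\<^sub>R vel (z t) \<alpha>)"
      by (rule C1_holderI[OF scaled_vel_C1(1)[OF R], where k = K2])
        (simp only: scaled_vel_C1(2)[OF R] scaleR_diff_right[symmetric] Bg2[OF IJ(1)[OF t]])
    ultimately show "periodic (\<lambda>\<alpha>. \<kappa> *\<^sub>R vel (z t) \<alpha>) \<and> C1_holder \<gamma> (\<lambda>\<alpha>. \<kappa> *\<^sub>R vel (z t) \<alpha>)" by blast
    fix \<alpha>
    show "((\<lambda>t. z t \<alpha>) has_vector_derivative \<kappa> *\<^sub>R vel (z t) \<alpha>) (at t)" using D1[OF IJ(1)[OF t], of \<alpha>] unfolding IJ(2)[OF t] .
    show "((\<lambda>t. dcurve (z t) \<alpha>) has_vector_derivative dcurve (\<lambda>\<alpha>. \<kappa> *\<^sub>R vel (z t) \<alpha>) \<alpha>) (at t)"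
      using D2[OF IJ(1)[OF t], of \<alpha>] unfolding IJ(2)[OF t] scaled_vel_C1(2)[OF R] .
    fix s assume s: "s \<in> {-T<..<T}"
    note st = IJ(1)[OF s] IJ(1)[OF t]
    show "norm (\<kappa> *\<^sub>R vel (z s) \<alpha> - \<kappa> *\<^sub>R vel (z t) \<alpha>) \<le> (E1 + E2) * \<bar>s - t\<bar> powr \<mu>" by (rule m12(1)[OF st])
    show "norm (dcurve (\<lambda>\<alpha>. \<kappa> *\<^sub>R vel (z s) \<alpha>) \<alpha> - dcurve (\<lambda>\<alpha>. \<kappa> *\<^sub>R vel (z t) \<alpha>) \<alpha>) \<le> (E1 + E2) * \<bar>s - t\<bar> powr \<mu>"
      unfolding scaled_vel_C1(2)[OF R] by (rule m12(2)[OF st])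
    fix \<beta> assume ab: "\<alpha> \<in> torus" "\<beta> \<in> torus"
    show "norm (dcurve (\<lambda>\<alpha>. \<kappa> *\<^sub>R vel (z s) \<alpha>) \<alpha> - dcurve (\<lambda>\<alpha>. \<kappa> *\<^sub>R vel (z t) \<alpha>) \<alpha>
       - (dcurve (\<lambda>\<alpha>. \<kappa> *\<^sub>R vel (z s) \<alpha>) \<beta> - dcurve (\<lambda>\<alpha>. \<kappa> *\<^sub>R vel (z t) \<alpha>) \<beta>)) \<le> (E1 + E2) * \<bar>s - t\<bar> powr \<mu> * \<bar>\<alpha> - \<beta>\<bar> powr \<gamma>"
      unfolding scaled_vel_C1(2)[OF R] by (rule m3[OF st ab])
  qed
  thus thesis by (rule that[of T z, OF T(1) z00 _ arc_chord_finite_of_regular[OF R]])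
qed

section \<open>Uniqueness\<close>

text \<open>
  The solution concept with the velocity in place of an unspecified time derivative and without the
  initial condition.
\<close>

definition solves :: "real \<Rightarrow> real \<Rightarrow> real \<Rightarrow> (real \<Rightarrow> real \<Rightarrow> real^2) \<Rightarrow> bool" where
  "solves \<kappa> \<gamma> T z \<longleftrightarrow> C1_in_time \<gamma> T z (\<lambda>t \<alpha>. \<kappa> *\<^sub>R vel (z t) \<alpha>) \<and> (\<forall>t\<in>{-T<..<T}. arc_chord_norm (z t) < \<infinity>)"

lemma solvesD:
  assumes "solves \<kappa> \<gamma> T z" "t \<in> {-T<..<T}"
  shows "C1_holder_curve \<gamma> (z t)" "\<exists>c A. regular c A (z t)" "C1_holder \<gamma> (\<lambda>\<alpha>. \<kappa> *\<^sub>R vel (z t) \<alpha>)" "periodic (\<lambda>\<alpha>. \<kappa> *\<^sub>R vel (z t) \<alpha>)"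
    "((\<lambda>h. C1_holder_norm \<gamma> (\<lambda>\<alpha>. (z (t + h) \<alpha> - z t \<alpha>) /\<^sub>R h - \<kappa> *\<^sub>R vel (z t) \<alpha>)) \<longlongrightarrow> 0) (at 0)"
proof -
  show 1: "C1_holder_curve \<gamma> (z t)" using assms by (auto simp: solves_def C1_in_time_def)
  show "\<exists>c A. regular c A (z t)" using regular_of_arc_chord[OF 1] assms unfolding solves_def by blast
  show "C1_holder \<gamma> (\<lambda>\<alpha>. \<kappa> *\<^sub>R vel (z t) \<alpha>)" "periodic (\<lambda>\<alpha>. \<kappa> *\<^sub>R vel (z t) \<alpha>)"
    "((\<lambda>h. C1_holder_norm \<gamma> (\<lambda>\<alpha>. (z (t + h) \<alpha> - z t \<alpha>) /\<^sub>R h - \<kappa> *\<^sub>R vel (z t) \<alpha>)) \<longlongrightarrow> 0) (at 0)"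
    using assms by (auto simp: solves_def C1_in_time_def)
qed

lemma solves_difference_quotient:
  assumes z: "solves \<kappa> \<gamma> T z" and t: "t \<in> {-T<..<T}" and th: "t + h \<in> {-T<..<T}"
  defines "N \<equiv> C1_holder_norm \<gamma> (\<lambda>\<alpha>. (z (t + h) \<alpha> - z t \<alpha>) /\<^sub>R h - \<kappa> *\<^sub>R vel (z t) \<alpha>)"
  shows "norm ((z (t + h) \<alpha> - z t \<alpha>) /\<^sub>R h - \<kappa> *\<^sub>R vel (z t) \<alpha>) \<le> N"
    "norm ((dcurve (z (t + h)) \<alpha> - dcurve (z t) \<alpha>) /\<^sub>R h - \<kappa> *\<^sub>R dvel (z t) \<alpha>) \<le> N"
proof -
  let ?e = "\<lambda>\<alpha>. (z (t + h) \<alpha> - z t \<alpha>) /\<^sub>R h - \<kappa> *\<^sub>R vel (z t) \<alpha>"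
  obtain c A where R: "regular c A (z t)" using solvesD(2)[OF z t] by blast
  have H: "C1_holder \<gamma> (z t)" "C1_holder \<gamma> (z (t + h))" and hp: "horizontally_periodic (z t)" "horizontally_periodic (z (t + h))"
    using solvesD(1)[OF z t] solvesD(1)[OF z th] by (auto simp: C1_holder_curve_def)
  have C: "z t C1_differentiable_on UNIV" "z (t + h) C1_differentiable_on UNIV" using H by (auto simp: C1_holder_def)
  have e: "C1_holder \<gamma> ?e" by (rule C1_holder_difference_quotient[OF H(2,1) solvesD(3)[OF z t]])
  have ep: "periodic ?e"
    using hp_diff_periodic[OF hp(2,1)] solvesD(4)[OF z t] by (simp add: periodic_def)
  show "norm (?e \<alpha>) \<le> N" unfolding N_def
    by (rule periodic_bound_torus[OF ep, where P = "\<lambda>x. norm x \<le> _"]) (rule C1_holder_normD(1)[OF e])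
  have de: "dcurve ?e \<alpha> = (dcurve (z (t + h)) \<alpha> - dcurve (z t) \<alpha>) /\<^sub>R h - \<kappa> *\<^sub>R dvel (z t) \<alpha>" for \<alpha>
    using C1_difference_quotient(2)[OF C(2,1) scaled_vel_C1(1)[OF R], of h] by (simp only: scaled_vel_C1(2)[OF R])
  have C1e: "?e C1_differentiable_on UNIV" using e by (simp add: C1_holder_def)
  have dp: "periodic (dcurve ?e)" by (rule periodic_derivative[OF ep C1_onD(1)[OF C1e]])
  have "norm (dcurve ?e \<alpha>) \<le> N" unfolding N_def
    by (rule periodic_bound_torus[OF dp, where P = "\<lambda>x. norm x \<le> _"]) (rule C1_holder_normD(2)[OF e])
  thus "norm ((dcurve (z (t + h)) \<alpha> - dcurve (z t) \<alpha>) /\<^sub>R h - \<kappa> *\<^sub>R dvel (z t) \<alpha>) \<le> N" unfolding de .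
qed

lemma eventually_in_shifted_interval:
  "t \<in> {-T<..<T} \<Longrightarrow> \<forall>\<^sub>F h in at (0::real). h \<noteq> 0 \<and> t + h \<in> {-T<..<T}"
proof -
  assume t: "t \<in> {-T<..<T}"
  have "\<forall>\<^sub>F h in at (0::real). h \<in> {-T-t<..<T-t} - {0}" using t by (intro eventually_at_in_open) auto
  thus ?thesis by eventually_elim auto
qed

lemma has_vector_derivative_of_quotient_bound:
  fixes g :: "real \<Rightarrow> 'a::real_normed_vector"
  assumes "(N \<longlongrightarrow> 0) (at 0)" "\<forall>\<^sub>F h in at 0. h \<noteq> 0 \<and> norm ((g (t + h) - g t) /\<^sub>R h - d) \<le> N h"
  shows "(g has_vector_derivative d) (at t)"
proof -
  have "((\<lambda>h. norm (g (t + h) - g t - h *\<^sub>R d) / norm h) \<longlongrightarrow> 0) (at 0)"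
  proof (rule Lim_null_comparison[OF _ assms(1)])
    show "\<forall>\<^sub>F h in at 0. norm (norm (g (t + h) - g t - h *\<^sub>R d) / norm h) \<le> N h"
      using assms(2)
    proof eventually_elim
      case (elim h)
      have "(g (t + h) - g t) /\<^sub>R h - d = (g (t + h) - g t - h *\<^sub>R d) /\<^sub>R h"
        using elim by (simp add: scaleR_diff_right)
      hence "norm ((g (t + h) - g t) /\<^sub>R h - d) = norm (g (t + h) - g t - h *\<^sub>R d) / norm h"
        by (simp add: divide_inverse mult.commute)
      thus ?case using elim by simp
    qed
  qed
  thus ?thesis unfolding has_vector_derivative_def has_derivative_at by (simp add: bounded_linear_scaleR_left)
qed

lemma solves_deriv:
  assumes z: "solves \<kappa> \<gamma> T z" and t: "t \<in> {-T<..<T}"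
  shows "((\<lambda>t. z t \<alpha>) has_vector_derivative \<kappa> *\<^sub>R vel (z t) \<alpha>) (at t)"
    "((\<lambda>t. dcurve (z t) \<alpha>) has_vector_derivative \<kappa> *\<^sub>R dvel (z t) \<alpha>) (at t)"
  by (rule has_vector_derivative_of_quotient_bound[OF solvesD(5)[OF z t]],
      use eventually_in_shifted_interval[OF t] in eventually_elim, use solves_difference_quotient[OF z t] in blast)+

text \<open>
  Difference quotients converge uniformly in the parameter to a bounded function, so the curves are
  continuous in time in the \<open>C\<^sup>1\<close> norm.
\<close>

lemma solves_C1_continuous:
  assumes z: "solves \<kappa> \<gamma> T z" and t: "t \<in> {-T<..<T}" and \<epsilon>: "0 < \<epsilon>"
  obtains \<eta> where "0 < \<eta>"
    "\<And>s. \<bar>s - t\<bar> < \<eta> \<Longrightarrow> s \<in> {-T<..<T} \<and> (\<forall>\<alpha>. norm (z s \<alpha> - z t \<alpha>) \<le> \<epsilon> \<and> norm (dcurve (z s) \<alpha> - dcurve (z t) \<alpha>) \<le> \<epsilon>)"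
proof -
  let ?N = "\<lambda>h. C1_holder_norm \<gamma> (\<lambda>\<alpha>. (z (t + h) \<alpha> - z t \<alpha>) /\<^sub>R h - \<kappa> *\<^sub>R vel (z t) \<alpha>)"
  obtain c A where R: "regular c A (z t)" using solvesD(2)[OF z t] by blast
  obtain V where V: "0 \<le> V" "\<And>z \<alpha>. regular c A z \<Longrightarrow> norm (vel z \<alpha>) \<le> V" "\<And>z \<alpha>. regular c A z \<Longrightarrow> norm (dvel z \<alpha>) \<le> V"
    using vel_dvel_bounded by blast
  define M where "M = 1 + \<bar>\<kappa>\<bar> * V"
  have M: "1 \<le> M" using V(1) by (simp add: M_def)
  have "\<forall>\<^sub>F h in at 0. ?N h < 1" using solvesD(5)[OF z t] by (rule order_tendstoD(2)) simp
  hence "\<forall>\<^sub>F h in at 0. ?N h < 1 \<and> h \<noteq> 0 \<and> t + h \<in> {-T<..<T}"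
    using eventually_in_shifted_interval[OF t] by eventually_elim blast
  then obtain d where d: "0 < d" "\<And>h. h \<noteq> 0 \<Longrightarrow> \<bar>h\<bar> < d \<Longrightarrow> ?N h < 1 \<and> t + h \<in> {-T<..<T}"
    unfolding eventually_at by (auto simp: dist_real_def)
  have step: "norm (x - y) \<le> \<bar>h\<bar> * M" if "h \<noteq> 0" "norm ((x - y) /\<^sub>R h - \<kappa> *\<^sub>R v) \<le> 1" "norm v \<le> V" for x y v :: "real^2" and h
  proof -
    have "norm ((x - y) /\<^sub>R h) \<le> norm (\<kappa> *\<^sub>R v) + norm ((x - y) /\<^sub>R h - \<kappa> *\<^sub>R v)" by (rule norm_triangle_sub)
    also have "\<dots> \<le> \<bar>\<kappa>\<bar> * V + 1" using that(2,3) by (intro add_mono) (auto intro: mult_left_mono)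
    finally have "norm ((x - y) /\<^sub>R h) \<le> M" by (simp add: M_def)
    hence "\<bar>h\<bar> * norm ((x - y) /\<^sub>R h) \<le> \<bar>h\<bar> * M" by (intro mult_left_mono) auto
    moreover have "norm (x - y) = \<bar>h\<bar> * norm ((x - y) /\<^sub>R h)" using that(1) by simp
    ultimately show ?thesis by (simp only:)
  qed
  define \<eta> where "\<eta> = min d (\<epsilon> / M)"
  show thesis
  proof (rule that[of \<eta>])
    show "0 < \<eta>" using d(1) \<epsilon> M by (simp add: \<eta>_def)
    fix s assume s: "\<bar>s - t\<bar> < \<eta>"
    show "s \<in> {-T<..<T} \<and> (\<forall>\<alpha>. norm (z s \<alpha> - z t \<alpha>) \<le> \<epsilon> \<and> norm (dcurve (z s) \<alpha> - dcurve (z t) \<alpha>) \<le> \<epsilon>)"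
    proof (cases "s = t")
      case True thus ?thesis using t \<epsilon> by simp
    next
      case False
      define h where "h = s - t"
      have h: "h \<noteq> 0" "\<bar>h\<bar> < d" "t + h = s" using False s by (auto simp: h_def \<eta>_def)
      have "\<bar>h\<bar> < \<epsilon> / M" using s by (simp add: h_def \<eta>_def)
      hence hM: "\<bar>h\<bar> * M \<le> \<epsilon>" using M by (simp add: field_simps)
      have N: "?N h < 1" and th: "t + h \<in> {-T<..<T}" using d(2)[OF h(1,2)] by auto
      note q = solves_difference_quotient[OF z t th]
      have "norm (z (t + h) \<alpha> - z t \<alpha>) \<le> \<bar>h\<bar> * M" for \<alpha>
        by (rule step[OF h(1) _ V(2)[OF R, of \<alpha>]]) (use q(1)[of \<alpha>] N in linarith)
      moreover have "norm (dcurve (z (t + h)) \<alpha> - dcurve (z t) \<alpha>) \<le> \<bar>h\<bar> * M" for \<alpha>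
        by (rule step[OF h(1) _ V(3)[OF R, of \<alpha>]]) (use q(2)[of \<alpha>] N in linarith)
      ultimately show ?thesis using hM th unfolding h(3) by (meson order_trans)
    qed
  qed
qed

text \<open>
  Near \<open>t\<close> both solutions stay in one class of regular curves, where the field is Lipschitz. On an
  interval so short that \<open>k \<eta> \<le> 1/2\<close>, integrating the equation halves any bound on their \<open>C\<^sup>1\<close>
  distance; iterating from the initial bound \<open>2 \<delta>\<close> gives distance zero.
\<close>

lemma solves_locally_unique:
  assumes z: "solves \<kappa> \<gamma> T z" and w: "solves \<kappa> \<gamma> T w" and t: "t \<in> {-T<..<T}" and eq: "z t = w t"
  obtains \<eta> where "0 < \<eta>" "\<And>s. \<bar>s - t\<bar> \<le> \<eta> \<Longrightarrow> z s = w s"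
proof -
  obtain c A where R: "regular c A (z t)" using solvesD(2)[OF z t] by blast
  obtain \<delta> where \<delta>: "0 < \<delta>"
    "\<And>w. \<lbrakk>horizontally_periodic w; w C1_differentiable_on UNIV; \<And>\<alpha>. norm (w \<alpha> - z t \<alpha>) \<le> \<delta>;
       \<And>\<alpha>. norm (dcurve w \<alpha> - dcurve (z t) \<alpha>) \<le> \<delta>\<rbrakk> \<Longrightarrow> regular (c/2) (A+1) w"
    using regular_stability[OF R] by blast
  obtain C where C: "0 \<le> C"
    "\<And>z w \<delta> \<alpha>. \<lbrakk>regular (c/2) (A+1) z; regular (c/2) (A+1) w; \<And>\<alpha>. norm (z \<alpha> - w \<alpha>) \<le> \<delta>; \<And>\<alpha>. norm (dcurve z \<alpha> - dcurve w \<alpha>) \<le> \<delta>\<rbrakk> \<Longrightarrow>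
       norm (vel z \<alpha> - vel w \<alpha>) \<le> C * \<delta> \<and> norm (dvel z \<alpha> - dvel w \<alpha>) \<le> C * \<delta>"
    using vel_dvel_lipschitz by blast
  obtain \<eta>1 where e1: "0 < \<eta>1"
    "\<And>s. \<bar>s - t\<bar> < \<eta>1 \<Longrightarrow> s \<in> {-T<..<T} \<and> (\<forall>\<alpha>. norm (z s \<alpha> - z t \<alpha>) \<le> \<delta> \<and> norm (dcurve (z s) \<alpha> - dcurve (z t) \<alpha>) \<le> \<delta>)"
    using solves_C1_continuous[OF z t \<delta>(1)] by blast
  obtain \<eta>2 where e2: "0 < \<eta>2"
    "\<And>s. \<bar>s - t\<bar> < \<eta>2 \<Longrightarrow> s \<in> {-T<..<T} \<and> (\<forall>\<alpha>. norm (w s \<alpha> - w t \<alpha>) \<le> \<delta> \<and> norm (dcurve (w s) \<alpha> - dcurve (w t) \<alpha>) \<le> \<delta>)"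
    using solves_C1_continuous[OF w t \<delta>(1)] by blast
  define k where "k = \<bar>\<kappa>\<bar> * C"
  have k: "0 \<le> k" using C(1) by (simp add: k_def)
  \<comment> \<open>The last bound ensures \<open>k \<eta> \<le> 1/2\<close>; the others keep both solutions within \<open>\<delta>\<close> of the curve at time \<open>t\<close>.\<close>
  define \<eta> where "\<eta> = min (min \<eta>1 \<eta>2 / 2) (1 / (2 * (k + 1)))"
  have \<eta>: "0 < \<eta>" using e1(1) e2(1) k by (simp add: \<eta>_def)
  have \<eta>12: "\<eta> < \<eta>1" "\<eta> < \<eta>2" using e1(1) e2(1) by (auto simp: \<eta>_def min_def)
  have k\<eta>: "k * \<eta> \<le> 1/2"
  proof -
    have "k * \<eta> \<le> k * (1 / (2 * (k + 1)))" using k by (intro mult_left_mono) (auto simp: \<eta>_def)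
    also have "\<dots> \<le> 1/2" using k by (simp add: field_simps)
    finally show ?thesis .
  qed
  define S where "S = {s. \<bar>s - t\<bar> \<le> \<eta>}"
  have S: "S = {t - \<eta>..t + \<eta>}" by (auto simp: S_def)
  have cv: "convex S" unfolding S by simp
  have tS: "t \<in> S" using \<eta> by (simp add: S_def)
  have SI: "s \<in> {-T<..<T}" if "s \<in> S" for s using that e1(2)[of s] \<eta>12 by (simp add: S_def)
  have zc: "norm (z s \<alpha> - z t \<alpha>) \<le> \<delta>" "norm (dcurve (z s) \<alpha> - dcurve (z t) \<alpha>) \<le> \<delta>" if "s \<in> S" for s \<alpha>
    using that e1(2)[of s] \<eta>12 by (auto simp: S_def)
  have wc: "norm (w s \<alpha> - z t \<alpha>) \<le> \<delta>" "norm (dcurve (w s) \<alpha> - dcurve (z t) \<alpha>) \<le> \<delta>" if "s \<in> S" for s \<alpha>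
    using that e2(2)[of s] \<eta>12 unfolding eq by (auto simp: S_def)
  have Rz: "regular (c/2) (A+1) (z s)" if s: "s \<in> S" for s
    using solvesD(1)[OF z SI[OF s]] by (intro \<delta>(2) zc[OF s]) (auto simp: C1_holder_curve_def C1_holder_def)
  have Rw: "regular (c/2) (A+1) (w s)" if s: "s \<in> S" for s
    using solvesD(1)[OF w SI[OF s]] by (intro \<delta>(2) wc[OF s]) (auto simp: C1_holder_curve_def C1_holder_def)
  have bound: "norm (z s \<alpha> - w s \<alpha>) \<le> 2 * \<delta> / 2 ^ n \<and> norm (dcurve (z s) \<alpha> - dcurve (w s) \<alpha>) \<le> 2 * \<delta> / 2 ^ n"
    if "s \<in> S" for s n \<alpha>
    using that
  proof (induction n arbitrary: s \<alpha>)
    case 0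
    have tri: "norm (x - y) \<le> 2 * \<delta>" if "norm (x - p) \<le> \<delta>" "norm (y - p) \<le> \<delta>" for x y p :: "real^2"
      using norm_triangle_ineq4[of "x - p" "y - p"] that by simp
    show ?case using tri[OF zc(1)[OF 0] wc(1)[OF 0]] tri[OF zc(2)[OF 0] wc(2)[OF 0]] by simp
  next
    case (Suc n)
    let ?m = "2 * \<delta> / 2 ^ n"
    have l: "norm (vel (z x) \<alpha> - vel (w x) \<alpha>) \<le> C * ?m \<and> norm (dvel (z x) \<alpha> - dvel (w x) \<alpha>) \<le> C * ?m" if x: "x \<in> S" for x \<alpha>
      by (rule C(2)[OF Rz[OF x] Rw[OF x]]) (use Suc.IH[OF x] in blast)+
    have fin: "norm (g s) \<le> 2 * \<delta> / 2 ^ Suc n"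
      if g: "\<And>x. x \<in> S \<Longrightarrow> (g has_vector_derivative \<kappa> *\<^sub>R g' x) (at x within S)" "\<And>x. x \<in> S \<Longrightarrow> norm (g' x) \<le> C * ?m" "g t = 0"
      for g g' :: "real \<Rightarrow> real^2"
    proof -
      have "norm (g s - g t) \<le> (k * ?m) * \<bar>s - t\<bar>"
      proof (rule mean_value_within[OF cv g(1) _ Suc.prems tS])
        show "norm (\<kappa> *\<^sub>R g' x) \<le> k * ?m" if "x \<in> S" for x
          unfolding norm_scaleR k_def mult.assoc by (intro mult_left_mono g(2)[OF that]) simp
      qed
      also have "\<dots> \<le> (k * ?m) * \<eta>" using Suc.prems k \<delta>(1) by (intro mult_left_mono) (auto simp: S_def)
      also have "\<dots> = (k * \<eta>) * ?m" by simp
      also have "\<dots> \<le> 1/2 * ?m" using \<delta>(1) by (intro mult_right_mono k\<eta>) auto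
      finally show ?thesis using g(3) by simp
    qed
    have "((\<lambda>x. z x \<alpha> - w x \<alpha>) has_vector_derivative \<kappa> *\<^sub>R (vel (z x) \<alpha> - vel (w x) \<alpha>)) (at x within S)" if "x \<in> S" for x
      unfolding scaleR_diff_right
      by (intro has_vector_derivative_diff has_vector_derivative_at_within[OF solves_deriv(1)[OF z SI[OF that]]]
          has_vector_derivative_at_within[OF solves_deriv(1)[OF w SI[OF that]]])
    moreover have "((\<lambda>x. dcurve (z x) \<alpha> - dcurve (w x) \<alpha>) has_vector_derivative \<kappa> *\<^sub>R (dvel (z x) \<alpha> - dvel (w x) \<alpha>)) (at x within S)" if "x \<in> S" for x
      unfolding scaleR_diff_right
      by (intro has_vector_derivative_diff has_vector_derivative_at_within[OF solves_deriv(2)[OF z SI[OF that]]]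
          has_vector_derivative_at_within[OF solves_deriv(2)[OF w SI[OF that]]])
    ultimately show ?case
      using fin[of "\<lambda>x. z x \<alpha> - w x \<alpha>" "\<lambda>x. vel (z x) \<alpha> - vel (w x) \<alpha>"]
        fin[of "\<lambda>x. dcurve (z x) \<alpha> - dcurve (w x) \<alpha>" "\<lambda>x. dvel (z x) \<alpha> - dvel (w x) \<alpha>"] l eq by simp
  qed
  have lim: "(\<lambda>n. 2 * \<delta> / 2 ^ n) \<longlonglongrightarrow> 0"
    using tendsto_mult_left[OF LIMSEQ_power_zero[of "1/2::real"], of "2 * \<delta>"] by (simp add: power_divide)
  have "z s \<alpha> = w s \<alpha>" if "s \<in> S" for s \<alpha>
  proof -
    have "norm (z s \<alpha> - w s \<alpha>) \<le> 0"
      by (rule LIMSEQ_le_const[OF lim]) (use bound[OF that] in blast)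
    thus ?thesis by simp
  qed
  thus thesis using that[OF \<eta>] by (auto simp: S_def)
qed

theorem solution_unique:
  assumes z: "solves \<kappa> \<gamma> T z" and w: "solves \<kappa> \<gamma> T w" and eq: "z 0 = w 0" and t: "t \<in> {-T<..<T}"
  shows "z t = w t"
proof -
  let ?I = "{-T<..<T}"
  define U where "U = {t\<in>?I. z t = w t}"
  define V where "V = {t\<in>?I. z t \<noteq> w t}"
  have "open U" unfolding open_dist
  proof
    fix t assume "t \<in> U"
    hence t: "t \<in> ?I" and e: "z t = w t" by (auto simp: U_def)
    obtain \<eta> where \<eta>: "0 < \<eta>" "\<And>s. \<bar>s - t\<bar> \<le> \<eta> \<Longrightarrow> z s = w s" using solves_locally_unique[OF z w t e] by blast
    obtain r where r: "0 < r" "\<And>s. dist s t < r \<Longrightarrow> s \<in> ?I"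
      using t open_greaterThanLessThan[of "-T" T] unfolding open_dist by blast
    show "\<exists>e>0. \<forall>y. dist y t < e \<longrightarrow> y \<in> U"
      by (rule exI[of _ "min \<eta> r"]) (use \<eta> r in \<open>auto simp: U_def dist_real_def\<close>)
  qed
  moreover have "open V" unfolding open_dist
  proof
    fix t assume "t \<in> V"
    then obtain \<alpha> where t: "t \<in> ?I" and a: "z t \<alpha> \<noteq> w t \<alpha>" by (auto simp: V_def)
    define \<epsilon> where "\<epsilon> = norm (z t \<alpha> - w t \<alpha>) / 4"
    have \<epsilon>: "0 < \<epsilon>" using a by (simp add: \<epsilon>_def)
    obtain r1 where r1: "0 < r1" "\<And>s. \<bar>s - t\<bar> < r1 \<Longrightarrow> s \<in> ?I \<and> (\<forall>\<alpha>. norm (z s \<alpha> - z t \<alpha>) \<le> \<epsilon> \<and> norm (dcurve (z s) \<alpha> - dcurve (z t) \<alpha>) \<le> \<epsilon>)"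
      using solves_C1_continuous[OF z t \<epsilon>] by blast
    obtain r2 where r2: "0 < r2" "\<And>s. \<bar>s - t\<bar> < r2 \<Longrightarrow> s \<in> ?I \<and> (\<forall>\<alpha>. norm (w s \<alpha> - w t \<alpha>) \<le> \<epsilon> \<and> norm (dcurve (w s) \<alpha> - dcurve (w t) \<alpha>) \<le> \<epsilon>)"
      using solves_C1_continuous[OF w t \<epsilon>] by blast
    show "\<exists>e>0. \<forall>y. dist y t < e \<longrightarrow> y \<in> V"
    proof (intro exI[of _ "min r1 r2"] conjI allI impI)
      show "0 < min r1 r2" using r1 r2 by simp
      fix s assume s: "dist s t < min r1 r2"
      hence n: "norm (z s \<alpha> - z t \<alpha>) \<le> \<epsilon>" "norm (w s \<alpha> - w t \<alpha>) \<le> \<epsilon>" "s \<in> ?I"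
        using r1(2)[of s] r2(2)[of s] by (auto simp: dist_real_def)
      have "z s \<noteq> w s"
      proof
        assume "z s = w s"
        hence "z t \<alpha> - w t \<alpha> = (w s \<alpha> - w t \<alpha>) - (z s \<alpha> - z t \<alpha>)" by simp
        hence "norm (z t \<alpha> - w t \<alpha>) \<le> \<epsilon> + \<epsilon>" using n norm_triangle_ineq4[of "w s \<alpha> - w t \<alpha>" "z s \<alpha> - z t \<alpha>"] by simp
        thus False using \<epsilon> by (simp add: \<epsilon>_def)
      qed
      thus "s \<in> V" using n by (simp add: V_def)
    qed
  qed
  moreover have "connected ?I" "U \<inter> V \<inter> ?I = {}" "?I \<subseteq> U \<union> V" by (auto simp: U_def V_def)
  ultimately have "U \<inter> ?I = {} \<or> V \<inter> ?I = {}" by (metis connectedD)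
  moreover have "0 \<in> U \<inter> ?I" using t eq by (auto simp: U_def)
  ultimately show ?thesis using t by (auto simp: V_def)
qed

lemma is_solution_iff_solves:
  "is_solution \<rho>p \<rho>m \<gamma> z0 T z \<longleftrightarrow> solves (\<rho>m - \<rho>p) \<gamma> T z \<and> z 0 = z0" (is "?l \<longleftrightarrow> ?r")
proof
  let ?v = "\<lambda>t \<alpha>. (\<rho>m - \<rho>p) *\<^sub>R vel (z t) \<alpha>"
  assume ?l
  then obtain z' where z': "C1_in_time \<gamma> T z z'" "\<And>t \<alpha>. t \<in> {-T<..<T} \<Longrightarrow> z' t \<alpha> = ?v t \<alpha>"
    and r: "z 0 = z0" "\<forall>t\<in>{-T<..<T}. arc_chord_norm (z t) < \<infinity>"
    unfolding is_solution_def stokes_velocity_eq by blast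
  have e: "z' t = ?v t" if "t \<in> {-T<..<T}" for t using z'(2)[OF that] by blast
  have "C1_in_time \<gamma> T z ?v" unfolding C1_in_time_def
  proof (intro conjI ballI)
    fix t assume t: "t \<in> {-T<..<T}"
    note c = z'(1)[unfolded C1_in_time_def]
    show "C1_holder_curve \<gamma> (z t)" "periodic (?v t)" "C1_holder \<gamma> (?v t)"
      using c t e[OF t] by (metis, metis, metis)
    have "((\<lambda>h. C1_holder_norm \<gamma> (\<lambda>\<alpha>. (z (t + h) \<alpha> - z t \<alpha>) /\<^sub>R h - z' t \<alpha>)) \<longlongrightarrow> 0) (at 0)" using c t by blast
    thus "((\<lambda>h. C1_holder_norm \<gamma> (\<lambda>\<alpha>. (z (t + h) \<alpha> - z t \<alpha>) /\<^sub>R h - ?v t \<alpha>)) \<longlongrightarrow> 0) (at 0)" by (simp only: e[OF t])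
    have "((\<lambda>s. C1_holder_norm \<gamma> (\<lambda>\<alpha>. z' s \<alpha> - z' t \<alpha>)) \<longlongrightarrow> 0) (at t)" using c t by blast
    moreover have "\<forall>\<^sub>F s in at t. s \<in> {-T<..<T}" using t by (intro eventually_at_in_open') auto
    hence "\<forall>\<^sub>F s in at t. C1_holder_norm \<gamma> (\<lambda>\<alpha>. z' s \<alpha> - z' t \<alpha>) = C1_holder_norm \<gamma> (\<lambda>\<alpha>. ?v s \<alpha> - ?v t \<alpha>)"
      by eventually_elim (simp only: e e[OF t])
    ultimately show "((\<lambda>s. C1_holder_norm \<gamma> (\<lambda>\<alpha>. ?v s \<alpha> - ?v t \<alpha>)) \<longlongrightarrow> 0) (at t)" by (rule Lim_transform_eventually)
  qed
  thus ?r using r by (simp add: solves_def)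
next
  assume ?r
  thus ?l unfolding is_solution_def solves_def stokes_velocity_eq by blast
qed

theorem proposition3:
  fixes \<rho>p \<rho>m \<gamma> :: real and z0 :: "real \<Rightarrow> real^2"
  assumes "\<rho>p \<noteq> \<rho>m"
    and "0 < \<gamma>" and "\<gamma> < 1"
    and "C1_holder_curve \<gamma> z0"
    and "arc_chord_norm z0 < \<infinity>"
  shows "\<exists>T>0. \<exists>z. is_solution \<rho>p \<rho>m \<gamma> z0 T z \<and>
           (\<forall>w. is_solution \<rho>p \<rho>m \<gamma> z0 T w \<longrightarrow> (\<forall>t\<in>{-T<..<T}. w t = z t))"
proof -
  obtain T z where T: "0 < T" and z: "z 0 = z0" "C1_in_time \<gamma> T z (\<lambda>t \<alpha>. (\<rho>m - \<rho>p) *\<^sub>R vel (z t) \<alpha>)" "\<And>t. arc_chord_norm (z t) < \<infinity>"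
    using holder_solution_exists[OF assms(2-5), of "\<rho>m - \<rho>p"] by blast
  have s: "solves (\<rho>m - \<rho>p) \<gamma> T z" unfolding solves_def using z by blast
  have "w t = z t" if "is_solution \<rho>p \<rho>m \<gamma> z0 T w" "t \<in> {-T<..<T}" for w t
    using that solution_unique[OF _ s] z(1) by (auto simp: is_solution_iff_solves)
  moreover have "is_solution \<rho>p \<rho>m \<gamma> z0 T z" using s z(1) by (simp add: is_solution_iff_solves)
  ultimately show ?thesis using T by blast
qed

end
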